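(* Let $n\geq 4$ be an integer. If $p$ and $q$ are two prime numbers then the following identities between Hecke operators acting on $GL(n)$ Maass cusp forms of level $1$ hold: $$T_{\mathrm{diag}(1,\underbrace{p,\dots,p}_{n-1})}\circ T_{\mathrm{diag}(\underbrace{1,\dots,1}_{n-1},q)}=T_{\mathrm{diag}(1,\underbrace{p,\dots,p}_{n-2},pq)}+\delta_{p=q}\,\frac{p^n-1}{p-1}\,\mathrm{Id}$$ and $$\begin{aligned} T_{\mathrm{diag}(1,\underbrace{p,\dots,p}_{n-2},p^2)}\circ T_{\mathrm{diag}(1,\underbrace{q,\dots,q}_{n-2},q^2)} &=T_{\mathrm{diag}(1,\underbrace{pq,\dots,pq}_{n-2},(pq)^2)} +\delta_{p=q}\,\frac{2p^n-p^2-2p+1}{p-1}\,T_{\mathrm{diag}(1,\underbrace{p,\dots,p}_{n-2},p^2)}\\ &\quad+\delta_{p=q}\,p\,\frac{(p^{n-1}-1)(p^n-1)}{(p-1)^2}\,\mathrm{Id} +\delta_{p=q}(p+1)\,T_{\mathrm{diag}(1,\underbrace{p^2,\dots,p^2}_{n-3},p^3,p^3)}\\ &\quad+\delta_{p=q}(p+1)\,T_{\mathrm{diag}(1,1,\underbrace{p,\dots,p}_{n-3},p^3)} +\delta_{p=q}(p+1)^2\,T_{\mathrm{diag}(1,1,\underbrace{p,\dots,p}_{n-4},p^2,p^2)}. \end{aligned}$$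
   Context: Let $\Lambda_n=GL_n(\mathbb{Z})$. $\mathrm{diag}(a_1,\dots,a_n)$ is the diagonal $n\times n$ matrix with diagonal entries $a_1,\dots,a_n$; $\delta_{p=q}$ is $1$ if $p=q$ and $0$ otherwise; $\mathrm{Id}$ is the identity operator. A $GL(n)$ Maass cusp form of level $1$ is in particular a function $f:GL_n(\mathbb{R})\to\mathbb{C}$ that is left invariant under $\Lambda_n$ and right invariant under $O_n(\mathbb{R})\cdot\mathbb{R}^\times$ (scalar matrices included); moreover it is smooth, cuspidal, and an eigenfunction of the center of the universal enveloping algebra. For $g\in GL_n(\mathbb{Q})$, the double coset $\Lambda_n g\Lambda_n$ is a finite union of right cosets $\Lambda_n\delta$, and the Hecke operator $T_g$ is defined by $$T_g(f)(h)=\sum_{\delta\in\Lambda_n\backslash\Lambda_n g\Lambda_n}f(\delta h),\qquad h\in GL_n(\mathbb{R}).$$ *)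

theory Defs
  imports "HOL-Analysis.Analysis" "HOL-Computational_Algebra.Primes"
begin

(* A finite linear order 'n serves as the index set {1, ..., n} with n = CARD('n); the order is
   needed for diag(a_1, ..., a_n) and for upper triangular block matrices.  A function on GL_n(R)
   is represented by a total function on all real n x n matrices whose values at singular matrices
   are irrelevant. *)

type_synonym 'n rmat = "real^'n^'n"

definition GL_real :: "'n::finite rmat set" where
  "GL_real = {g. invertible g}"

definition GL_int :: "'n::finite rmat set" where
  "GL_int = map_matrix real_of_int ` {A :: int^'n^'n. invertible A}"

(* card {..<i} is the zero-based position of i. *)
definition diag :: "nat list \<Rightarrow> 'n::{finite,linorder} rmat" where
  "diag as = (\<chi> i j. if i = j then real (as ! card {..<i}) else 0)"

definition double_coset :: "'n::finite rmat \<Rightarrow> 'n rmat set" where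
  "double_coset g = {\<gamma> ** g ** \<gamma>' | \<gamma> \<gamma>'. \<gamma> \<in> GL_int \<and> \<gamma>' \<in> GL_int}"

definition right_coset :: "'n::finite rmat \<Rightarrow> 'n rmat set" where
  "right_coset \<delta> = {\<gamma> ** \<delta> | \<gamma>. \<gamma> \<in> GL_int}"

(* To be used for g in GL_n(Q), where the sum is finite, and for f left invariant under GL_n(Z),
   where the chosen representative of a coset does not matter. *)
definition hecke :: "'n::finite rmat \<Rightarrow> ('n rmat \<Rightarrow> complex) \<Rightarrow> ('n rmat \<Rightarrow> complex)" where
  "hecke g f = (\<lambda>h. \<Sum>C \<in> right_coset ` double_coset g. f ((SOME \<delta>. \<delta> \<in> C) ** h))"

fun Ck_on :: "nat \<Rightarrow> 'a::real_normed_vector set \<Rightarrow> ('a \<Rightarrow> 'b::real_normed_vector) \<Rightarrow> bool" where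
  "Ck_on 0 S f \<longleftrightarrow> continuous_on S f"
| "Ck_on (Suc k) S f \<longleftrightarrow>
     (\<forall>x\<in>S. f differentiable (at x)) \<and> (\<forall>v. Ck_on k S (\<lambda>x. frechet_derivative f (at x) v))"

definition smooth_on :: "'a::real_normed_vector set \<Rightarrow> ('a \<Rightarrow> 'b::real_normed_vector) \<Rightarrow> bool" where
  "smooth_on S f \<longleftrightarrow> (\<forall>k. Ck_on k S f)"

(* Action of X in gl_n(R) by the left invariant vector field: for F differentiable at g this is
   the derivative of F (g exp(t X)), equivalently of F (g + t g X), at t = 0. *)
definition lie_deriv :: "'n::finite rmat \<Rightarrow> ('n rmat \<Rightarrow> complex) \<Rightarrow> ('n rmat \<Rightarrow> complex)" where
  "lie_deriv X F = (\<lambda>g. frechet_derivative F (at g) (g ** X))"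

(* The complexified universal enveloping algebra of gl_n(R) acts faithfully on smooth functions
   on GL_n(R); it is realised as the algebra of differential operators generated by gl_n(R). *)
inductive_set univ_env :: "(('n::finite rmat \<Rightarrow> complex) \<Rightarrow> ('n rmat \<Rightarrow> complex)) set" where
  one: "(\<lambda>F. F) \<in> univ_env"
| mult: "P \<in> univ_env \<Longrightarrow> (\<lambda>F. lie_deriv X (P F)) \<in> univ_env"
| add: "P \<in> univ_env \<Longrightarrow> Q \<in> univ_env \<Longrightarrow> (\<lambda>F g. P F g + Q F g) \<in> univ_env"
| scale: "P \<in> univ_env \<Longrightarrow> (\<lambda>F g. c * P F g) \<in> univ_env"

(* Operators are compared by their effect on smooth functions on GL_n(R). *)
definition center_univ_env :: "(('n::finite rmat \<Rightarrow> complex) \<Rightarrow> ('n rmat \<Rightarrow> complex)) set" where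
  "center_univ_env = {P \<in> univ_env. \<forall>Q \<in> univ_env. \<forall>F. smooth_on GL_real F \<longrightarrow>
      (\<forall>g \<in> GL_real. P (Q F) g = Q (P F) g)}"

(* A standard parabolic subgroup is given by the set S of those indices, other than the least one,
   at which a new diagonal block begins.  Its unipotent radical consists of the matrices
   unipotent S X: ones on the diagonal, the entries of X at positions (i, j) with j in a later
   block than i, and zeros elsewhere. *)
definition unipotent :: "'n::{finite,linorder} set \<Rightarrow> 'n rmat \<Rightarrow> 'n rmat" where
  "unipotent S X = (\<chi> i j. if i = j then 1 else if \<exists>s\<in>S. i < s \<and> s \<le> j then X $ i $ j else 0)"

(* For the unipotent radical U of every proper standard parabolic subgroup, the integral of f (u g)
   over U(Z)\U(R) vanishes.  The entries of u running through [0,1] give a fundamental domain;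
   the entries of X that unipotent S X discards also run through [0,1] and contribute a factor 1. *)
definition cuspidal :: "('n::{finite,linorder} rmat \<Rightarrow> complex) \<Rightarrow> bool" where
  "cuspidal f \<longleftrightarrow> (\<forall>S. S \<noteq> {} \<and> (\<forall>s\<in>S. \<exists>i. i < s) \<longrightarrow>
     (\<forall>g \<in> GL_real. ((\<lambda>X. f (unipotent S X ** g)) has_integral 0) (cbox 0 (\<chi> i j. 1))))"

definition maass_cusp_form :: "('n::{finite,linorder} rmat \<Rightarrow> complex) \<Rightarrow> bool" where
  "maass_cusp_form f \<longleftrightarrow>
     (\<forall>\<gamma> \<in> GL_int. \<forall>g \<in> GL_real. f (\<gamma> ** g) = f g) \<and>
     (\<forall>k. orthogonal_matrix k \<longrightarrow> (\<forall>g \<in> GL_real. f (g ** k) = f g)) \<and>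
     (\<forall>c. c \<noteq> 0 \<longrightarrow> (\<forall>g \<in> GL_real. f (c *\<^sub>R g) = f g)) \<and>
     smooth_on GL_real f \<and>
     cuspidal f \<and>
     (\<forall>P \<in> center_univ_env. \<exists>c. \<forall>g \<in> GL_real. P f g = c * f g)"

end

(*
  The coset of a matrix g under left multiplication by GL_n(Z) is the lattice Z^n g spanned by its
  rows, and Smith normal form identifies the double cosets with the relative positions of two
  lattices.  So a Hecke operator sums f over the lattices in a given position relative to
  H = Z^n h.  As f is invariant under scaling, the operators composed in the theorem sum over the
  superlattices of index p, the sublattices of index q, and the neighbours of H, i.e. the lattices
  M such that the intersection of M and H has index p in both.  A composition counts intermediate
  lattices, and the isomorphism theorems reduce this to counting lattices of prime index.  The
  common neighbours M of two neighbours H and D lie just above the intersection of H and D or just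
  below their sum.  If H and D are farther apart, M = K + J, where K and J are chosen independently
  between the intersection of H and D and, respectively, H and D; for each there are 1 or p + 1
  choices according as the quotient is cyclic or elementary abelian.
*)
theory Submission
  imports Defs "HOL-Computational_Algebra.Squarefree"
begin

section \<open>Smith normal form over the integers\<close>

text \<open>The coefficients count paths. Let c = (p^n - 1)/(p - 1) be the number of lattices of
  index p in, or over, a given one. H is reached by c paths in the first identity and by c^2 - c in
  the second, the number of its neighbours: choose a superlattice, then a sublattice, and discard H.
  Two neighbours have 2c - p - 3 common neighbours: c over the intersection, c under the sum, p + 1
  of them counted twice, H and D removed. The factors 1, p + 1 (twice) and (p + 1)^2 belong to the
  four pairs of groups H/(H cap D), D/(H cap D) of order p^2, each cyclic or elementary; these pairs
  are four of the double cosets on the right-hand side. The obstacle is to recognise a double coset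
  from the lattices alone. The two indices suffice if they are squarefree; at p^2 one must also ask
  whether p annihilates each quotient. Quotient groups are never formed: an index is a ratio of
  covolumes, and the isomorphism theorems are read off in a basis adapted to both lattices.\<close>

definition elem_matrix :: "'n \<Rightarrow> 'n \<Rightarrow> int \<Rightarrow> int^'n^'n" where
  "elem_matrix i j c = (\<chi> k l. if k = l then 1 else if k = i \<and> l = j then c else 0)"

lemma elem_matrix_mult:
  fixes A :: "int^'n^'n"
  assumes "i \<noteq> j"
  shows "(elem_matrix i j c ** A) $ k $ l = A $ k $ l + (if k = i then c * A $ j $ l else 0)"
proof -
  have "(elem_matrix i j c ** A) $ k $ l
      = (\<Sum>m\<in>UNIV. (if m = k then A $ k $ l else 0)
          + (if m = j then (if k = i then c * A $ j $ l else 0) else 0))"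
    unfolding matrix_matrix_mult_def elem_matrix_def vec_lambda_beta
    by (rule sum.cong) (use assms in auto)
  then show ?thesis by (simp add: sum.distrib)
qed

lemma mult_elem_matrix:
  fixes A :: "int^'n^'n"
  assumes "i \<noteq> j"
  shows "(A ** elem_matrix i j c) $ k $ l = A $ k $ l + (if l = j then c * A $ k $ i else 0)"
proof -
  have "(A ** elem_matrix i j c) $ k $ l
      = (\<Sum>m\<in>UNIV. (if m = l then A $ k $ l else 0)
          + (if m = i then (if l = j then c * A $ k $ i else 0) else 0))"
    unfolding matrix_matrix_mult_def elem_matrix_def vec_lambda_beta
    by (rule sum.cong) (use assms in auto)
  then show ?thesis by (simp add: sum.distrib)
qed

lemma invertible_elem_matrix:
  assumes "i \<noteq> j"
  shows "invertible (elem_matrix i j c)"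
proof -
  have "elem_matrix i j c ** elem_matrix i j (- c) = mat 1" for c :: int
    by (simp add: vec_eq_iff elem_matrix_mult[OF assms])
      (use assms in \<open>auto simp: elem_matrix_def mat_def\<close>)
  from this[of c] this[of "- c"] show ?thesis
    unfolding invertible_def by auto
qed

text \<open>Operations are confined to the indices in \<open>T\<close>, so that diagonal entries
  already finished outside \<open>T\<close> stay untouched while elimination continues
  inside.\<close>

inductive elem_equiv :: "'n::finite set \<Rightarrow> int^'n^'n \<Rightarrow> int^'n^'n \<Rightarrow> bool" for T A where
  refl: "elem_equiv T A A"
| row: "elem_equiv T A B \<Longrightarrow> i \<in> T \<Longrightarrow> j \<in> T \<Longrightarrow> i \<noteq> j \<Longrightarrow> elem_equiv T A (elem_matrix i j c ** B)"
| col: "elem_equiv T A B \<Longrightarrow> i \<in> T \<Longrightarrow> j \<in> T \<Longrightarrow> i \<noteq> j \<Longrightarrow> elem_equiv T A (B ** elem_matrix i j c)"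

lemma elem_equiv_trans:
  "elem_equiv T B C \<Longrightarrow> elem_equiv T A B \<Longrightarrow> elem_equiv T A C"
  by (induction rule: elem_equiv.induct) (auto intro: elem_equiv.intros)

lemma elem_equiv_mono:
  "elem_equiv T A B \<Longrightarrow> T \<subseteq> S \<Longrightarrow> elem_equiv S A B"
  by (induction rule: elem_equiv.induct) (auto intro!: elem_equiv.intros)

lemma elem_equiv_matrices:
  "elem_equiv T A B \<Longrightarrow> \<exists>U V. invertible U \<and> invertible V \<and> B = U ** A ** V"
proof (induction rule: elem_equiv.induct)
  case refl
  have "invertible (mat 1 :: int^'a^'a)" unfolding invertible_def by (metis matrix_mul_lid)
  then show ?case by (metis matrix_mul_lid matrix_mul_rid)
next
  case (row B i j c)
  then show ?case
    by (metis invertible_elem_matrix invertible_mult matrix_mul_assoc)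
next
  case (col B i j c)
  then show ?case
    by (metis invertible_elem_matrix invertible_mult matrix_mul_assoc)
qed

text \<open>Elimination shrinks the unfinished block \<open>T\<close> from \<open>UNIV\<close>,
  where this is no condition, to \<open>{}\<close>, where the matrix is diagonal.\<close>

definition block_diag :: "'n set \<Rightarrow> int^'n^'n \<Rightarrow> bool" where
  "block_diag T A \<longleftrightarrow> (\<forall>i j. i \<noteq> j \<longrightarrow> i \<notin> T \<or> j \<notin> T \<longrightarrow> A $ i $ j = 0)"

lemma elem_equiv_block_diag:
  "elem_equiv T A B \<Longrightarrow> block_diag T A \<Longrightarrow> block_diag T B \<and> (\<forall>i. i \<notin> T \<longrightarrow> B $ i $ i = A $ i $ i)"
proof (induction rule: elem_equiv.induct)
  case (row B i j c)
  then have B: "block_diag T B" "\<forall>i. i \<notin> T \<longrightarrow> B $ i $ i = A $ i $ i" by auto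
  then have "B $ j $ k = 0" if "k \<notin> T" for k
    using that row unfolding block_diag_def by metis
  then show ?case using B row(2,3) unfolding block_diag_def elem_matrix_mult[OF row(4)] by auto
next
  case (col B i j c)
  then have B: "block_diag T B" "\<forall>i. i \<notin> T \<longrightarrow> B $ i $ i = A $ i $ i" by auto
  then have "B $ k $ i = 0" if "k \<notin> T" for k
    using that col unfolding block_diag_def by metis
  then show ?case using B col(2,3) unfolding block_diag_def mult_elem_matrix[OF col(4)] by auto
qed auto

text \<open>New entries are integer combinations of old ones. Hence a pivot that divides its block
  still divides it after the rest of the block has been diagonalised.\<close>

lemma elem_equiv_dvd:
  fixes m :: int
  shows "elem_equiv T A B \<Longrightarrow> \<forall>i\<in>T. \<forall>j\<in>T. m dvd A $ i $ j \<Longrightarrow> i \<in> T \<Longrightarrow> j \<in> T \<Longrightarrow> m dvd B $ i $ j"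
proof (induction arbitrary: i j rule: elem_equiv.induct)
  case (row B i' j' c)
  then show ?case by (auto simp: elem_matrix_mult)
next
  case (col B i' j' c)
  then show ?case by (auto simp: mult_elem_matrix)
qed auto

text \<open>Additions replace the usual swaps: where needed, row \<open>i\<close> is added to row
  \<open>t\<close>, and then column \<open>j\<close> to column \<open>t\<close>.\<close>

lemma elem_equiv_pivot_nonzero:
  fixes A :: "int^'n::finite^'n"
  assumes t: "t \<in> T" and ij: "i \<in> T" "j \<in> T" "A $ i $ j \<noteq> 0"
  shows "\<exists>B. elem_equiv T A B \<and> B $ t $ t \<noteq> 0"
proof -
  have 1: "\<exists>B. elem_equiv T C B \<and> B $ t $ t \<noteq> 0" if "C $ t $ j \<noteq> 0" for C
  proof (cases "C $ t $ t = 0")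
    case True
    then have "j \<noteq> t" using that by auto
    then have "elem_equiv T C (C ** elem_matrix j t 1)"
      by (intro elem_equiv.col elem_equiv.refl t ij)
    moreover have "(C ** elem_matrix j t 1) $ t $ t \<noteq> 0"
      using \<open>j \<noteq> t\<close> True that by (simp add: mult_elem_matrix)
    ultimately show ?thesis by blast
  qed (auto intro: elem_equiv.refl)
  show ?thesis
  proof (cases "A $ t $ j = 0")
    case True
    then have "i \<noteq> t" using ij by auto
    then have "elem_equiv T A (elem_matrix t i 1 ** A)"
      by (intro elem_equiv.row elem_equiv.refl t ij) auto
    moreover have "(elem_matrix t i 1 ** A) $ t $ j \<noteq> 0"
      using \<open>i \<noteq> t\<close> True ij by (simp add: elem_matrix_mult)
    ultimately show ?thesis using 1 elem_equiv_trans by blast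
  qed (use 1 in blast)
qed

text \<open>One round of the Euclidean algorithm by additions alone: \<open>b\<close> first becomes
  its residue \<open>r\<close> modulo \<open>\<bar>a\<bar>\<close>, then \<open>a\<close> is reduced
  modulo \<open>r\<close>. The pivot itself has to shrink without becoming zero, hence the two
  conclusions.\<close>

lemma smaller_combination:
  fixes a b :: int
  assumes "a \<noteq> 0" "\<not> a dvd b"
  obtains c d where "a + d * (b + c * a) \<noteq> 0" "\<bar>a + d * (b + c * a)\<bar> < \<bar>a\<bar>"
proof -
  define r where "r = b mod \<bar>a\<bar>"
  have "b mod \<bar>a\<bar> \<noteq> 0" using assms(2) by (simp add: mod_eq_0_iff_dvd)
  moreover have "0 \<le> b mod \<bar>a\<bar>" "b mod \<bar>a\<bar> < \<bar>a\<bar>" using assms(1) by simp_all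
  ultimately have r: "0 < r" "r < \<bar>a\<bar>" unfolding r_def by linarith+
  define c where "c = - (b div \<bar>a\<bar>) * sgn a"
  have "r = b - (b div \<bar>a\<bar>) * \<bar>a\<bar>" by (simp add: r_def minus_div_mult_eq_mod)
  also have "(b div \<bar>a\<bar>) * \<bar>a\<bar> = (b div \<bar>a\<bar>) * sgn a * a"
    by (metis abs_sgn mult.assoc mult.commute)
  finally have rc: "b + c * a = r" by (simp add: c_def)
  \<comment> \<open>Dividing \<open>a - 1\<close> instead of \<open>a\<close> places the remainder
    among 1, ..., r rather than 0, ..., r - 1.\<close>
  define d where "d = - ((a - 1) div r)"
  have "a + d * r = 1 + (a - 1) mod r"
    unfolding d_def using div_mult_mod_eq[of "a - 1" r] by linarith
  moreover have "0 \<le> (a - 1) mod r" "(a - 1) mod r < r" using r by auto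
  ultimately have "a + d * r \<noteq> 0" "\<bar>a + d * r\<bar> < \<bar>a\<bar>" using r by linarith+
  then show ?thesis using that[of d c] unfolding rc by blast
qed

text \<open>Take an equivalent matrix whose entry at (t, t) is nonzero and of least absolute value.
  By \<open>smaller_combination\<close>, an entry of its row or column not divisible by the pivot
  would produce a smaller one. So row and column can be cleared, and minimality is used once more
  for the remaining entries.\<close>

lemma elem_equiv_pivot_divides:
  fixes A :: "int^'n::finite^'n"
  assumes t: "t \<in> T" and ij: "i \<in> T" "j \<in> T" "A $ i $ j \<noteq> 0"
  shows "\<exists>B. elem_equiv T A B \<and> B $ t $ t \<noteq> 0 \<and> (\<forall>i\<in>T - {t}. B $ i $ t = 0)
      \<and> (\<forall>j\<in>T - {t}. B $ t $ j = 0) \<and> (\<forall>i\<in>T. \<forall>j\<in>T. B $ t $ t dvd B $ i $ j)"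
proof -
  define P where "P B \<longleftrightarrow> elem_equiv T A B \<and> B $ t $ t \<noteq> 0" for B
  obtain B where PB: "P B" and minB: "\<And>C. P C \<Longrightarrow> nat \<bar>B $ t $ t\<bar> \<le> nat \<bar>C $ t $ t\<bar>"
    using elem_equiv_pivot_nonzero[OF assms] ex_has_least_nat[of P _ "\<lambda>B. nat \<bar>B $ t $ t\<bar>"]
    unfolding P_def by blast
  define m where "m = B $ t $ t"
  have m: "m \<noteq> 0" using PB by (auto simp: P_def m_def)
  have least: "\<not> \<bar>C $ t $ t\<bar> < \<bar>m\<bar>" if "elem_equiv T B C" "C $ t $ t \<noteq> 0" for C
    using minB[of C] that PB elem_equiv_trans[of T B C A] unfolding P_def m_def by fastforce
  have row: "m dvd C $ t $ j" if C: "elem_equiv T B C" "C $ t $ t = m" and j: "j \<in> T" for C j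
  proof (rule ccontr)
    assume nd: "\<not> m dvd C $ t $ j"
    then have jt: "j \<noteq> t" "t \<noteq> j" using C by auto
    obtain c d where cd: "m + d * (C $ t $ j + c * m) \<noteq> 0" "\<bar>m + d * (C $ t $ j + c * m)\<bar> < \<bar>m\<bar>"
      using smaller_combination[OF m nd] by blast
    let ?D = "(C ** elem_matrix t j c) ** elem_matrix j t d"
    have "elem_equiv T B ?D" using C j t jt by (intro elem_equiv.col) auto
    moreover have "?D $ t $ t = m + d * (C $ t $ j + c * m)"
      using jt C by (simp add: mult_elem_matrix)
    ultimately show False using least cd by metis
  qed
  have col: "m dvd C $ j $ t" if C: "elem_equiv T B C" "C $ t $ t = m" and j: "j \<in> T" for C j
  proof (rule ccontr)
    assume nd: "\<not> m dvd C $ j $ t"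
    then have jt: "j \<noteq> t" "t \<noteq> j" using C by auto
    obtain c d where cd: "m + d * (C $ j $ t + c * m) \<noteq> 0" "\<bar>m + d * (C $ j $ t + c * m)\<bar> < \<bar>m\<bar>"
      using smaller_combination[OF m nd] by blast
    let ?D = "elem_matrix t j d ** (elem_matrix j t c ** C)"
    have "elem_equiv T B ?D" using C j t jt by (intro elem_equiv.row) auto
    moreover have "?D $ t $ t = m + d * (C $ j $ t + c * m)"
      using jt C by (simp add: elem_matrix_mult)
    ultimately show False using least cd by metis
  qed
  have clear_row: "\<exists>C. elem_equiv T B C \<and> C $ t $ t = m \<and> (\<forall>j\<in>S. C $ t $ j = 0)"
    if "finite S" "S \<subseteq> T - {t}" for S
    using that
  proof (induction S)
    case empty
    then show ?case by (auto intro: elem_equiv.refl simp: m_def)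
  next
    case (insert j S)
    then obtain C where C: "elem_equiv T B C" "C $ t $ t = m" "\<forall>j\<in>S. C $ t $ j = 0" by auto
    have j: "j \<in> T" "j \<noteq> t" "t \<noteq> j" using insert by auto
    obtain k where k: "C $ t $ j = m * k" using row[OF C(1,2) j(1)] by auto
    have "elem_equiv T B (C ** elem_matrix t j (- k))" using C j t by (intro elem_equiv.col) auto
    then show ?case using j C k insert(2)
      by (intro exI[of _ "C ** elem_matrix t j (- k)"]) (auto simp: mult_elem_matrix)
  qed
  obtain C where C: "elem_equiv T B C" "C $ t $ t = m" "\<forall>j\<in>T - {t}. C $ t $ j = 0"
    using clear_row[of "T - {t}"] by auto
  have clear_col: "\<exists>C. elem_equiv T B C \<and> C $ t $ t = m \<and> (\<forall>j\<in>T - {t}. C $ t $ j = 0)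
      \<and> (\<forall>j\<in>S. C $ j $ t = 0)"
    if "finite S" "S \<subseteq> T - {t}" for S
    using that
  proof (induction S)
    case empty
    then show ?case using C by auto
  next
    case (insert j S)
    then obtain C where C: "elem_equiv T B C" "C $ t $ t = m" "\<forall>j\<in>T - {t}. C $ t $ j = 0"
      "\<forall>j\<in>S. C $ j $ t = 0" by auto
    have j: "j \<in> T" "j \<noteq> t" "t \<noteq> j" using insert by auto
    obtain k where k: "C $ j $ t = m * k" using col[OF C(1,2) j(1)] by auto
    have "elem_equiv T B (elem_matrix j t (- k) ** C)" using C j t by (intro elem_equiv.row) auto
    then show ?case using j C k insert(2)
      by (intro exI[of _ "elem_matrix j t (- k) ** C"]) (auto simp: elem_matrix_mult)
  qed
  obtain C where C: "elem_equiv T B C" "C $ t $ t = m" "\<forall>j\<in>T - {t}. C $ t $ j = 0"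
    "\<forall>j\<in>T - {t}. C $ j $ t = 0"
    using clear_col[of "T - {t}"] by auto
  have "m dvd C $ i $ j" if ij: "i \<in> T" "j \<in> T" for i j
  proof (cases "i = t \<or> j = t")
    case True
    then show ?thesis using row[OF C(1,2)] col[OF C(1,2)] ij by auto
  next
    case False
    \<comment> \<open>Row and column \<open>t\<close> are already cleared, so adding row
      \<open>i\<close> keeps the pivot and copies the entry (i, j) into row \<open>t\<close>, where
      \<open>row\<close> applies.\<close>
    let ?D = "elem_matrix t i 1 ** C"
    have "elem_equiv T B ?D" using C ij t False by (intro elem_equiv.row) auto
    moreover have "?D $ t $ t = m" using C False ij by (auto simp: elem_matrix_mult)
    ultimately have "m dvd ?D $ t $ j" using row ij by blast
    then show ?thesis using C False ij by (auto simp: elem_matrix_mult)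
  qed
  moreover have "elem_equiv T A C" using elem_equiv_trans C PB P_def by blast
  ultimately show ?thesis using C m by blast
qed

text \<open>The index \<open>t\<close> inserted by the induction precedes all of \<open>T\<close>.
  Its pivot divides the whole remaining block, and \<open>elem_equiv_dvd\<close> preserves this;
  that is what orders the divisibility chain along the indices.\<close>

lemma smith_normal_form_block:
  fixes A :: "int^'n::{finite,linorder}^'n::{finite,linorder}"
  assumes "block_diag T A"
  shows "\<exists>B. elem_equiv T A B \<and> block_diag {} B
      \<and> (\<forall>i\<in>T. \<forall>j\<in>T. i \<le> j \<longrightarrow> B $ i $ i dvd B $ j $ j)"
  using finite[of T] assms
proof (induction T arbitrary: A rule: finite_linorder_min_induct)
  case empty
  then show ?case by (auto intro: elem_equiv.refl)
next
  case (insert t T)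
  let ?T = "insert t T"
  have tT: "t \<notin> T" using insert by auto
  show ?case
  proof (cases "\<exists>i\<in>?T. \<exists>j\<in>?T. A $ i $ j \<noteq> 0")
    case False
    have "A $ i $ j = 0" if "i \<noteq> j" for i j
      using False insert.prems that unfolding block_diag_def by blast
    then have "block_diag {} A" by (simp add: block_diag_def)
    then show ?thesis using False by (intro exI[of _ A]) (auto intro: elem_equiv.refl)
  next
    case True
    then obtain k l where "k \<in> ?T" "l \<in> ?T" "A $ k $ l \<noteq> 0" by blast
    from elem_equiv_pivot_divides[OF insertI1 this]
    obtain B where B: "elem_equiv ?T A B" "\<forall>i\<in>?T - {t}. B $ i $ t = 0"
      "\<forall>j\<in>?T - {t}. B $ t $ j = 0" "\<forall>i\<in>?T. \<forall>j\<in>?T. B $ t $ t dvd B $ i $ j"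
      by auto
    have bdB: "block_diag ?T B" using elem_equiv_block_diag[OF B(1)] insert.prems by simp
    have "block_diag T B"
      unfolding block_diag_def
    proof (intro allI impI)
      fix i j assume "i \<noteq> j" "i \<notin> T \<or> j \<notin> T"
      moreover have "i = t \<Longrightarrow> j \<in> T \<Longrightarrow> B $ i $ j = 0" "j = t \<Longrightarrow> i \<in> T \<Longrightarrow> B $ i $ j = 0"
        using B(2,3) tT by auto
      ultimately show "B $ i $ j = 0" using bdB unfolding block_diag_def by blast
    qed
    from insert.IH[OF this] obtain C where C: "elem_equiv T B C" "block_diag {} C"
      "\<forall>i\<in>T. \<forall>j\<in>T. i \<le> j \<longrightarrow> C $ i $ i dvd C $ j $ j" by blast
    have "elem_equiv ?T A C" using elem_equiv_trans elem_equiv_mono[OF C(1), of ?T] B by blast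
    moreover have "C $ t $ t = B $ t $ t" using elem_equiv_block_diag[OF C(1) \<open>block_diag T B\<close>] tT by auto
    moreover have "B $ t $ t dvd C $ j $ j" if "j \<in> T" for j
      using elem_equiv_dvd[OF C(1)] B(4) that by blast
    moreover have "\<not> j \<le> t" if "j \<in> T" for j using insert that by (simp add: not_le)
    ultimately show ?thesis using C by (intro exI[of _ C]) auto
  qed
qed

theorem smith_normal_form:
  fixes A :: "int^'n::{finite,linorder}^'n::{finite,linorder}"
  obtains U V :: "int^'n::{finite,linorder}^'n::{finite,linorder}" and s where "invertible U" "invertible V" "U ** A ** V = (\<chi> i j. if i = j then s i else 0)"
    "\<And>i j. i \<le> j \<Longrightarrow> s i dvd s j"
proof -
  have "block_diag UNIV A" by (simp add: block_diag_def)
  from smith_normal_form_block[OF this] obtain B where B: "elem_equiv UNIV A B" "block_diag {} B"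
    "\<And>i j. i \<le> j \<Longrightarrow> B $ i $ i dvd B $ j $ j" by auto
  obtain U V where UV: "invertible U" "invertible V" "B = U ** A ** V"
    using elem_equiv_matrices[OF B(1)] by blast
  show ?thesis
  proof (rule that[OF UV(1,2)])
    show "U ** A ** V = (\<chi> i j. if i = j then B $ i $ i else 0)"
      using B(2) UV(3) by (auto simp: vec_eq_iff block_diag_def)
  qed (rule B(3))
qed

section \<open>Row lattices and adapted bases\<close>

lemma matrix_inv_mult:
  fixes g :: "real^'n^'n"
  assumes "invertible g"
  shows "g ** matrix_inv g = mat 1" "matrix_inv g ** g = mat 1"
  using someI_ex[OF assms[unfolded invertible_def]] unfolding matrix_inv_def by auto

lemma invertible_matrix_inv:
  fixes g :: "real^'n^'n"
  shows "invertible g \<Longrightarrow> invertible (matrix_inv g)"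
  using matrix_inv_mult unfolding invertible_def by blast

definition int_matrix :: "real^'n^'n \<Rightarrow> bool" where
  "int_matrix A \<longleftrightarrow> (\<forall>i j. A $ i $ j \<in> \<int>)"

lemma int_matrix_mult: "int_matrix A \<Longrightarrow> int_matrix B \<Longrightarrow> int_matrix (A ** B)"
  unfolding int_matrix_def matrix_matrix_mult_def by (auto intro!: Ints_sum Ints_mult)

lemma int_matrix_1: "int_matrix (mat 1)"
  by (auto simp: int_matrix_def mat_def)

lemma map_matrix_of_int_mult:
  fixes A B :: "int^'n^'n"
  shows "map_matrix real_of_int (A ** B) = map_matrix real_of_int A ** map_matrix real_of_int B"
  by (simp add: vec_eq_iff matrix_matrix_mult_def)

lemma map_matrix_of_int_1: "map_matrix real_of_int (mat 1) = mat 1"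
  by (simp add: vec_eq_iff mat_def)

lemma int_matrix_map_matrix: "int_matrix (map_matrix real_of_int A)"
  by (simp add: int_matrix_def)

lemma int_matrix_cases:
  assumes "int_matrix A"
  obtains B where "A = map_matrix real_of_int B"
proof
  show "A = map_matrix real_of_int (\<chi> i j. \<lfloor>A $ i $ j\<rfloor>)"
    using assms by (auto simp: vec_eq_iff int_matrix_def)
qed

lemma map_matrix_of_int_inj: "map_matrix real_of_int A = map_matrix real_of_int B \<Longrightarrow> A = B"
  by (simp add: vec_eq_iff)

text \<open>Trades the type of integer matrices in \<open>GL_int_def\<close> for a predicate on real
  ones, where inverses, determinants and lattices live.\<close>

lemma GL_int_iff:
  fixes A :: "real^'n^'n"
  shows "A \<in> GL_int \<longleftrightarrow> int_matrix A \<and> (\<exists>B. int_matrix B \<and> A ** B = mat 1 \<and> B ** A = mat 1)"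
proof
  assume "A \<in> GL_int"
  then obtain C D where "A = map_matrix real_of_int C" "C ** D = mat 1" "D ** C = mat 1"
    unfolding GL_int_def invertible_def by auto
  then show "int_matrix A \<and> (\<exists>B. int_matrix B \<and> A ** B = mat 1 \<and> B ** A = mat 1)"
    by (metis int_matrix_map_matrix map_matrix_of_int_mult map_matrix_of_int_1)
next
  assume "int_matrix A \<and> (\<exists>B. int_matrix B \<and> A ** B = mat 1 \<and> B ** A = mat 1)"
  then obtain B where B: "int_matrix A" "int_matrix B" "A ** B = mat 1" "B ** A = mat 1" by auto
  obtain C where C: "A = map_matrix real_of_int C" using int_matrix_cases B by blast
  obtain D where D: "B = map_matrix real_of_int D" using int_matrix_cases B by blast
  have "C ** D = mat 1 \<and> D ** C = mat 1"
    using B C D map_matrix_of_int_inj by (metis map_matrix_of_int_mult map_matrix_of_int_1)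
  then show "A \<in> GL_int" using C unfolding GL_int_def invertible_def by blast
qed

lemma GL_int_1: "mat 1 \<in> GL_int"
  unfolding GL_int_iff by (metis int_matrix_1 matrix_mul_lid)

lemma GL_int_mult: "A \<in> GL_int \<Longrightarrow> B \<in> GL_int \<Longrightarrow> A ** B \<in> GL_int"
proof -
  assume "A \<in> GL_int" "B \<in> GL_int"
  then obtain A' B' where *: "int_matrix A" "int_matrix A'" "A ** A' = mat 1" "A' ** A = mat 1"
    "int_matrix B" "int_matrix B'" "B ** B' = mat 1" "B' ** B = mat 1"
    by (auto simp: GL_int_iff)
  have "(A ** B) ** (B' ** A') = A ** (B ** B') ** A'" "(B' ** A') ** (A ** B) = B' ** (A' ** A) ** B"
    by (simp_all add: matrix_mul_assoc)
  then have "(A ** B) ** (B' ** A') = mat 1" "(B' ** A') ** (A ** B) = mat 1"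
    by (simp_all add: *)
  moreover have "int_matrix (A ** B)" "int_matrix (B' ** A')" using * by (simp_all add: int_matrix_mult)
  ultimately show ?thesis unfolding GL_int_iff by blast
qed

lemma GL_int_inverse:
  assumes "A \<in> GL_int"
  obtains B where "B \<in> GL_int" "A ** B = mat 1" "B ** A = mat 1"
  using assms unfolding GL_int_iff by blast

lemma GL_int_invertible: "A \<in> GL_int \<Longrightarrow> invertible A"
  unfolding GL_int_iff invertible_def by blast

lemma det_int_matrix: "int_matrix A \<Longrightarrow> det A \<in> \<int>"
  unfolding det_def int_matrix_def by (auto intro!: Ints_sum Ints_mult Ints_prod)

lemma abs_det_GL_int:
  assumes "A \<in> GL_int"
  shows "\<bar>det A\<bar> = 1"
proof -
  obtain B where B: "int_matrix B" "A ** B = mat 1" "int_matrix A" using assms GL_int_iff by metis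
  obtain a b :: int where ab: "det A = a" "det B = b"
    using det_int_matrix[OF B(3)] det_int_matrix[OF B(1)] by (auto elim!: Ints_cases)
  have "det A * det B = 1" using B by (metis det_I det_mul)
  then have "a * b = 1" unfolding ab by (metis of_int_1 of_int_eq_iff of_int_mult)
  then have "\<bar>a\<bar> = 1" using zmult_eq_1_iff[of a b] by auto
  then show ?thesis unfolding ab by (metis of_int_1 of_int_abs)
qed

section \<open>Lattices as cosets of matrices, and their covolumes\<close>

definition lat :: "'n::finite rmat \<Rightarrow> (real^'n) set" where
  "lat g = {x v* g | x. \<forall>i. x $ i \<in> \<int>}"

definition lattices :: "(real^'n) set set" where
  "lattices = {lat g | g. invertible g}"

lemma lattices_lat: "invertible g \<Longrightarrow> lat g \<in> lattices"
  unfolding lattices_def by blast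

lemma vector_matrix_mult_inv:
  fixes g :: "real^'n^'n"
  assumes "invertible g"
  shows "(v v* g) v* matrix_inv g = v" "(v v* matrix_inv g) v* g = v"
  using matrix_inv_mult[OF assms] by (simp_all add: vector_matrix_mul_assoc)

lemma lat_iff:
  assumes "invertible g"
  shows "v \<in> lat g \<longleftrightarrow> (\<forall>i. (v v* matrix_inv g) $ i \<in> \<int>)"
  unfolding lat_def using vector_matrix_mult_inv[OF assms] by (smt (verit, best) mem_Collect_eq)

lemma lat_add: "x \<in> lat g \<Longrightarrow> y \<in> lat g \<Longrightarrow> x + y \<in> lat g"
  unfolding lat_def by (force simp flip: vector_matrix_left_distrib intro: Ints_add)

lemma lat_diff: "x \<in> lat g \<Longrightarrow> y \<in> lat g \<Longrightarrow> x - y \<in> lat g"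
  unfolding lat_def by (force simp flip: vector_matrix_mult_diff_distrib intro: Ints_diff)

lemma lat_0: "0 \<in> lat g"
  unfolding lat_def by (force intro!: exI[of _ 0])

lemma lat_scale_int:
  assumes "x \<in> lat g"
  shows "real_of_int k *\<^sub>R x \<in> lat g"
proof -
  obtain y where "x = y v* g" "\<forall>i. y $ i \<in> \<int>" using assms lat_def by blast
  then have "real_of_int k *\<^sub>R x = (real_of_int k *\<^sub>R y) v* g" "\<forall>i. (real_of_int k *\<^sub>R y) $ i \<in> \<int>"
    by (simp_all add: scaleR_vector_matrix_assoc)
  then show ?thesis unfolding lat_def by blast
qed

lemma lattice_closed:
  assumes "L \<in> lattices"
  shows "0 \<in> L" "x \<in> L \<Longrightarrow> y \<in> L \<Longrightarrow> x + y \<in> L" "x \<in> L \<Longrightarrow> y \<in> L \<Longrightarrow> x - y \<in> L"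
    "x \<in> L \<Longrightarrow> real_of_int k *\<^sub>R x \<in> L" "x \<in> L \<Longrightarrow> real m *\<^sub>R x \<in> L"
  using assms lat_add lat_diff lat_0 lat_scale_int[of _ _ k] lat_scale_int[of _ _ "int m"]
  unfolding lattices_def by auto

lemma lat_mult_subset: "int_matrix A \<Longrightarrow> lat (A ** g) \<subseteq> lat g"
proof
  fix v
  assume A: "int_matrix A" and "v \<in> lat (A ** g)"
  then obtain x where x: "v = (x v* A) v* g" "\<forall>i. x $ i \<in> \<int>"
    unfolding lat_def by (auto simp: vector_matrix_mul_assoc)
  have "\<forall>i. (x v* A) $ i \<in> \<int>"
    using A x(2) unfolding int_matrix_def vector_matrix_mult_def by (auto intro!: Ints_sum Ints_mult)
  then show "v \<in> lat g" unfolding lat_def x(1) by blast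
qed

lemma row_in_lat: "row i g \<in> lat g"
proof -
  have "row i g = axis i 1 v* g"
    by (simp add: vec_eq_iff row_def vector_matrix_mult_def axis_def if_distrib if_distribR cong: if_cong)
  moreover have "\<forall>j. axis i (1::real) $ j \<in> \<int>" by (simp add: axis_def)
  ultimately show ?thesis unfolding lat_def by blast
qed

lemma row_mult: "row i (A ** B) = row i A v* B"
  by (simp add: vec_eq_iff row_def vector_matrix_mult_def matrix_matrix_mult_def)

lemma int_matrix_if_rows_in_lat:
  assumes "invertible g" "\<And>i. row i h \<in> lat g"
  shows "int_matrix (h ** matrix_inv g)"
  unfolding int_matrix_def
proof (intro allI)
  fix i j
  have "(h ** matrix_inv g) $ i $ j = (row i h v* matrix_inv g) $ j"
    unfolding row_mult[symmetric] by (simp add: row_def)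
  then show "(h ** matrix_inv g) $ i $ j \<in> \<int>" using assms lat_iff by metis
qed

lemma mult_inv_cancel:
  fixes g :: "real^'n^'n"
  assumes "invertible g"
  shows "(h ** matrix_inv g) ** g = h" "(h ** g) ** matrix_inv g = h"
  using matrix_inv_mult[OF assms] by (simp_all flip: matrix_mul_assoc)

text \<open>Each transition matrix is integral because the rows of one basis lie in the lattice of
  the other, and the two are inverse to each other.\<close>

lemma lat_eq_iff:
  assumes "invertible g" "invertible h"
  shows "lat g = lat h \<longleftrightarrow> (\<exists>\<gamma>\<in>GL_int. g = \<gamma> ** h)"
proof
  assume eq: "lat g = lat h"
  let ?A = "g ** matrix_inv h" and ?B = "h ** matrix_inv g"
  have "int_matrix ?A" "int_matrix ?B" using assms int_matrix_if_rows_in_lat row_in_lat eq by metis+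
  moreover have "?A ** ?B = mat 1" "?B ** ?A = mat 1"
    using mult_inv_cancel assms matrix_inv_mult by (metis matrix_mul_assoc)+
  ultimately have "?A \<in> GL_int" unfolding GL_int_iff by blast
  then show "\<exists>\<gamma>\<in>GL_int. g = \<gamma> ** h" using mult_inv_cancel(1)[OF assms(2)] by metis
next
  assume "\<exists>\<gamma>\<in>GL_int. g = \<gamma> ** h"
  then obtain A B where "int_matrix A" "int_matrix B" "A ** B = mat 1" "B ** A = mat 1" "g = A ** h"
    by (auto simp: GL_int_iff)
  then have "h = B ** g" by (simp add: matrix_mul_assoc)
  with lat_mult_subset \<open>int_matrix A\<close> \<open>int_matrix B\<close> \<open>g = A ** h\<close> show "lat g = lat h" by (metis subset_antisym)
qed

text \<open>Independent of the chosen basis because elements of \<open>GL_int\<close> have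
  determinant 1 or -1. Ratios of covolumes serve as indices, which makes the multiplicativity of the
  index plain arithmetic.\<close>

definition covol :: "(real^'n) set \<Rightarrow> real" where
  "covol L = \<bar>det (SOME g. invertible g \<and> lat g = L)\<bar>"

lemma covol_lat:
  assumes "invertible g"
  shows "covol (lat g) = \<bar>det g\<bar>"
proof -
  let ?h = "SOME h. invertible h \<and> lat h = lat g"
  have h: "invertible ?h \<and> lat ?h = lat g" by (rule someI[of _ g]) (use assms in simp)
  then obtain \<gamma> where "\<gamma> \<in> GL_int" "?h = \<gamma> ** g" using lat_eq_iff assms by blast
  then have "\<bar>det ?h\<bar> = \<bar>det g\<bar>" by (simp add: det_mul abs_mult abs_det_GL_int)
  then show ?thesis unfolding covol_def .
qed

lemma covol_pos: "L \<in> lattices \<Longrightarrow> covol L > 0"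
  unfolding lattices_def using covol_lat invertible_det_nz by fastforce

section \<open>Diagonal positions and adapted bases of a pair of lattices\<close>

definition dmat :: "('n \<Rightarrow> real) \<Rightarrow> 'n::finite rmat" where
  "dmat d = (\<chi> i j. if i = j then d i else 0)"

lemma det_dmat: "det (dmat d) = prod d UNIV"
  by (subst det_diagonal) (auto simp: dmat_def)

lemma vector_matrix_dmat: "(x v* dmat d) $ i = x $ i * d i"
  by (simp add: vector_matrix_mult_def dmat_def if_distrib cong: if_cong)

lemma invertible_dmat: "(\<And>i. d i \<noteq> 0) \<Longrightarrow> invertible (dmat d)"
  by (simp add: invertible_det_nz det_dmat)

lemma lat_dmat_iff:
  assumes "invertible e" "\<And>i. d i \<noteq> 0"
  shows "v \<in> lat (dmat d ** e) \<longleftrightarrow> (\<forall>i. (v v* matrix_inv e) $ i / d i \<in> \<int>)"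
proof
  assume "v \<in> lat (dmat d ** e)"
  then obtain x where x: "v = x v* dmat d v* e" "\<forall>i. x $ i \<in> \<int>"
    unfolding lat_def by (auto simp: vector_matrix_mul_assoc)
  then have "v v* matrix_inv e = x v* dmat d" using vector_matrix_mult_inv[OF assms(1)] by simp
  then show "\<forall>i. (v v* matrix_inv e) $ i / d i \<in> \<int>"
    using x assms by (simp add: vector_matrix_dmat)
next
  assume *: "\<forall>i. (v v* matrix_inv e) $ i / d i \<in> \<int>"
  define x where "x = (\<chi> i. (v v* matrix_inv e) $ i / d i)"
  have "x v* dmat d = v v* matrix_inv e"
    using assms by (simp add: vec_eq_iff vector_matrix_dmat x_def)
  then have "v = x v* (dmat d ** e)"
    using vector_matrix_mult_inv[OF assms(1)] by (simp flip: vector_matrix_mul_assoc)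
  then show "v \<in> lat (dmat d ** e)" using * unfolding lat_def x_def by (auto intro!: exI[of _ x] simp: x_def)
qed

lemma covol_dmat:
  assumes "invertible e" "\<And>i. d i \<noteq> 0"
  shows "covol (lat (dmat d ** e)) = \<bar>prod d UNIV\<bar> * covol (lat e)"
  using assms by (simp add: covol_lat invertible_mult invertible_dmat det_mul det_dmat abs_mult)

text \<open>The elementary divisors of \<open>D\<close> relative to \<open>H\<close> as fractions
  u/w in lowest terms. Then H/(H cap D) is the sum of the groups Z/u_i and D/(H cap D) that of the
  groups Z/w_i; in the order of divisibility, u increases and w decreases along the indices.\<close>

definition adapted where
  "adapted H D e u w \<longleftrightarrow> invertible e \<and> H = lat e
     \<and> D = lat (dmat (\<lambda>i. real (u i) / real (w i)) ** e)
     \<and> (\<forall>i. u i > 0 \<and> w i > 0 \<and> coprime (u i) (w i))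
     \<and> (\<forall>i j. i \<le> j \<longrightarrow> u i dvd u j \<and> w j dvd w i)"

text \<open>One inclusion of a multiple is enough for commensurability, since both lattices have
  full rank.\<close>

definition commens :: "(real^'n) set \<Rightarrow> (real^'n) set \<Rightarrow> bool" where
  "commens H D \<longleftrightarrow> H \<in> lattices \<and> D \<in> lattices \<and> (\<exists>N>0. \<forall>x\<in>D. real N *\<^sub>R x \<in> H)"

lemma reduced_fraction_dvd:
  fixes s t N :: nat
  assumes "s dvd t" "s > 0" "N > 0"
  shows "s div gcd s N dvd t div gcd t N" "N div gcd t N dvd N div gcd s N"
proof -
  obtain k where k: "t = s * k" using assms by auto
  obtain a b where ab: "s = gcd s N * a" "N = gcd s N * b" "coprime a b"
    using assms gcd_coprime_exists[of s N] by (metis mult.commute gcd_eq_0_iff less_numeral_extra(3))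
  define g where "g = gcd s N"
  have g: "g > 0" using assms g_def by simp
  have s: "s = g * a" and N: "N = g * b" using ab g_def by auto
  have t: "gcd t N = g * gcd (a * k) b" unfolding k s N by (simp add: gcd_mult_distrib_nat mult.assoc)
  also have "gcd (a * k) b = gcd k b" using ab(3)
    by (metis gcd.commute gcd_mult_left_left_cancel coprime_commute)
  finally have t: "gcd t N = g * gcd k b" .
  have "s div gcd s N = a" "N div gcd s N = b" unfolding g_def[symmetric] unfolding s N using g by auto
  moreover have "t div gcd t N = a * (k div gcd k b)" unfolding t unfolding k s
    using g by (simp add: mult.assoc div_mult_swap)
  moreover have "N div gcd t N = b div gcd k b" unfolding t unfolding N using g by simp
  ultimately show "s div gcd s N dvd t div gcd t N" "N div gcd t N dvd N div gcd s N"
    by (auto simp: div_dvd_iff_mult)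
      (metis dvd_div_mult_self dvd_triv_left gcd_dvd2)
qed

text \<open>Smith normal form of the transition matrix from \<open>H\<close> to N D, with N clearing
  the denominators: \<open>U\<close> changes the basis of \<open>D\<close>, the inverse of
  \<open>V\<close> that of \<open>H\<close>. The diagonal entries divided by N are then put in
  lowest terms.\<close>

lemma commens_adapted:
  fixes H D :: "(real^'n::{finite,linorder}) set"
  assumes "commens H D"
  obtains e u w where "adapted H D e u w"
proof -
  obtain h g N where h: "invertible h" "H = lat h" and g: "invertible g" "D = lat g"
    and N: "N > 0" "\<forall>x\<in>D. real N *\<^sub>R x \<in> H"
    using assms unfolding commens_def lattices_def by auto
  have "int_matrix ((real N *\<^sub>R g) ** matrix_inv h)"
  proof (rule int_matrix_if_rows_in_lat[OF h(1)])
    fix i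
    have "row i (real N *\<^sub>R g) = real N *\<^sub>R row i g" by (simp add: vec_eq_iff row_def)
    then show "row i (real N *\<^sub>R g) \<in> lat h" using N h g row_in_lat by metis
  qed
  then obtain A where A: "(real N *\<^sub>R g) ** matrix_inv h = map_matrix real_of_int A"
    using int_matrix_cases by blast
  then have Ah: "real N *\<^sub>R g = map_matrix real_of_int A ** h" using mult_inv_cancel[OF h(1)] by metis
  obtain U V :: "int^'n::{finite,linorder}^'n::{finite,linorder}" and s where UV: "invertible U" "invertible V"
    and S: "U ** A ** V = (\<chi> i j. if i = j then s i else 0)" and chain: "\<And>i j. i \<le> j \<Longrightarrow> s i dvd s j"
    using smith_normal_form[of A] by blast
  let ?m = "map_matrix real_of_int :: int^'n::{finite,linorder}^'n::{finite,linorder} \<Rightarrow> _"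
  have U: "?m U \<in> GL_int" using UV unfolding GL_int_def by blast
  have V: "?m V \<in> GL_int" using UV unfolding GL_int_def by blast
  obtain W where W: "W \<in> GL_int" "?m V ** W = mat 1" using GL_int_inverse[OF V] by metis
  have S': "?m U ** ?m A ** ?m V = dmat (\<lambda>i. real_of_int (s i))"
    unfolding map_matrix_of_int_mult[symmetric] S by (simp add: vec_eq_iff dmat_def)
  \<comment> \<open>With W inverse to V, the equation U A V = S gives U A h = S (W h), so this is
    the basis of \<open>H\<close> in which \<open>D\<close> becomes diagonal.\<close>
  define e where "e = W ** h"
  have e: "invertible e" "lat e = H"
    using invertible_mult GL_int_invertible W h lat_eq_iff unfolding e_def by blast+
  have "real N *\<^sub>R (?m U ** g) = ?m U ** (real N *\<^sub>R g)"
    by (simp add: matrix_scalar_ac scalar_matrix_assoc)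
  also have "\<dots> = ?m U ** ?m A ** (?m V ** W) ** h"
    unfolding W(2) by (simp add: Ah matrix_mul_assoc)
  also have "\<dots> = dmat (\<lambda>i. real_of_int (s i)) ** e"
    unfolding e_def S'[symmetric] by (simp add: matrix_mul_assoc)
  finally have Ug: "real N *\<^sub>R (?m U ** g) = dmat (\<lambda>i. real_of_int (s i)) ** e" .
  have "invertible (real N *\<^sub>R (?m U ** g))"
    using N g GL_int_invertible[OF U] invertible_mult scalar_invertible by (metis of_nat_0_less_iff less_irrefl)
  then have "det (dmat (\<lambda>i. real_of_int (s i))) \<noteq> 0"
    unfolding Ug by (metis det_mul invertible_det_nz mult_zero_left)
  then have s0: "s i \<noteq> 0" for i by (auto simp: det_dmat)
  have "?m U ** g = dmat (\<lambda>i. real_of_int (s i) / real N) ** e"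
  proof -
    have "?m U ** g = (1 / real N) *\<^sub>R (real N *\<^sub>R (?m U ** g))" using N by simp
    also have "\<dots> = ((1 / real N) *\<^sub>R dmat (\<lambda>i. real_of_int (s i))) ** e"
      unfolding Ug by (simp add: scalar_matrix_assoc)
    also have "(1 / real N) *\<^sub>R dmat (\<lambda>i. real_of_int (s i)) = dmat (\<lambda>i. real_of_int (s i) / real N)"
      by (simp add: vec_eq_iff dmat_def)
    finally show ?thesis .
  qed
  moreover have "lat (?m U ** g) = D"
    using lat_eq_iff[of "?m U ** g" g] g U GL_int_invertible invertible_mult by blast
  ultimately have D: "D = lat (dmat (\<lambda>i. real_of_int (s i) / real N) ** e)" by simp
  define t where "t i = nat \<bar>s i\<bar>" for i
  have t: "t i > 0" for i using s0 by (simp add: t_def)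
  have tdvd: "i \<le> j \<Longrightarrow> t i dvd t j" for i j using chain[of i j] by (simp add: t_def nat_dvd_iff)
  define u where "u i = t i div gcd (t i) N" for i
  define w where "w i = N div gcd (t i) N" for i
  have pos: "u i > 0" "w i > 0" for i
    unfolding u_def w_def using t[of i] N by (simp_all add: div_greater_zero_iff gcd_le1_nat gcd_le2_nat)
  have cop: "coprime (u i) (w i)" for i unfolding u_def w_def by (intro div_gcd_coprime) (use t[of i] in simp)
  have uw: "real (u i) / real (w i) = \<bar>real_of_int (s i)\<bar> / real N" for i
  proof -
    have "real (t i) = real (u i) * real (gcd (t i) N)" "real N = real (w i) * real (gcd (t i) N)"
      unfolding u_def w_def by (simp_all flip: of_nat_mult)
    moreover have "real (t i) = \<bar>real_of_int (s i)\<bar>" by (simp add: t_def)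
    moreover have "real (gcd (t i) N) \<noteq> 0" "real (w i) \<noteq> 0" using N(1) pos[of i] by simp_all
    ultimately show ?thesis by (metis mult_divide_mult_cancel_right)
  qed
  \<comment> \<open>Smith normal form leaves the signs of \<open>s\<close> open, but the lattice
    spanned does not depend on them.\<close>
  have D': "D = lat (dmat (\<lambda>i. real (u i) / real (w i)) ** e)"
  proof (rule set_eqI)
    fix v
    have "(x / (real_of_int (s i) / real N) \<in> \<int>) = (x / (real (u i) / real (w i)) \<in> \<int>)" for x i
    proof (cases "s i \<ge> 0")
      case False
      then have "x / (real_of_int (s i) / real N) = - (x / (real (u i) / real (w i)))"
        unfolding uw by (simp add: abs_if)
      then show ?thesis by (metis Ints_minus minus_minus)
    qed (simp add: uw)
    then show "v \<in> D \<longleftrightarrow> v \<in> lat (dmat (\<lambda>i. real (u i) / real (w i)) ** e)"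
      unfolding D using s0 N pos by (simp add: lat_dmat_iff e)
  qed
  have "u i dvd u j" "w j dvd w i" if "i \<le> j" for i j
    using reduced_fraction_dvd[OF tdvd[OF that]] t N by (simp_all add: u_def w_def)
  then have "adapted H D e u w" unfolding adapted_def
    by (intro conjI allI impI) (rule e(1) e(2)[symmetric] D' pos cop | assumption)+
  then show ?thesis by (rule that)
qed

lemma of_int_divide_in_Ints_iff:
  assumes "b > 0"
  shows "real_of_int a / real b \<in> \<int> \<longleftrightarrow> int b dvd a"
proof
  assume "real_of_int a / real b \<in> \<int>"
  then obtain k where "real_of_int a / real b = of_int k" by (auto elim!: Ints_cases)
  then have "real_of_int a = of_int (k * int b)" using assms by (simp add: field_simps)
  then have "a = k * int b" by (simp only: of_int_eq_iff)
  then show "int b dvd a" by simp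
qed (use assms in auto)

lemma of_nat_divide_in_Ints_iff: "b > 0 \<Longrightarrow> real a / real b \<in> \<int> \<longleftrightarrow> b dvd a"
  using of_int_divide_in_Ints_iff[of b "int a"] by simp

text \<open>Coprimality forces \<open>u\<close> to divide the integer y, so Z meets (u/w)Z in uZ.
  This is one coordinate of \<open>adapted_Int\<close>.\<close>

lemma Ints_div_fraction:
  fixes y :: real and u w :: nat
  assumes "u > 0" "w > 0" "coprime u w"
  shows "y \<in> \<int> \<and> y / (real u / real w) \<in> \<int> \<longleftrightarrow> y / real u \<in> \<int>"
proof
  assume *: "y \<in> \<int> \<and> y / (real u / real w) \<in> \<int>"
  then obtain a b where ab: "y = of_int a" "y / (real u / real w) = of_int b" by (auto elim!: Ints_cases)
  then have "of_int a * real w = of_int b * real u" using assms by (simp add: field_simps)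
  then have "of_int (a * int w) = (of_int (b * int u) :: real)" by simp
  then have "a * int w = b * int u" by (simp only: of_int_eq_iff)
  then have "int u dvd a * int w" by simp
  then have "int u dvd a" using assms(3) by (simp add: coprime_dvd_mult_left_iff)
  then obtain k where "a = int u * k" by blast
  then show "y / real u \<in> \<int>" using ab assms by simp
next
  assume "y / real u \<in> \<int>"
  then obtain k where "y / real u = of_int k" by (auto elim!: Ints_cases)
  then have y: "y = of_int k * real u" using assms by (simp add: field_simps)
  then have "y / (real u / real w) = of_int k * real w" using assms by simp
  then show "y \<in> \<int> \<and> y / (real u / real w) \<in> \<int>" unfolding y by simp
qed

text \<open>By Bezout for \<open>w\<close> and \<open>u\<close>, Z and (u/w)Z together generate
  (1/w)Z. This is one coordinate of \<open>adapted_lsum\<close>.\<close>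

lemma Ints_sum_fraction:
  fixes y :: real and u w :: nat
  assumes "u > 0" "w > 0" "coprime u w"
  shows "(\<exists>x\<in>\<int>. (y - x) / (real u / real w) \<in> \<int>) \<longleftrightarrow> y / (1 / real w) \<in> \<int>"
proof
  assume "\<exists>x\<in>\<int>. (y - x) / (real u / real w) \<in> \<int>"
  then obtain a b where ab: "(y - of_int a) / (real u / real w) = of_int b" by (auto elim!: Ints_cases)
  then have "y / (1 / real w) = of_int (a * int w + b * int u)" using assms by (simp add: field_simps)
  then show "y / (1 / real w) \<in> \<int>" by (metis Ints_of_int)
next
  assume "y / (1 / real w) \<in> \<int>"
  then obtain n where "y / (1 / real w) = of_int n" by (auto elim!: Ints_cases)
  then have y: "y = of_int n / real w" using assms by (simp add: field_simps)
  obtain a b where "a * int w + b * int u = 1"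
    using bezout_int[of "int w" "int u"] assms(3) by (auto simp: coprime_commute)
  then have 1: "real_of_int a * real w + of_int b * real u = 1"
    by (metis of_int_1 of_int_add of_int_mult of_int_of_nat_eq)
  then have "1 - real_of_int a * real w = of_int b * real u" by linarith
  moreover have "y - of_int (n * a) = of_int n * (1 - of_int a * real w) / real w"
    using assms unfolding y by (simp add: field_simps)
  ultimately have "(y - of_int (n * a)) / (real u / real w) = of_int (n * b)"
    using assms by simp
  then show "\<exists>x\<in>\<int>. (y - x) / (real u / real w) \<in> \<int>" by (metis Ints_of_int)
qed

lemma adapted_D:
  assumes "adapted H D e u w"
  shows "invertible e" "H = lat e" "D = lat (dmat (\<lambda>i. real (u i) / real (w i)) ** e)"
    "u i > 0" "w i > 0" "coprime (u i) (w i)" "u i \<noteq> 0" "w i \<noteq> 0"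
    "i \<le> j \<Longrightarrow> u i dvd u j" "i \<le> j \<Longrightarrow> w j dvd w i"
  using assms unfolding adapted_def by (auto simp: neq0_conv[symmetric] simp del: neq0_conv)

lemma adapted_mem:
  assumes "adapted H D e u w"
  shows "v \<in> H \<longleftrightarrow> (\<forall>i. (v v* matrix_inv e) $ i \<in> \<int>)"
    "v \<in> D \<longleftrightarrow> (\<forall>i. (v v* matrix_inv e) $ i / (real (u i) / real (w i)) \<in> \<int>)"
  using adapted_D[OF assms] by (simp_all add: lat_iff lat_dmat_iff)

lemma adapted_lattices:
  assumes "adapted H D e u w"
  shows "H \<in> lattices" "D \<in> lattices"
proof -
  note ad = adapted_D[OF assms]
  have "real (u i) / real (w i) \<noteq> 0" for i using ad(7,8) by simp
  then show "H \<in> lattices" "D \<in> lattices"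
    unfolding ad(2,3) by (intro lattices_lat invertible_mult invertible_dmat ad(1))+
qed

definition lsum :: "'a::plus set \<Rightarrow> 'a set \<Rightarrow> 'a set" where
  "lsum H D = {x + y | x y. x \<in> H \<and> y \<in> D}"

lemma lsum_subset: "S \<in> lattices \<Longrightarrow> H \<subseteq> S \<Longrightarrow> D \<subseteq> S \<Longrightarrow> lsum H D \<subseteq> S"
  unfolding lsum_def using lattice_closed(2) by blast

lemma subset_lsum:
  assumes "H \<in> lattices" "D \<in> lattices"
  shows "H \<subseteq> lsum H D" "D \<subseteq> lsum H D"
proof -
  have "x = x + 0" "x = 0 + x" for x :: "real^'n" by simp_all
  then show "H \<subseteq> lsum H D" "D \<subseteq> lsum H D"
    unfolding lsum_def using lattice_closed(1)[OF assms(1)] lattice_closed(1)[OF assms(2)] by blast+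
qed

lemma adapted_Int:
  assumes "adapted H D e u w"
  shows "H \<inter> D = lat (dmat (\<lambda>i. real (u i)) ** e)"
proof (rule set_eqI)
  fix v
  note ad = adapted_D[OF assms]
  let ?c = "v v* matrix_inv e"
  have "v \<in> H \<inter> D \<longleftrightarrow> (\<forall>i. ?c $ i \<in> \<int> \<and> ?c $ i / (real (u i) / real (w i)) \<in> \<int>)"
    unfolding Int_iff adapted_mem[OF assms] by blast
  also have "\<dots> \<longleftrightarrow> (\<forall>i. ?c $ i / real (u i) \<in> \<int>)"
    by (simp only: Ints_div_fraction[OF ad(4-6)])
  also have "\<dots> \<longleftrightarrow> v \<in> lat (dmat (\<lambda>i. real (u i)) ** e)"
    using ad(1,7) by (simp add: lat_dmat_iff)
  finally show "v \<in> H \<inter> D \<longleftrightarrow> v \<in> lat (dmat (\<lambda>i. real (u i)) ** e)" .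
qed

lemma adapted_lsum:
  assumes "adapted H D e u w"
  shows "lsum H D = lat (dmat (\<lambda>i. 1 / real (w i)) ** e)"
proof (rule set_eqI)
  fix v
  note ad = adapted_D[OF assms]
  let ?c = "\<lambda>v. v v* matrix_inv e"
  have "v \<in> lsum H D \<longleftrightarrow> (\<exists>x\<in>H. v - x \<in> D)"
  proof
    assume "\<exists>x\<in>H. v - x \<in> D"
    then obtain x where "x \<in> H" "v - x \<in> D" by blast
    moreover have "v = x + (v - x)" by simp
    ultimately show "v \<in> lsum H D" unfolding lsum_def by blast
  next
    assume "v \<in> lsum H D"
    then obtain x y where "x \<in> H" "y \<in> D" "v = x + y" unfolding lsum_def by blast
    moreover from this have "v - x \<in> D" by simp
    ultimately show "\<exists>x\<in>H. v - x \<in> D" by blast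
  qed
  also have "\<dots> \<longleftrightarrow> (\<forall>i. \<exists>x\<in>\<int>. (?c v $ i - x) / (real (u i) / real (w i)) \<in> \<int>)"
  proof
    assume "\<exists>x\<in>H. v - x \<in> D"
    then show "\<forall>i. \<exists>x\<in>\<int>. (?c v $ i - x) / (real (u i) / real (w i)) \<in> \<int>"
      using adapted_mem[OF assms] by (metis vector_matrix_mult_diff_distrib vector_minus_component)
  next
    assume "\<forall>i. \<exists>x\<in>\<int>. (?c v $ i - x) / (real (u i) / real (w i)) \<in> \<int>"
    then obtain f where f: "f i \<in> \<int>" "(?c v $ i - f i) / (real (u i) / real (w i)) \<in> \<int>" for i
      by metis
    let ?x = "(\<chi> i. f i) v* e"
    have "?c ?x = (\<chi> i. f i)" using vector_matrix_mult_inv ad(1) by blast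
    then have "?x \<in> H" "v - ?x \<in> D"
      using f by (simp_all add: adapted_mem[OF assms] vector_matrix_mult_diff_distrib)
    then show "\<exists>x\<in>H. v - x \<in> D" by blast
  qed
  also have "\<dots> \<longleftrightarrow> v \<in> lat (dmat (\<lambda>i. 1 / real (w i)) ** e)"
    using ad by (simp only: Ints_sum_fraction[OF ad(4-6)]) (simp add: lat_dmat_iff)
  finally show "v \<in> lsum H D \<longleftrightarrow> v \<in> lat (dmat (\<lambda>i. 1 / real (w i)) ** e)" .
qed

text \<open>Tested on basis vectors, where coprimality of u and w removes the other factor. It tells
  whether p annihilates H/(H cap D), respectively D/(H cap D), information that an index such as p^2
  does not contain.\<close>

lemma adapted_scale_subset:
  assumes "adapted H D e u w"
  shows "(\<forall>x\<in>H. real p *\<^sub>R x \<in> D) \<longleftrightarrow> (\<forall>i. u i dvd p)"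
    "(\<forall>x\<in>D. real p *\<^sub>R x \<in> H) \<longleftrightarrow> (\<forall>i. w i dvd p)"
proof -
  note ad = adapted_D[OF assms] and mem = adapted_mem[OF assms]
  let ?c = "\<lambda>v. v v* matrix_inv e"
  have c: "?c (axis i d v* e) $ j = (if j = i then d else 0)" for i j d
    using vector_matrix_mult_inv(1)[OF ad(1)] by (simp add: axis_def)
  have cs: "?c (r *\<^sub>R v) $ i = r * ?c v $ i" for r v i
    by (simp add: scaleR_vector_matrix_assoc)
  note dvd_iff = of_nat_divide_in_Ints_iff
  show "(\<forall>x\<in>H. real p *\<^sub>R x \<in> D) \<longleftrightarrow> (\<forall>i. u i dvd p)"
  proof
    assume *: "\<forall>x\<in>H. real p *\<^sub>R x \<in> D"
    show "\<forall>i. u i dvd p"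
    proof
      fix i
      have "axis i 1 v* e \<in> H" by (simp add: mem c)
      then have "real p *\<^sub>R (axis i 1 v* e) \<in> D" using * by blast
      then have "real p / (real (u i) / real (w i)) \<in> \<int>" unfolding mem cs c by (auto dest: spec[of _ i])
      then have "real p / real (u i) \<in> \<int>" using Ints_div_fraction[OF ad(4-6)] by (metis Ints_of_nat)
      then show "u i dvd p" using dvd_iff ad(4) by blast
    qed
  next
    assume "\<forall>i. u i dvd p"
    then have *: "real p / real (u i) \<in> \<int>" for i using dvd_iff ad(4) by blast
    show "\<forall>x\<in>H. real p *\<^sub>R x \<in> D"
    proof
      fix x assume "x \<in> H"
      then have x: "?c x $ i \<in> \<int>" for i using mem by blast
      have "real p * ?c x $ i / (real (u i) / real (w i)) = (real p / real (u i)) * ?c x $ i * real (w i)" for i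
        by simp
      also have "\<dots> i \<in> \<int>" for i using * x by (intro Ints_mult) auto
      finally show "real p *\<^sub>R x \<in> D" unfolding mem cs by blast
    qed
  qed
  show "(\<forall>x\<in>D. real p *\<^sub>R x \<in> H) \<longleftrightarrow> (\<forall>i. w i dvd p)"
  proof
    assume *: "\<forall>x\<in>D. real p *\<^sub>R x \<in> H"
    show "\<forall>i. w i dvd p"
    proof
      fix i
      have "axis i (real (u i) / real (w i)) v* e \<in> D" using ad(7,8) by (simp add: mem c)
      then have "real p *\<^sub>R (axis i (real (u i) / real (w i)) v* e) \<in> H" using * by blast
      then have "real p * (real (u i) / real (w i)) \<in> \<int>" unfolding mem cs c by (auto dest: spec[of _ i])
      then have "real (p * u i) / real (w i) \<in> \<int>" by simp
      then have "w i dvd p * u i" using dvd_iff ad(5) by blast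
      then show "w i dvd p" using ad(6) coprime_dvd_mult_left_iff coprime_commute by blast
    qed
  next
    assume *: "\<forall>i. w i dvd p"
    show "\<forall>x\<in>D. real p *\<^sub>R x \<in> H"
    proof
      fix x assume "x \<in> D"
      then have x: "?c x $ i / (real (u i) / real (w i)) \<in> \<int>" for i using mem by blast
      have "real p * ?c x $ i = (?c x $ i / (real (u i) / real (w i))) * (real p / real (w i)) * real (u i)" for i
        using ad(4,5)[of i] by simp
      also have "\<dots> i \<in> \<int>" for i using * x dvd_iff ad(5) by (intro Ints_mult) auto
      finally show "real p *\<^sub>R x \<in> H" unfolding mem cs by blast
    qed
  qed
qed

section \<open>Indices of sublattices and the isomorphism theorems\<close>

definition lat_index :: "nat \<Rightarrow> (real^'n) set \<Rightarrow> (real^'n) set \<Rightarrow> bool" where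
  "lat_index k M H \<longleftrightarrow> M \<in> lattices \<and> H \<in> lattices \<and> M \<subseteq> H \<and> covol M = real k * covol H"

text \<open>The second isomorphism theorem in coordinates: (H + D)/D has the same elementary
  divisors \<open>u\<close> as H/(H cap D), and (H + D)/H the same \<open>w\<close> as D/(H cap
  D).\<close>

lemma adapted_index:
  assumes "adapted H D e u w"
  shows "lat_index (prod u UNIV) (H \<inter> D) H" "lat_index (prod w UNIV) (H \<inter> D) D"
    "lat_index (prod w UNIV) H (lsum H D)" "lat_index (prod u UNIV) D (lsum H D)"
proof -
  note ad = adapted_D[OF assms]
  have L: "H \<inter> D \<in> lattices" "lsum H D \<in> lattices"
    unfolding adapted_Int[OF assms] adapted_lsum[OF assms]
    using ad(1,7,8) by (auto simp del: neq0_conv intro!: lattices_lat invertible_mult invertible_dmat)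
  have c: "covol (H \<inter> D) = real (prod u UNIV) * covol H"
    unfolding adapted_Int[OF assms] using ad by (simp add: covol_dmat prod_nonneg)
  have d: "covol D = real (prod u UNIV) / real (prod w UNIV) * covol H"
    using ad by (simp add: covol_dmat prod_nonneg prod_dividef)
  have s: "covol (lsum H D) = 1 / real (prod w UNIV) * covol H"
    unfolding adapted_lsum[OF assms] using ad by (simp add: covol_dmat prod_nonneg prod_dividef)
  have w: "real (prod w UNIV) \<noteq> 0" using ad by simp
  note l = adapted_lattices[OF assms]
  show "lat_index (prod u UNIV) (H \<inter> D) H" "lat_index (prod w UNIV) (H \<inter> D) D"
    "lat_index (prod w UNIV) H (lsum H D)" "lat_index (prod u UNIV) D (lsum H D)"
    using L l c d s w subset_lsum[OF l] unfolding lat_index_def by simp_all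
qed

lemma commens_index:
  fixes H D :: "(real^'n::{finite,linorder}) set"
  assumes "commens H D"
  obtains a b where "lat_index a (H \<inter> D) H" "lat_index b (H \<inter> D) D"
    "lat_index b H (lsum H D)" "lat_index a D (lsum H D)"
  using commens_adapted[OF assms] adapted_index by metis

lemma commens_subset: "M \<in> lattices \<Longrightarrow> H \<in> lattices \<Longrightarrow> M \<subseteq> H \<Longrightarrow> commens H M"
  unfolding commens_def by (auto intro!: exI[of _ 1])

lemma lat_index_exists:
  fixes H M :: "(real^'n::{finite,linorder}) set"
  assumes "M \<in> lattices" "H \<in> lattices" "M \<subseteq> H"
  obtains k where "k > 0" "lat_index k M H"
proof -
  obtain e u w where a: "adapted H M e u w" using commens_adapted commens_subset assms by blast
  moreover have "H \<inter> M = M" using assms by blast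
  ultimately show ?thesis using adapted_index[OF a] that adapted_D(4)[OF a]
    by (metis prod_pos)
qed

text \<open>A product of natural numbers equal to 1 forces each elementary divisor to be 1.\<close>

lemma lat_index_1:
  fixes H M :: "(real^'n::{finite,linorder}) set"
  assumes "lat_index 1 M H"
  shows "M = H"
proof -
  have "M \<in> lattices" "H \<in> lattices" "M \<subseteq> H" using assms lat_index_def by auto
  then obtain e u w where a: "adapted H M e u w" using commens_adapted commens_subset by blast
  have HM: "H \<inter> M = M" using \<open>M \<subseteq> H\<close> by blast
  then have "real (prod u UNIV) * covol H = 1 * covol H"
    using adapted_index(1)[OF a] assms unfolding lat_index_def by simp
  then have "prod u UNIV = 1" using covol_pos[OF \<open>H \<in> lattices\<close>] by (simp del: of_nat_prod)
  then have "u i = 1" for i by (metis UNIV_I dvd_prodI finite nat_dvd_1_iff_1)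
  then have "H \<inter> M = H"
    unfolding adapted_Int[OF a] using adapted_D[OF a] by (simp add: set_eq_iff lat_dmat_iff lat_iff)
  with HM show ?thesis by simp
qed

lemma lat_index_unique: "lat_index a M H \<Longrightarrow> lat_index b M H \<Longrightarrow> a = b"
  unfolding lat_index_def using covol_pos[of H] by auto

lemma lat_index_self: "H \<in> lattices \<Longrightarrow> lat_index a H H \<longleftrightarrow> a = 1"
  unfolding lat_index_def using covol_pos[of H] by auto

lemma lat_index_trans: "lat_index a M H \<Longrightarrow> lat_index b K M \<Longrightarrow> lat_index (a * b) K H"
  unfolding lat_index_def by auto

lemma lat_index_factor:
  fixes H M :: "(real^'n::{finite,linorder}) set"
  assumes "lat_index c K H" "M \<in> lattices" "K \<subseteq> M" "M \<subseteq> H"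
  obtains a b where "a > 0" "b > 0" "c = a * b" "lat_index a M H" "lat_index b K M"
proof -
  obtain a b where "a > 0" "b > 0" "lat_index a M H" "lat_index b K M"
    using assms lat_index_exists unfolding lat_index_def by metis
  moreover have "c = a * b" using lat_index_unique assms(1) lat_index_trans calculation by blast
  ultimately show ?thesis using that by blast
qed

text \<open>The index of \<open>I\<close> in \<open>D\<close> annihilates D/I, which supplies the
  multiple required by \<open>commens\<close>.\<close>

lemma commens_if_superset:
  fixes H D I :: "(real^'n::{finite,linorder}) set"
  assumes "H \<in> lattices" "D \<in> lattices" "I \<in> lattices" "I \<subseteq> H" "I \<subseteq> D"
  shows "commens H D"
proof -
  obtain e u w where a: "adapted D I e u w" using commens_adapted commens_subset assms by blast
  have "\<forall>i. u i dvd prod u UNIV" by (simp add: dvd_prodI)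
  then have "\<forall>x\<in>D. real (prod u UNIV) *\<^sub>R x \<in> I" using adapted_scale_subset[OF a] by blast
  moreover have "prod u UNIV > 0" using adapted_D[OF a] by (simp add: prod_pos)
  ultimately show ?thesis unfolding commens_def using assms by blast
qed

lemma commens_if_subset:
  fixes H D S :: "(real^'n::{finite,linorder}) set"
  assumes "H \<in> lattices" "D \<in> lattices" "S \<in> lattices" "H \<subseteq> S" "D \<subseteq> S"
  shows "commens H D"
proof -
  obtain e u w where a: "adapted S H e u w" using commens_adapted commens_subset assms by blast
  have "\<forall>i. u i dvd prod u UNIV" by (simp add: dvd_prodI)
  then have "\<forall>x\<in>S. real (prod u UNIV) *\<^sub>R x \<in> H" using adapted_scale_subset[OF a] by blast
  moreover have "prod u UNIV > 0" using adapted_D[OF a] by (simp add: prod_pos)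
  ultimately show ?thesis unfolding commens_def using assms by blast
qed

text \<open>For lattices of a fixed position such as \<open>diag(1/b, 1, \<dots>, 1, a)\<close> with squarefree \<open>a\<close> and \<open>b\<close>,
  the elementary divisors can be recovered from the two indices alone.\<close>

definition adj :: "nat \<Rightarrow> nat \<Rightarrow> (real^'n) set \<Rightarrow> (real^'n) set \<Rightarrow> bool" where
  "adj a b H D \<longleftrightarrow> lat_index a (H \<inter> D) H \<and> lat_index b (H \<inter> D) D"

lemma adj_adapted:
  fixes H D :: "(real^'n::{finite,linorder}) set"
  assumes "adj a b H D"
  obtains e u w where "adapted H D e u w" "prod u UNIV = a" "prod w UNIV = b"
proof -
  have "commens H D"
    using assms commens_if_superset[of H D "H \<inter> D"] unfolding adj_def lat_index_def by auto
  then obtain e u w where a: "adapted H D e u w" using commens_adapted by blast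
  then show ?thesis using that[OF a] adapted_index[OF a] assms lat_index_unique unfolding adj_def by blast
qed

lemma adapted_adj: "adapted H D e u w \<Longrightarrow> adj (prod u UNIV) (prod w UNIV) H D"
  using adapted_index unfolding adj_def by blast

lemma adj_lsum:
  fixes H D :: "(real^'n::{finite,linorder}) set"
  assumes "adj a b H D"
  shows "lat_index b H (lsum H D)" "lat_index a D (lsum H D)"
  using adj_adapted[OF assms] adapted_index by metis+

text \<open>The second isomorphism theorem moves each index to the opposite side of the diamond
  formed by the sum, \<open>H\<close>, \<open>D\<close> and the intersection.\<close>

lemma lsum_adj:
  fixes H D :: "(real^'n::{finite,linorder}) set"
  assumes "lat_index b H (lsum H D)" "lat_index a D (lsum H D)"
  shows "adj a b H D"
proof -
  have "commens H D"
    using assms commens_if_subset[of H D "lsum H D"] unfolding lat_index_def by auto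
  then obtain e u w where a: "adapted H D e u w" using commens_adapted by blast
  then show ?thesis using adapted_adj[OF a] adapted_index[OF a] assms lat_index_unique by metis
qed

section \<open>Counting lattices of prime index\<close>

lemma lat_subset_if_rows:
  assumes "L \<in> lattices" "\<And>i. row i h \<in> L"
  shows "lat h \<subseteq> L"
proof -
  obtain g where g: "invertible g" "L = lat g" using assms(1) unfolding lattices_def by blast
  then have "int_matrix (h ** matrix_inv g)" using assms int_matrix_if_rows_in_lat by blast
  then show ?thesis using lat_mult_subset mult_inv_cancel(1) g by metis
qed

lemma dmat_mult_nth: "(dmat d ** A) $ i $ j = d i * A $ i $ j"
proof -
  have "(dmat d ** A) $ i $ j = (\<Sum>k\<in>UNIV. if k = i then d i * A $ i $ j else 0)"
    unfolding matrix_matrix_mult_def dmat_def vec_lambda_beta by (rule sum.cong) auto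
  then show ?thesis by simp
qed

lemma row_dmat_mult: "row i (dmat d ** e) = d i *\<^sub>R row i e"
  by (simp add: vec_eq_iff row_def dmat_mult_nth)

lemma dmat_mult: "dmat a ** (dmat b ** e) = dmat (\<lambda>i. a i * b i) ** e"
  by (simp add: vec_eq_iff dmat_mult_nth)

lemma dmat_one: "dmat (\<lambda>i. 1) ** e = e"
  by (simp add: vec_eq_iff dmat_mult_nth)

text \<open>Lagrange's theorem for the quotient: each elementary divisor divides their product
  \<open>k\<close>.\<close>

lemma lat_index_scale:
  fixes M H :: "(real^'n::{finite,linorder}) set"
  assumes "lat_index k M H" "x \<in> H"
  shows "real k *\<^sub>R x \<in> M"
proof -
  have MH: "M \<in> lattices" "H \<in> lattices" "M \<subseteq> H" using assms lat_index_def by auto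
  then obtain e u w where a: "adapted H M e u w" using commens_adapted commens_subset by blast
  have "H \<inter> M = M" using MH by blast
  then have "prod u UNIV = k" using adapted_index(1)[OF a] assms lat_index_unique by metis
  then have "\<forall>i. u i dvd k" by (auto intro: dvd_prodI)
  then show ?thesis using adapted_scale_subset(1)[OF a] assms by blast
qed

lemma lat_index_eqI:
  fixes M H :: "(real^'n::{finite,linorder}) set"
  assumes "lat_index k M H" "lat_index k N H" "M \<subseteq> N" "k > 0"
  shows "M = N"
proof -
  have "lat_index 1 M N" using assms unfolding lat_index_def by simp
  then show ?thesis by (rule lat_index_1)
qed

lemma lat_index_eqI':
  fixes M H :: "(real^'n::{finite,linorder}) set"
  assumes "lat_index k I M" "lat_index k I N" "M \<subseteq> N" "k > 0"
  shows "M = N"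
proof -
  have "lat_index 1 M N" using assms unfolding lat_index_def by simp
  then show ?thesis by (rule lat_index_1)
qed

lemma lat_index_dmat:
  fixes e :: "'n::{finite,linorder} rmat"
  assumes "invertible e" "\<And>i. a i > 0" "\<And>i. c i > (0::real)" "\<And>i. d i = real (a i) * c i"
  shows "lat_index (prod a UNIV) (lat (dmat d ** e)) (lat (dmat c ** e))"
proof -
  have c0: "c i \<noteq> 0" for i using assms(3)[of i] by simp
  have inv: "invertible (dmat c ** e)" by (intro invertible_mult invertible_dmat c0 assms(1))
  have a0: "real (a i) \<noteq> 0" for i using assms(2)[of i] by simp
  have eq: "dmat d ** e = dmat (\<lambda>i. real (a i)) ** (dmat c ** e)"
    unfolding dmat_mult by (simp add: assms(4)[abs_def])
  have "int_matrix (dmat (\<lambda>i. real (a i)))" by (simp add: int_matrix_def dmat_def)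
  then show ?thesis
    unfolding lat_index_def eq using inv a0
    by (simp add: covol_dmat lattices_lat invertible_mult invertible_dmat lat_mult_subset prod_nonneg)
qed

section \<open>Superlattices of prime index as lines over a finite field\<close>

lemma prime_index_adapted:
  fixes H M :: "(real^'n::{finite,linorder}) set"
  assumes "lat_index p M H" "prime p"
  obtains e m where "invertible e" "H = lat e" "M = lat (dmat (\<lambda>i. if i = m then real p else 1) ** e)"
proof -
  have MH: "M \<in> lattices" "H \<in> lattices" "M \<subseteq> H" using assms lat_index_def by auto
  then obtain e u w where a: "adapted H M e u w" using commens_adapted commens_subset by blast
  have HM: "H \<inter> M = M" using MH by blast
  then have prod: "prod u UNIV = p" using adapted_index(1)[OF a] assms lat_index_unique by metis
  have "\<exists>m. u m \<noteq> 1"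
  proof (rule ccontr)
    assume "\<not> ?thesis"
    then have "prod u UNIV = 1" by simp
    then show False using prod assms(2) by simp
  qed
  then obtain m where m: "u m \<noteq> 1" by blast
  have "u m dvd p" unfolding prod[symmetric] by (rule dvd_prodI) auto
  then have um: "u m = p" using assms(2) m by (metis prime_nat_iff)
  have "prod u UNIV = u m * prod u (UNIV - {m})" by (rule prod.remove) auto
  then have "prod u (UNIV - {m}) = 1" using um prod assms(2) by (simp add: prime_gt_0_nat)
  then have "u i = 1" if "i \<noteq> m" for i
    using that by (metis DiffI UNIV_I dvd_prodI finite nat_dvd_1_iff_1 singletonD)
  then have "(\<lambda>i. real (u i)) = (\<lambda>i. if i = m then real p else 1)" using um by auto
  then show ?thesis using that adapted_Int[OF a] HM adapted_D(1,2)[OF a] by metis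
qed

text \<open>\<open>dmat (inv_p J p) ** e\<close> spans the lattice over \<open>lat e\<close> in
  which the basis vectors in \<open>J\<close> are divided by p. Its quotient by \<open>lat e\<close>
  is a vector space with basis \<open>J\<close> over the field with p elements. Taking
  \<open>J = UNIV\<close> captures all superlattices of index p; a set of two elements captures the
  lattices between two given ones.\<close>

definition inv_p :: "'n set \<Rightarrow> nat \<Rightarrow> 'n \<Rightarrow> real" where
  "inv_p J p = (\<lambda>i. if i \<in> J then 1 / real p else 1)"

text \<open>The lattice sought is \<open>lat e\<close> + D, where D is spanned by the fractional
  vector x and the basis vectors other than the one at \<open>i\<^sub>0\<close>. No basis of the sum
  is constructed. The index b of \<open>lat e\<close> in the sum equals that of their intersection
  in D; it divides p because p x and the other basis vectors lie in \<open>lat e\<close>, and it is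
  not 1 because x does not.\<close>

lemma frac_vec_lattice:
  fixes e :: "'n::{finite,linorder} rmat" and k :: "'n \<Rightarrow> nat"
  assumes p: "prime p" and e: "invertible e" and k: "\<And>i. i \<in> J \<Longrightarrow> k i < p" "\<And>i. i \<notin> J \<Longrightarrow> k i = 0"
    "k i\<^sub>0 \<noteq> 0"
  obtains Z where "lat_index p (lat e) Z" "Z \<subseteq> lat (dmat (inv_p J p) ** e)"
    "(\<chi> i. real (k i) / real p) v* e \<in> Z"
proof -
  let ?x = "(\<chi> i. real (k i) / real p) v* e" and ?S = "lat (dmat (inv_p J p) ** e)"
  have p0: "p > 0" using p prime_gt_0_nat by blast
  \<comment> \<open>The identity with row \<open>i\<^sub>0\<close> replaced by \<open>k\<close>,
    invertible since \<open>k i\<^sub>0\<close> is not zero. Dividing this row by p, as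
    \<open>d\<close> does below, yields the basis of D.\<close>
  define A :: "'n rmat" where "A = (\<chi> i j. if i = i\<^sub>0 then real (k j) else if i = j then 1 else 0)"
  have A_col: "(transpose A *v y) $ j = y $ i\<^sub>0 * real (k j) + (if j = i\<^sub>0 then 0 else y $ j)" for y j
  proof -
    have "(transpose A *v y) $ j = (\<Sum>i\<in>UNIV. y $ i * A $ i $ j)"
      unfolding transpose_matrix_vector vector_matrix_mult_def by simp
    also have "\<dots> = (\<Sum>i\<in>UNIV. (if i = i\<^sub>0 then y $ i\<^sub>0 * real (k j) else 0)
        + (if i = j then if j = i\<^sub>0 then 0 else y $ j else 0))"
      by (rule sum.cong) (auto simp: A_def)
    finally show ?thesis by (simp add: sum.distrib)
  qed
  have "y = 0" if y: "transpose A *v y = 0" for y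
  proof -
    have "y $ i\<^sub>0 = 0" using A_col[of y i\<^sub>0] k(3) y by simp
    then have "y $ j = 0" for j using A_col[of y j] y by (cases "j = i\<^sub>0") auto
    then show ?thesis by (simp add: vec_eq_iff)
  qed
  then have "invertible (transpose A)" unfolding invertible_left_inverse matrix_left_invertible_ker by blast
  then have A: "invertible A" by (metis transpose_invertible transpose_transpose)
  define d where "d i = (if i = i\<^sub>0 then 1 / real p else 1)" for i
  let ?Ae = "A ** e"
  have Ae: "invertible ?Ae" using A e invertible_mult by blast
  define D where "D = lat (dmat d ** ?Ae)"
  have d0: "d i > 0" "d i \<noteq> 0" for i using p0 by (auto simp: d_def)
  have Dl: "D \<in> lattices" unfolding D_def by (intro lattices_lat invertible_mult invertible_dmat d0 Ae)
  have Il: "lat e \<in> lattices" using e lattices_lat by blast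
  have inv0: "inv_p J p i > 0" "inv_p J p i \<noteq> 0" for i using p0 by (auto simp: inv_p_def)
  have Sl: "?S \<in> lattices" by (intro lattices_lat invertible_mult invertible_dmat e inv0)
  have rowA: "row i\<^sub>0 ?Ae = real p *\<^sub>R ?x" "i \<noteq> i\<^sub>0 \<Longrightarrow> row i ?Ae = row i e" for i
  proof -
    show "row i\<^sub>0 ?Ae = real p *\<^sub>R ?x"
      using p0 by (simp add: vec_eq_iff row_def matrix_matrix_mult_def A_def vector_matrix_mult_def sum_distrib_left)
    show "row i ?Ae = row i e" if "i \<noteq> i\<^sub>0"
    proof -
      have "(A ** e) $ i $ j = (\<Sum>l\<in>UNIV. if l = i then e $ i $ j else 0)" for j
        unfolding matrix_matrix_mult_def A_def vec_lambda_beta using that by (intro sum.cong) auto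
      then show ?thesis by (simp add: vec_eq_iff row_def)
    qed
  qed
  have rowD: "row i (dmat d ** ?Ae) = (if i = i\<^sub>0 then ?x else row i e)" for i
    unfolding row_dmat_mult using rowA p0 by (simp add: d_def)
  have xD: "?x \<in> D" using row_in_lat[of i\<^sub>0 "dmat d ** ?Ae"] unfolding D_def rowD by simp
  have eD: "lat_index p (lat ?Ae) D"
  proof -
    have "lat_index (\<Prod>i\<in>UNIV. if i = i\<^sub>0 then p else 1) (lat (dmat (\<lambda>i. 1) ** ?Ae)) D"
      unfolding D_def by (rule lat_index_dmat[OF Ae]) (use p0 in \<open>auto simp: d_def\<close>)
    then show ?thesis by (simp add: dmat_one)
  qed
  have "int_matrix A" by (simp add: int_matrix_def A_def)
  then have eI: "lat ?Ae \<subseteq> lat e" by (rule lat_mult_subset)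
  have "commens (lat e) D"
    using commens_if_superset[OF Il Dl _ eI] eD unfolding lat_index_def by blast
  then obtain a b where ab: "lat_index a (lat e \<inter> D) (lat e)" "lat_index b (lat e \<inter> D) D"
    "lat_index b (lat e) (lsum (lat e) D)" by (rule commens_index)
  have "x \<notin> lat e" if "x = ?x" for x
  proof
    assume "x \<in> lat e"
    then have "\<forall>i. real (k i) / real p \<in> \<int>"
      unfolding that lat_iff[OF e] vector_matrix_mult_inv(1)[OF e] by simp
    then have "p dvd k i\<^sub>0" using of_nat_divide_in_Ints_iff[OF p0] by blast
    moreover have "k i\<^sub>0 < p" using k by metis
    ultimately show False using k(3) by (simp add: nat_dvd_not_less)
  qed
  then have "b \<noteq> 1" using ab(2) lat_index_1 xD by blast
  moreover have "b dvd p"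
  proof -
    have "lat ?Ae \<subseteq> lat e \<inter> D" using eI eD unfolding lat_index_def by blast
    moreover have "lat e \<inter> D \<in> lattices" using ab(2) unfolding lat_index_def by blast
    ultimately obtain a' b' where "p = a' * b'" "lat_index a' (lat e \<inter> D) D"
      using lat_index_factor[OF eD, of "lat e \<inter> D"] by blast
    then show ?thesis using ab(2) lat_index_unique by (metis dvd_triv_left)
  qed
  ultimately have "b = p" using p by (metis prime_nat_iff)
  have IS: "lat e \<subseteq> ?S"
  proof (rule lat_subset_if_rows[OF Sl])
    fix i
    show "row i e \<in> ?S"
    proof (cases "i \<in> J")
      case True
      have "real p *\<^sub>R row i (dmat (inv_p J p) ** e) \<in> ?S" using lattice_closed(5)[OF Sl] row_in_lat by blast
      then show ?thesis using True p0 by (simp add: row_dmat_mult inv_p_def)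
    next
      case False
      then show ?thesis using row_in_lat[of i "dmat (inv_p J p) ** e"] by (simp add: row_dmat_mult inv_p_def)
    qed
  qed
  have xS: "?x \<in> ?S"
    unfolding lat_dmat_iff[OF e inv0(2)] vector_matrix_mult_inv(1)[OF e]
    using k(2) p0 by (auto simp: inv_p_def)
  have "D \<subseteq> ?S" unfolding D_def
    by (rule lat_subset_if_rows[OF Sl]) (use IS xS row_in_lat rowD in auto)
  then have "lsum (lat e) D \<subseteq> ?S" using lsum_subset[OF Sl IS] by blast
  moreover have "?x \<in> lsum (lat e) D" using subset_lsum[OF Il Dl] xD by blast
  ultimately show ?thesis using that ab(3) \<open>b = p\<close> by blast
qed

text \<open>The quotient of \<open>Z\<close> by \<open>lat e\<close> is cyclic of order p. Its
  nonzero classes are the multiples j y, 0 < j < p, of one generator y, and each class has exactly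
  one representative with coordinates k/p in [0, 1).\<close>

lemma card_superlattice_vectors:
  fixes e :: "'n::{finite,linorder} rmat"
  assumes p: "prime p" and e: "invertible e"
    and Z: "lat_index p (lat e) Z" "Z \<subseteq> lat (dmat (inv_p J p) ** e)"
  shows "card {k. (\<forall>i. k i \<in> (if i \<in> J then {..<p} else {0})) \<and> k \<noteq> (\<lambda>i. 0)
      \<and> (\<chi> i. real (k i) / real p) v* e \<in> Z} = p - 1"
    (is "card ?A = _")
proof -
  let ?c = "\<lambda>v. v v* matrix_inv e"
  have p0: "p > 0" using p prime_gt_0_nat by blast
  have Zl: "Z \<in> lattices" "lat e \<subseteq> Z" using Z(1) unfolding lat_index_def by auto
  have inv0: "inv_p J p i \<noteq> 0" for i using p0 by (auto simp: inv_p_def)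
  obtain g m where g: "invertible g" "Z = lat g"
    "lat e = lat (dmat (\<lambda>i. if i = m then real p else 1) ** g)"
    using prime_index_adapted[OF Z(1) p] by blast
  have p0': "(if i = m then real p else 1) \<noteq> 0" for i using p0 by simp
  let ?y = "row m g"
  have yZ: "?y \<in> Z" using row_in_lat g by blast
  have gm: "?y v* matrix_inv g = axis m 1"
    unfolding row_mult[symmetric] matrix_inv_mult(1)[OF g(1)]
    by (simp add: vec_eq_iff row_def mat_def axis_def)
  have my: "real_of_int z *\<^sub>R ?y \<in> lat e \<longleftrightarrow> int p dvd z" for z
  proof -
    have "real_of_int z *\<^sub>R ?y \<in> lat e \<longleftrightarrow> real_of_int z / real p \<in> \<int>"
      unfolding g(3) lat_dmat_iff[OF g(1) p0'] scaleR_vector_matrix_assoc gm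
      by (auto simp: axis_def dest: spec[of _ m])
    also have "\<dots> \<longleftrightarrow> int p dvd z"
      by (rule of_int_divide_in_Ints_iff[OF p0])
    finally show ?thesis .
  qed
  \<comment> \<open>Coordinates of the generator over the common denominator p. Outside
    \<open>J\<close> they are integers, so the numerators are divisible by p and the entries of
    \<open>f j\<close> vanish there.\<close>
  have "\<exists>a::'n \<Rightarrow> int. \<forall>i. ?c ?y $ i = of_int (a i) / real p \<and> (i \<notin> J \<longrightarrow> int p dvd a i)"
  proof -
    have int: "?c ?y $ i / inv_p J p i \<in> \<int>" for i
      using Z(2) yZ lat_dmat_iff[OF e, of "inv_p J p", OF inv0] by blast
    obtain b where b: "?c ?y $ i / inv_p J p i = of_int (b i)" for i
      using that[of "\<lambda>i. \<lfloor>?c ?y $ i / inv_p J p i\<rfloor>"] int by simp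
    have "?c ?y $ i = of_int (b i) * inv_p J p i" for i
      using b[of i] inv0[of i] by (metis nonzero_eq_divide_eq)
    then have "?c ?y $ i = of_int (if i \<in> J then b i else b i * int p) / real p" for i
      using p0 by (simp add: inv_p_def)
    then show ?thesis by (intro exI[of _ "\<lambda>i. if i \<in> J then b i else b i * int p"]) auto
  qed
  then obtain a where a: "\<And>i. ?c ?y $ i = of_int (a i) / real p" "\<And>i. i \<notin> J \<Longrightarrow> int p dvd a i" by metis
  let ?x = "\<lambda>k::'n \<Rightarrow> nat. (\<chi> i. real (k i) / real p) v* e"
  have cx: "?c (?x k) $ i = real (k i) / real p" for k i
    using vector_matrix_mult_inv(1)[OF e] by simp
  \<comment> \<open>The representative of the class of j y, obtained by reducing the numerators
    modulo p.\<close>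
  define f where "f j = (\<lambda>i. nat ((int j * a i) mod int p))" for j
  have fI: "?x (f j) - real_of_int (int j) *\<^sub>R ?y \<in> lat e" for j
    unfolding lat_iff[OF e]
  proof
    fix i
    have "int (f j i) = int j * a i - int p * ((int j * a i) div int p)"
      unfolding f_def using p0 by (simp add: minus_mult_div_eq_mod)
    then have "real_of_int (int (f j i)) = of_int (int j * a i - int p * ((int j * a i) div int p))" by simp
    then have "real (f j i) = real j * of_int (a i) - real p * of_int ((int j * a i) div int p)" by simp
    then have "real (f j i) / real p - real j * (of_int (a i) / real p) = - of_int ((int j * a i) div int p)"
      using p0 by (simp add: field_simps)
    moreover have "?c (?x (f j) - real_of_int (int j) *\<^sub>R ?y) $ i = real (f j i) / real p - real j * (of_int (a i) / real p)"
      by (simp add: vector_matrix_mult_diff_distrib scaleR_vector_matrix_assoc cx a)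
    ultimately show "?c (?x (f j) - real_of_int (int j) *\<^sub>R ?y) $ i \<in> \<int>" by simp
  qed
  have range: "f j i \<in> (if i \<in> J then {..<p} else {0})" for i j
    using a(2)[of i] p0 by (auto simp: f_def nat_less_iff dvd_imp_mod_0)
  have unique: "k = l" if "\<And>i. k i < p" "\<And>i. l i < p" "?x k - ?x l \<in> lat e" for k l
  proof
    fix i
    have "real (k i) / real p - real (l i) / real p \<in> \<int>"
      using that(3) unfolding lat_iff[OF e] vector_matrix_mult_diff_distrib by (simp add: cx)
    then obtain z where "real (k i) / real p - real (l i) / real p = of_int z" by (meson Ints_cases)
    then have "real_of_int (int (k i) - int (l i)) = of_int (z * int p)" using p0 by (simp add: field_simps)
    then have z: "int (k i) - int (l i) = z * int p" by (simp only: of_int_eq_iff)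
    then have "int p dvd int (k i) - int (l i)" by simp
    then have "int (k i) mod int p = int (l i) mod int p" by (simp add: mod_eq_dvd_iff)
    then show "k i = l i" using that(1,2)[of i] by simp
  qed
  have lt: "f j i < p" for i j using p0 by (simp add: f_def nat_less_iff)
  have x0: "?x (\<lambda>i. 0) = 0" by (simp add: zero_vec_def[symmetric])
  have inj: "inj_on f {1..<p}"
  proof (rule inj_onI)
    fix j l assume jl: "j \<in> {1..<p}" "l \<in> {1..<p}" "f j = f l"
    have "(?x (f j) - real_of_int (int l) *\<^sub>R ?y) - (?x (f j) - real_of_int (int j) *\<^sub>R ?y) \<in> lat e"
      using lat_diff fI jl(3) by metis
    then have "real_of_int (int j - int l) *\<^sub>R ?y \<in> lat e" by (simp add: algebra_simps)
    then have "int p dvd int j - int l" using my by blast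
    then have "int j mod int p = int l mod int p" by (simp add: mod_eq_dvd_iff)
    then show "j = l" using jl by simp
  qed
  have "f ` {1..<p} = ?A"
  proof
    show "f ` {1..<p} \<subseteq> ?A"
    proof clarify
      fix j assume j: "j \<in> {1..<p}"
      have "?x (f j) \<in> Z"
      proof -
        have "?x (f j) - real_of_int (int j) *\<^sub>R ?y + real_of_int (int j) *\<^sub>R ?y \<in> Z"
          using lattice_closed(2,4)[OF Zl(1)] yZ fI Zl(2) by blast
        then show ?thesis by simp
      qed
      moreover have "f j \<noteq> (\<lambda>i. 0)"
      proof
        assume "f j = (\<lambda>i. 0)"
        then have "- (real_of_int (int j) *\<^sub>R ?y) \<in> lat e" using fI[of j] x0 by simp
        then have "real_of_int (- int j) *\<^sub>R ?y \<in> lat e" by simp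
        then have "int p dvd - int j" using my by blast
        then have "p dvd j" by simp
        then show False using j by (auto dest: dvd_imp_le)
      qed
      ultimately show "(\<forall>i. f j i \<in> (if i \<in> J then {..<p} else {0})) \<and> f j \<noteq> (\<lambda>i. 0) \<and> ?x (f j) \<in> Z"
        using range by blast
    qed
    show "?A \<subseteq> f ` {1..<p}"
    proof
      fix k assume k: "k \<in> ?A"
      have kp: "k i < p" for i
      proof -
        have "k i \<in> (if i \<in> J then {..<p} else {0})" using k by blast
        then show ?thesis using p0 by (auto split: if_splits)
      qed
      have int: "(?x k v* matrix_inv g) $ i \<in> \<int>" for i using k unfolding g(2) lat_iff[OF g(1)] by blast
      obtain b where b: "(?x k v* matrix_inv g) $ i = of_int (b i)" for i
        using that[of "\<lambda>i. \<lfloor>(?x k v* matrix_inv g) $ i\<rfloor>"] int by simp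
      have "?x k - of_int (b m) *\<^sub>R ?y \<in> lat e"
        unfolding g(3) lat_dmat_iff[OF g(1) p0'] vector_matrix_mult_diff_distrib scaleR_vector_matrix_assoc gm
        by (simp add: b axis_def)
      moreover have "real_of_int (b m - int (nat (b m mod int p))) *\<^sub>R ?y \<in> lat e"
        unfolding my using p0 by (simp add: dvd_minus_mod)
      ultimately have *: "?x k - of_int (b m) *\<^sub>R ?y + real_of_int (b m - int (nat (b m mod int p))) *\<^sub>R ?y \<in> lat e"
        by (rule lat_add)
      \<comment> \<open>Only the coefficient at \<open>m\<close> matters modulo
        \<open>lat e\<close>, since the other basis vectors in \<open>g\<close> belong to
        \<open>lat e\<close>.\<close>
      define j where "j = nat (b m mod int p)"
      have "?x k - real_of_int (int j) *\<^sub>R ?y \<in> lat e"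
        using * unfolding j_def[symmetric] by (simp add: algebra_simps)
      then have "?x k - real_of_int (int j) *\<^sub>R ?y - (?x (f j) - real_of_int (int j) *\<^sub>R ?y) \<in> lat e"
        using lat_diff fI by blast
      then have "?x k - ?x (f j) \<in> lat e" by simp
      then have kf: "k = f j" using unique kp lt by blast
      have "j \<noteq> 0"
      proof
        assume "j = 0"
        then have "f j = (\<lambda>i. 0)" by (simp add: f_def)
        then show False using k kf by blast
      qed
      moreover have "j < p" unfolding j_def using p0 by (simp add: nat_less_iff)
      ultimately show "k \<in> f ` {1..<p}" using kf by auto
    qed
  qed
  then have "card ?A = card {1..<p}" using card_image inj by metis
  then show ?thesis by simp
qed

text \<open>Superlattices of index \<open>p\<close> are lines over the field with \<open>p\<close> elements, and each line
  contains \<open>p - 1\<close> nonzero vectors.\<close>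

lemma card_superlattices_within:
  fixes e :: "'n::{finite,linorder} rmat" and J :: "'n set"
  assumes p: "prime p" and e: "invertible e"
  defines "\<Z> \<equiv> {Z. lat_index p (lat e) Z \<and> Z \<subseteq> lat (dmat (inv_p J p) ** e)}"
  shows "finite \<Z>" "(p - 1) * card \<Z> = p ^ card J - 1"
proof -
  let ?x = "\<lambda>k::'n \<Rightarrow> nat. (\<chi> i. real (k i) / real p) v* e"
  \<comment> \<open>The nonzero vectors of the space with basis \<open>J\<close>, with 0, ..., p - 1
    as representatives of the residues.\<close>
  define K where "K = {k. \<forall>i. k i \<in> (if i \<in> J then {..<p} else {0})} - {\<lambda>i::'n. 0::nat}"
  have p1: "p > 1" using p prime_gt_1_nat by blast
  have K': "{k::'n \<Rightarrow> nat. \<forall>i. k i \<in> (if i \<in> J then {..<p} else {0})} = PiE UNIV (\<lambda>i. if i \<in> J then {..<p} else {0})"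
    by (simp add: PiE_UNIV_domain Pi_def)
  have finK: "finite K" unfolding K_def K' by (intro finite_Diff finite_PiE) auto
  have "card {k::'n \<Rightarrow> nat. \<forall>i. k i \<in> (if i \<in> J then {..<p} else {0})} = (\<Prod>i\<in>UNIV. if i \<in> J then p else 1)"
    unfolding K' by (subst card_PiE) (auto intro: prod.cong)
  also have "\<dots> = p ^ card J" by (simp add: prod.If_cases)
  finally have cardK: "card K = p ^ card J - 1"
    unfolding K_def using p1 by (subst card_Diff_singleton) auto
  have ex: "\<exists>Z\<in>\<Z>. ?x k \<in> Z" if k: "k \<in> K" for k
  proof -
    obtain i\<^sub>0 where "k i\<^sub>0 \<noteq> 0" using k unfolding K_def by auto
    moreover have "i \<in> J \<Longrightarrow> k i < p" "i \<notin> J \<Longrightarrow> k i = 0" for i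
      using k unfolding K_def by (auto dest: spec[of _ i])
    ultimately obtain Z where "lat_index p (lat e) Z" "Z \<subseteq> lat (dmat (inv_p J p) ** e)" "?x k \<in> Z"
      using frac_vec_lattice[OF p e, of J k i\<^sub>0] by blast
    then show ?thesis unfolding \<Z>_def by blast
  qed
  have card_fibre: "card {k\<in>K. ?x k \<in> Z} = p - 1" if "Z \<in> \<Z>" for Z
  proof -
    have "{k\<in>K. ?x k \<in> Z} = {k. (\<forall>i. k i \<in> (if i \<in> J then {..<p} else {0})) \<and> k \<noteq> (\<lambda>i. 0) \<and> ?x k \<in> Z}"
      unfolding K_def by blast
    then show ?thesis using card_superlattice_vectors[OF p e] that unfolding \<Z>_def by simp
  qed
  have x_notin: "?x k \<notin> lat e" if k: "k \<in> K" for k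
  proof
    assume "?x k \<in> lat e"
    then have "\<forall>i. real (k i) / real p \<in> \<int>"
      unfolding lat_iff[OF e] vector_matrix_mult_inv(1)[OF e] by simp
    then have "\<forall>i. p dvd k i"
      using of_nat_divide_in_Ints_iff[of p] p1 by simp
    moreover have "k i < p" for i
    proof -
      have "k i \<in> (if i \<in> J then {..<p} else {0})" using k unfolding K_def by blast
      then show ?thesis using p1 by (auto split: if_splits)
    qed
    ultimately have "k i = 0" for i by (meson gr0I nat_dvd_not_less)
    then show False using k unfolding K_def by auto
  qed
  \<comment> \<open>The intersection of \<open>Z\<close> and \<open>Z'\<close> lies over
    \<open>lat e\<close>, properly because of the vector of \<open>k\<close>. As p is prime, it is
    all of \<open>Z\<close>.\<close>
  have unique: "Z = Z'" if Z: "Z \<in> \<Z>" "Z' \<in> \<Z>" and k: "k \<in> K" "?x k \<in> Z" "?x k \<in> Z'" for Z Z' k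
  proof -
    have idx: "lat_index p (lat e) Z" "lat_index p (lat e) Z'" using Z \<Z>_def by auto
    then have l: "Z \<in> lattices" "Z' \<in> lattices" "lat e \<in> lattices" "lat e \<subseteq> Z \<inter> Z'" unfolding lat_index_def by auto
    then have "commens Z Z'" using commens_if_superset[of Z Z' "lat e"] by blast
    then obtain a b where ab: "lat_index a (Z \<inter> Z') Z" by (rule commens_index)
    then obtain a' b' where "p = a' * b'" "lat_index a' (Z \<inter> Z') Z" "lat_index b' (lat e) (Z \<inter> Z')"
      using lat_index_factor[OF idx(1) _ l(4)] unfolding lat_index_def by blast
    moreover have "b' \<noteq> 1" using calculation lat_index_1 x_notin[OF k(1)] k(2,3) by blast
    ultimately have "a' = 1" using p by (metis prime_product mult.commute)
    then have "Z \<inter> Z' = Z" using \<open>lat_index a' (Z \<inter> Z') Z\<close> lat_index_1 by blast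
    then have "Z \<subseteq> Z'" by blast
    then show ?thesis using lat_index_eqI'[OF idx] p1 by simp
  qed
  \<comment> \<open>This choice serves to show that there are finitely many lattices; the count
    itself partitions \<open>K\<close> according to the lattice containing the vector.\<close>
  define zz where "zz k = (SOME Z. Z \<in> \<Z> \<and> ?x k \<in> Z)" for k
  have zz: "zz k \<in> \<Z>" "?x k \<in> zz k" if "k \<in> K" for k
    using someI_ex[of "\<lambda>Z. Z \<in> \<Z> \<and> ?x k \<in> Z"] ex[OF that] unfolding zz_def by auto
  have "\<Z> \<subseteq> zz ` K"
  proof
    fix Z assume Z: "Z \<in> \<Z>"
    then have "{k\<in>K. ?x k \<in> Z} \<noteq> {}" using card_fibre[OF Z] p1 by (metis card.empty zero_less_diff less_irrefl)
    then obtain k where k: "k \<in> K" "?x k \<in> Z" by blast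
    then have "Z = zz k" using unique Z zz[OF k(1)] by blast
    then show "Z \<in> zz ` K" using k by blast
  qed
  then show fin: "finite \<Z>" using finK finite_surj by blast
  have "K = (\<Union>Z\<in>\<Z>. {k\<in>K. ?x k \<in> Z})" using ex by blast
  then have "card K = (\<Sum>Z\<in>\<Z>. card {k\<in>K. ?x k \<in> Z})"
    using card_UN_disjoint[OF fin, of "\<lambda>Z. {k\<in>K. ?x k \<in> Z}"] finK unique by auto
  also have "\<dots> = (\<Sum>Z\<in>\<Z>. p - 1)" using card_fibre by (rule sum.cong[OF HOL.refl])
  finally show "(p - 1) * card \<Z> = p ^ card J - 1" using cardK by (simp add: mult.commute)
qed

text \<open>Since p Z lies in H, every superlattice Z of index p lies in p^(-1) H, which is the case
  \<open>J = UNIV\<close>.\<close>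

lemma card_superlattices:
  fixes H :: "(real^'n::{finite,linorder}) set"
  assumes "H \<in> lattices" "prime p"
  shows "finite {Z. lat_index p H Z}" "(p - 1) * card {Z. lat_index p H Z} = p ^ CARD('n) - 1"
proof -
  obtain e where e: "invertible e" "H = lat e" using assms unfolding lattices_def by blast
  have p0: "p > 0" using assms prime_gt_0_nat by blast
  have inv0: "inv_p UNIV p i \<noteq> 0" for i :: 'n using p0 by (auto simp: inv_p_def)
  have "Z \<subseteq> lat (dmat (inv_p UNIV p) ** e)" if Z: "lat_index p (lat e) Z" for Z
  proof
    fix v assume "v \<in> Z"
    then have "real p *\<^sub>R v \<in> lat e" using lat_index_scale Z by blast
    then show "v \<in> lat (dmat (inv_p UNIV p) ** e)"
      unfolding lat_iff[OF e(1)] lat_dmat_iff[OF e(1), of "inv_p UNIV p", OF inv0]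
      by (simp add: scaleR_vector_matrix_assoc inv_p_def mult.commute)
  qed
  then have "{Z. lat_index p H Z} = {Z. lat_index p (lat e) Z \<and> Z \<subseteq> lat (dmat (inv_p UNIV p) ** e)}"
    using e by blast
  then show "finite {Z. lat_index p H Z}" "(p - 1) * card {Z. lat_index p H Z} = p ^ CARD('n) - 1"
    using card_superlattices_within[OF assms(2) e(1), of UNIV] by simp_all
qed

section \<open>Duality between sublattices and superlattices\<close>

definition dual :: "(real^'n) set \<Rightarrow> (real^'n) set" where
  "dual L = {y. \<forall>x\<in>L. inner x y \<in> \<int>}"

lemma inner_int_vectors:
  fixes z :: "real^'n"
  shows "(\<forall>x. (\<forall>i. x $ i \<in> \<int>) \<longrightarrow> inner x z \<in> \<int>) \<longleftrightarrow> (\<forall>i. z $ i \<in> \<int>)"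
proof
  assume *: "\<forall>x. (\<forall>i. x $ i \<in> \<int>) \<longrightarrow> inner x z \<in> \<int>"
  show "\<forall>i. z $ i \<in> \<int>"
  proof
    fix i :: 'n
    have "\<forall>j. axis i (1::real) $ j \<in> \<int>" by (simp add: axis_def)
    then have "inner (axis i 1) z \<in> \<int>" using * by blast
    then show "z $ i \<in> \<int>" by (simp add: inner_axis')
  qed
qed (auto simp: inner_vec_def intro!: Ints_sum Ints_mult)

lemma dual_lat:
  assumes "invertible g"
  shows "dual (lat g) = lat (transpose (matrix_inv g))"
proof -
  have "y \<in> dual (lat g) \<longleftrightarrow> (\<forall>x. (\<forall>i. x $ i \<in> \<int>) \<longrightarrow> inner x (g *v y) \<in> \<int>)" for y
    unfolding dual_def lat_def by (auto simp flip: dot_lmul_matrix)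
  then have "y \<in> dual (lat g) \<longleftrightarrow> (\<forall>i. (g *v y) $ i \<in> \<int>)" for y
    by (simp only: inner_int_vectors)
  moreover have "y \<in> lat (transpose (matrix_inv g)) \<longleftrightarrow> (\<forall>i. (g *v y) $ i \<in> \<int>)" for y
  proof
    assume "y \<in> lat (transpose (matrix_inv g))"
    then obtain z where "y = matrix_inv g *v z" "\<forall>i. z $ i \<in> \<int>" unfolding lat_def by auto
    then show "\<forall>i. (g *v y) $ i \<in> \<int>"
      by (simp add: matrix_vector_mul_assoc matrix_inv_mult[OF assms])
  next
    assume *: "\<forall>i. (g *v y) $ i \<in> \<int>"
    have "y = (g *v y) v* transpose (matrix_inv g)"
      by (simp add: matrix_vector_mul_assoc matrix_inv_mult[OF assms])
    then show "y \<in> lat (transpose (matrix_inv g))" using * unfolding lat_def by blast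
  qed
  ultimately show ?thesis by blast
qed

lemma dual_lattice:
  assumes "L \<in> lattices"
  shows "dual L \<in> lattices" "dual (dual L) = L" "covol (dual L) = 1 / covol L"
proof -
  obtain g where g: "invertible g" "L = lat g" using assms unfolding lattices_def by blast
  let ?h = "transpose (matrix_inv g)"
  have h: "invertible ?h" using g invertible_matrix_inv transpose_invertible by blast
  show "dual L \<in> lattices" unfolding g dual_lat[OF g(1)] using h lattices_lat by blast
  have "matrix_inv ?h = matrix_inv ?h ** (?h ** transpose g)"
    using matrix_inv_mult[OF g(1)] by (simp flip: matrix_transpose_mul)
  then have "matrix_inv ?h = transpose g"
    using matrix_inv_mult(2)[OF h] by (simp add: matrix_mul_assoc)
  then show "dual (dual L) = L" unfolding g dual_lat[OF g(1)] dual_lat[OF h] by simp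
  have "det (matrix_inv g) * det g = 1" using matrix_inv_mult(2)[OF g(1)] by (metis det_I det_mul)
  then have "\<bar>det (matrix_inv g)\<bar> * \<bar>det g\<bar> = 1" by (metis abs_mult abs_one)
  moreover have "\<bar>det g\<bar> \<noteq> 0" using g invertible_det_nz[of g] by simp
  ultimately show "covol (dual L) = 1 / covol L"
    unfolding g dual_lat[OF g(1)] covol_lat[OF h] covol_lat[OF g(1)] by (simp add: eq_divide_eq)
qed

lemma lat_index_dual:
  assumes "lat_index p M H"
  shows "lat_index p (dual H) (dual M)"
proof -
  have M: "M \<in> lattices" "H \<in> lattices" "M \<subseteq> H" "covol M = real p * covol H"
    using assms lat_index_def by auto
  have "dual H \<subseteq> dual M" using M(3) unfolding dual_def by blast
  moreover have "covol (dual H) = real p * covol (dual M)"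
    using M(4) covol_pos[OF M(1)] covol_pos[OF M(2)] by (auto simp: dual_lattice M field_simps zero_less_mult_iff)
  ultimately show ?thesis using dual_lattice(1) M unfolding lat_index_def by blast
qed

text \<open>Passing to dual lattices reverses inclusions and keeps indices, so sublattices of
  \<open>H\<close> correspond to superlattices of \<open>dual H\<close>, whose number depends only
  on p and the dimension.\<close>

lemma card_sublattices:
  fixes H :: "(real^'n::{finite,linorder}) set"
  assumes "H \<in> lattices" "prime p"
  shows "finite {M. lat_index p M H}" "card {M. lat_index p M H} = card {Z. lat_index p H Z}"
    "(p - 1) * card {M. lat_index p M H} = p ^ CARD('n) - 1"
proof -
  have dd: "dual (dual L) = L" if "lat_index p L K \<or> lat_index p K L" for L K :: "(real^'n::{finite,linorder}) set"
    using that dual_lattice(2) unfolding lat_index_def by blast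
  have "bij_betw dual {M. lat_index p M H} {Z. lat_index p (dual H) Z}"
    by (rule bij_betw_byWitness[where f' = dual])
      (use dd lat_index_dual lat_index_dual[of p "dual H"] dual_lattice(2)[OF assms(1)] in auto)
  moreover have "finite {Z. lat_index p (dual H) Z}" "(p - 1) * card {Z. lat_index p (dual H) Z} = p ^ CARD('n) - 1"
    using card_superlattices dual_lattice(1) assms by blast+
  ultimately show "finite {M. lat_index p M H}" and *: "(p - 1) * card {M. lat_index p M H} = p ^ CARD('n) - 1"
    using bij_betw_finite bij_betw_same_card by metis+
  have "p - 1 > 0" using assms(2) prime_gt_1_nat by simp
  then show "card {M. lat_index p M H} = card {Z. lat_index p H Z}"
    using * card_superlattices(2)[OF assms] by (metis mult_left_cancel less_irrefl)
qed

text \<open>If \<open>f i\<close> with i different from m were not 1, its square would divide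
  \<open>f i * f m\<close> and hence the squarefree number \<open>a\<close>.\<close>

lemma dvd_chain_squarefree:
  fixes f :: "'a::finite \<Rightarrow> nat"
  assumes "\<And>i. f i dvd f m" "prod f UNIV = a" "squarefree a"
  shows "f = (\<lambda>i. if i = m then a else 1)"
proof -
  have 1: "prod f UNIV = f m * prod f (UNIV - {m})" by (rule prod.remove) auto
  have "f i = 1" if "i \<noteq> m" for i
  proof -
    have "f i dvd prod f (UNIV - {m})" using that by (intro dvd_prodI) auto
    then have "f i * f i dvd a" using assms(1) 1 assms(2) by (metis mult_dvd_mono)
    then show ?thesis using assms(3) squarefreeD by (metis nat_dvd_1_iff_1 power2_eq_square)
  qed
  then show ?thesis using 1 assms(2) by auto
qed

text \<open>With exponents c at \<open>m\<^sub>1\<close> and b at \<open>m\<^sub>2\<close> one has b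
  \<le> c and b + c \<le> 2. If b = 0, all entries but the largest are 1; otherwise b = c = 1, and
  the remaining entries have product 1.\<close>

lemma dvd_chain_prime_square:
  fixes f :: "'a::finite \<Rightarrow> nat"
  assumes "\<And>i. f i dvd f m\<^sub>1" "\<And>i. i \<noteq> m\<^sub>1 \<Longrightarrow> f i dvd f m\<^sub>2" "m\<^sub>1 \<noteq> m\<^sub>2"
    and "prod f UNIV = p\<^sup>2" "prime p"
  shows "f = (\<lambda>i. if i = m\<^sub>1 then p\<^sup>2 else 1) \<or> f = (\<lambda>i. if i = m\<^sub>1 \<or> i = m\<^sub>2 then p else 1)"
proof -
  have p: "p > 1" "p > 0" using assms prime_gt_1_nat prime_gt_0_nat by auto
  define R where "R = prod f (UNIV - {m\<^sub>1} - {m\<^sub>2})"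
  have "prod f UNIV = f m\<^sub>1 * prod f (UNIV - {m\<^sub>1})" by (rule prod.remove) auto
  also have "prod f (UNIV - {m\<^sub>1}) = f m\<^sub>2 * R" unfolding R_def
    by (rule prod.remove) (use assms(3) in auto)
  finally have fR: "f m\<^sub>1 * f m\<^sub>2 * R = p\<^sup>2" using assms(4) by simp
  have "f m\<^sub>1 dvd p\<^sup>2" "f m\<^sub>2 dvd p\<^sup>2" unfolding assms(4)[symmetric] by (auto intro: dvd_prodI)
  then obtain c b where c: "f m\<^sub>1 = p ^ c" "c \<le> 2" and b: "f m\<^sub>2 = p ^ b" "b \<le> 2"
    using divides_primepow_nat[OF assms(5)] by metis
  have "p ^ b dvd p ^ c" using assms(1) b c by metis
  then have bc: "b \<le> c" using p power_dvd_imp_le by blast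
  have "p ^ (c + b) dvd p ^ 2" using fR c b by (metis dvd_triv_left power_add)
  then have "c + b \<le> 2" using p power_dvd_imp_le by blast
  then consider "b = 0" | "b = 1" "c = 1" using bc by linarith
  then show ?thesis
  proof cases
    case 1
    then have f1: "f i = 1" if "i \<noteq> m\<^sub>1" for i using assms(2)[OF that] b by simp
    then have "R = 1" unfolding R_def by simp
    then have "f m\<^sub>1 = p\<^sup>2" using fR f1 assms(3) by simp
    then show ?thesis using f1 by auto
  next
    case 2
    then have "R = 1" using fR b c p by (simp add: power2_eq_square)
    then have "f i = 1" if "i \<noteq> m\<^sub>1" "i \<noteq> m\<^sub>2" for i
      using that dvd_prodI[of "UNIV - {m\<^sub>1} - {m\<^sub>2}" i f] unfolding R_def by simp
    then show ?thesis using 2 b c by auto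
  qed
qed

section \<open>Relative positions read off from indices and multiples\<close>

definition pos :: "'n::{finite,linorder} \<Rightarrow> nat" where
  "pos i = card {..<i}"

lemma pos_less: "i < j \<Longrightarrow> pos i < pos j"
  unfolding pos_def by (rule psubset_card_mono) auto

lemma pos_le_iff: "pos i \<le> pos j \<longleftrightarrow> i \<le> j"
  using pos_less[of i j] pos_less[of j i] by (metis leD linorder_less_linear not_le_imp_less order_le_less)

lemma pos_eq_iff: "pos i = pos j \<longleftrightarrow> i = j"
  using pos_le_iff by (metis order_antisym order_refl)

lemma pos_lt: "pos (i :: 'n::{finite,linorder}) < CARD('n)"
  unfolding pos_def by (rule psubset_card_mono) auto

lemma range_pos: "range (pos :: 'n::{finite,linorder} \<Rightarrow> nat) = {..<CARD('n)}"
proof (rule card_subset_eq)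
  have "inj (pos :: 'n \<Rightarrow> nat)" by (simp add: inj_def pos_eq_iff)
  then show "card (range (pos :: 'n \<Rightarrow> nat)) = card {..<CARD('n)}" by (simp add: card_image)
qed (auto simp: pos_lt)

lemma pos_exists:
  assumes "k < CARD('n)"
  obtains i :: "'n::{finite,linorder}" where "pos i = k"
  using assms range_pos by (metis imageE lessThan_iff)

lemma card_pos: "card {i :: 'n::{finite,linorder}. P (pos i)} = card {k. k < CARD('n) \<and> P k}"
proof -
  have "pos ` {i :: 'n. P (pos i)} = {k. k < CARD('n) \<and> P k}"
  proof -
    have "k \<in> pos ` {i :: 'n. P (pos i)}" if "k < CARD('n)" "P k" for k
      using pos_exists[OF that(1)] that(2) by (metis (mono_tags, lifting) image_eqI mem_Collect_eq)
    then show ?thesis using pos_lt by auto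
  qed
  moreover have "inj_on pos {i :: 'n. P (pos i)}" by (simp add: inj_on_def pos_eq_iff)
  ultimately show ?thesis using card_image by metis
qed

text \<open>The divisibility chains in \<open>adapted\<close> put the nontrivial \<open>u\<close> at
  the last indices and the nontrivial \<open>w\<close> at the first ones; hence this shape for
  \<open>u\<close>, and \<open>bottom_entries\<close> for \<open>w\<close>.\<close>

definition top_entries :: "nat \<Rightarrow> nat \<Rightarrow> 'n::{finite,linorder} \<Rightarrow> nat" where
  "top_entries k a i = (if CARD('n) - k \<le> pos i then a else 1)"

definition bottom_entries :: "nat \<Rightarrow> nat \<Rightarrow> 'n::{finite,linorder} \<Rightarrow> nat" where
  "bottom_entries k a i = (if pos i < k then a else 1)"

lemma prod_top_entries:
  assumes "k \<le> CARD('n)"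
  shows "prod (top_entries k a) (UNIV :: 'n::{finite,linorder} set) = a ^ k"
proof -
  have "prod (top_entries k a) (UNIV :: 'n set) = a ^ card {i :: 'n. CARD('n) - k \<le> pos i}"
    unfolding top_entries_def by (simp add: prod.If_cases)
  also have "card {i :: 'n. CARD('n) - k \<le> pos i} = card {j. j < CARD('n) \<and> CARD('n) - k \<le> j}"
    by (rule card_pos)
  also have "{j. j < CARD('n) \<and> CARD('n) - k \<le> j} = {CARD('n) - k..<CARD('n)}" by auto
  also have "card \<dots> = k" using assms by simp
  finally show ?thesis .
qed

lemma prod_bottom_entries:
  assumes "k \<le> CARD('n)"
  shows "prod (bottom_entries k a) (UNIV :: 'n::{finite,linorder} set) = a ^ k"
proof -
  have "prod (bottom_entries k a) (UNIV :: 'n set) = a ^ card {i :: 'n. pos i < k}"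
    unfolding bottom_entries_def by (simp add: prod.If_cases)
  also have "card {i :: 'n. pos i < k} = card {j. j < CARD('n) \<and> j < k}"
    by (rule card_pos)
  also have "{j. j < CARD('n) \<and> j < k} = {..<k}" using assms by auto
  finally show ?thesis by simp
qed

lemma adapted_squarefree:
  fixes H D :: "(real^'n::{finite,linorder}) set"
  assumes "adapted H D e u w"
  shows "squarefree a \<Longrightarrow> prod u UNIV = a \<Longrightarrow> u = top_entries 1 a"
    "squarefree a \<Longrightarrow> prod w UNIV = a \<Longrightarrow> w = bottom_entries 1 a"
proof -
  note ad = adapted_D[OF assms]
  have n: "CARD('n) > 0" by simp
  obtain m :: 'n where m: "pos m = CARD('n) - 1" using pos_exists n by (metis diff_less zero_less_one)
  have "i \<le> m" for i using pos_lt[of i] pos_le_iff[of i m] m by linarith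
  then have um: "u i dvd u m" for i using ad by blast
  have im: "i = m \<longleftrightarrow> CARD('n) - 1 \<le> pos i" for i
    using pos_lt[of i] pos_eq_iff[of i m] m by linarith
  show "u = top_entries 1 a" if "squarefree a" "prod u UNIV = a"
    using dvd_chain_squarefree[OF um that(2,1)] im by (simp add: fun_eq_iff top_entries_def)
  obtain l :: 'n where l: "pos l = 0" using pos_exists n by metis
  have "l \<le> i" for i using pos_le_iff[of l i] l by simp
  then have wl: "w i dvd w l" for i using ad by blast
  have il: "i = l \<longleftrightarrow> pos i < 1" for i
    using pos_eq_iff[of i l] l by linarith
  show "w = bottom_entries 1 a" if "squarefree a" "prod w UNIV = a"
    using dvd_chain_squarefree[OF wl that(2,1)] il by (simp add: fun_eq_iff bottom_entries_def)
qed

text \<open>The index p^2 leaves two chains, one entry p^2 or two entries p, that is, a cyclic or an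
  elementary quotient. Multiplication by p separates them, by
  \<open>adapted_scale_subset\<close>.\<close>

lemma adapted_prime_square:
  fixes H D :: "(real^'n::{finite,linorder}) set"
  assumes "adapted H D e u w" "CARD('n) \<ge> 2" "prime p"
  shows "prod u UNIV = p\<^sup>2 \<Longrightarrow> u = (if \<forall>x\<in>H. real p *\<^sub>R x \<in> D then top_entries 2 p else top_entries 1 (p\<^sup>2))"
    "prod w UNIV = p\<^sup>2 \<Longrightarrow> w = (if \<forall>x\<in>D. real p *\<^sub>R x \<in> H then bottom_entries 2 p else bottom_entries 1 (p\<^sup>2))"
proof -
  note ad = adapted_D[OF assms(1)]
  have p: "\<not> p\<^sup>2 dvd p" using assms(3) prime_gt_1_nat[of p] by (auto dest!: dvd_imp_le simp: power2_eq_square)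
  obtain m :: 'n where m: "pos m = CARD('n) - 1" using pos_exists assms(2) by (metis diff_less zero_less_one pos2 order_less_le_trans)
  obtain m' :: 'n where m': "pos m' = CARD('n) - 2" using pos_exists assms(2) by (metis diff_less pos2 order_less_le_trans)
  have mm': "m \<noteq> m'" using m m' assms(2) by auto
  have im: "i = m \<longleftrightarrow> CARD('n) - 1 \<le> pos i" for i
    using pos_lt[of i] pos_eq_iff[of i m] m by linarith
  have im': "i = m \<or> i = m' \<longleftrightarrow> CARD('n) - 2 \<le> pos i" for i
    using pos_lt[of i] pos_eq_iff[of i m] pos_eq_iff[of i m'] m m' assms(2) by linarith
  have "i \<le> m" for i using pos_lt[of i] pos_le_iff[of i m] m by linarith
  then have um: "u i dvd u m" for i using ad by blast
  have "i \<le> m'" if "i \<noteq> m" for i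
    using pos_lt[of i] pos_le_iff[of i m'] pos_eq_iff[of i m] that m m' by linarith
  then have um': "u i dvd u m'" if "i \<noteq> m" for i using ad that by blast
  show "u = (if \<forall>x\<in>H. real p *\<^sub>R x \<in> D then top_entries 2 p else top_entries 1 (p\<^sup>2))"
    if "prod u UNIV = p\<^sup>2"
    using dvd_chain_prime_square[OF um um' mm' that assms(3)]
  proof
    assume u: "u = (\<lambda>i. if i = m then p\<^sup>2 else 1)"
    then have "\<not> u m dvd p" using p by simp
    moreover have "u = top_entries 1 (p\<^sup>2)"
      unfolding u using im by (simp add: fun_eq_iff top_entries_def)
    ultimately show ?thesis unfolding adapted_scale_subset(1)[OF assms(1)] by metis
  next
    assume u: "u = (\<lambda>i. if i = m \<or> i = m' then p else 1)"
    then have "\<forall>i. u i dvd p" by simp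
    moreover have "u = top_entries 2 p"
      unfolding u using im' by (simp add: fun_eq_iff top_entries_def)
    ultimately show ?thesis unfolding adapted_scale_subset(1)[OF assms(1)] by metis
  qed
  obtain l :: 'n where l: "pos l = 0" using pos_exists assms(2) by (metis pos2 order_less_le_trans)
  obtain l' :: 'n where l': "pos l' = 1" using pos_exists assms(2) by (metis one_less_numeral_iff semiring_norm(76) order_less_le_trans)
  have ll': "l \<noteq> l'" using l l' by auto
  have il: "i = l \<longleftrightarrow> pos i < 1" for i
    using pos_eq_iff[of i l] l by linarith
  have il': "i = l \<or> i = l' \<longleftrightarrow> pos i < 2" for i
    using pos_eq_iff[of i l] pos_eq_iff[of i l'] l l' by linarith
  have "l \<le> i" for i using pos_le_iff[of l i] l by simp
  then have wl: "w i dvd w l" for i using ad by blast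
  have "l' \<le> i" if "i \<noteq> l" for i
    using pos_le_iff[of l' i] pos_eq_iff[of i l] that l l' by linarith
  then have wl': "w i dvd w l'" if "i \<noteq> l" for i using ad that by blast
  show "w = (if \<forall>x\<in>D. real p *\<^sub>R x \<in> H then bottom_entries 2 p else bottom_entries 1 (p\<^sup>2))"
    if "prod w UNIV = p\<^sup>2"
    using dvd_chain_prime_square[OF wl wl' ll' that assms(3)]
  proof
    assume w: "w = (\<lambda>i. if i = l then p\<^sup>2 else 1)"
    then have "\<not> w l dvd p" using p by simp
    moreover have "w = bottom_entries 1 (p\<^sup>2)"
      unfolding w using il by (simp add: fun_eq_iff bottom_entries_def)
    ultimately show ?thesis unfolding adapted_scale_subset(2)[OF assms(1)] by metis
  next
    assume w: "w = (\<lambda>i. if i = l \<or> i = l' then p else 1)"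
    then have "\<forall>i. w i dvd p" by simp
    moreover have "w = bottom_entries 2 p"
      unfolding w using il' by (simp add: fun_eq_iff bottom_entries_def)
    ultimately show ?thesis unfolding adapted_scale_subset(2)[OF assms(1)] by metis
  qed
qed

text \<open>Unlike \<open>adapted\<close>, this fixes the position diag(u/w) relative to
  \<open>H\<close> without any normalisation of the fractions, which is the form in which a double
  coset delivers it.\<close>

definition lat_type where
  "lat_type u w H = {D. \<exists>e. invertible e \<and> lat e = H \<and> D = lat (dmat (\<lambda>i. real (u i) / real (w i)) ** e)}"

text \<open>The bound on k + l keeps the two blocks of nontrivial entries apart, so that at each
  index the numerator or the denominator is 1. For k = l = 2 it asks for dimension at least
  4.\<close>

lemma lat_type_adapted:
  fixes H :: "(real^'n::{finite,linorder}) set"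
  assumes "a > 0" "b > 0" "k + l \<le> CARD('n)"
  shows "D \<in> lat_type (top_entries k a) (bottom_entries l b) H \<longleftrightarrow>
    (\<exists>e. adapted H D e (top_entries k a) (bottom_entries l b))"
proof -
  have "top_entries k a i > 0 \<and> bottom_entries l b i > 0 \<and> coprime (top_entries k a i) (bottom_entries l b i)"
    for i :: 'n
    using assms by (auto simp: top_entries_def bottom_entries_def)
  moreover have "top_entries k a i dvd top_entries k a j \<and> bottom_entries l b j dvd bottom_entries l b i"
    if "i \<le> j" for i j :: 'n
    using that pos_le_iff[of i j] by (auto simp: top_entries_def bottom_entries_def)
  ultimately show ?thesis unfolding lat_type_def adapted_def mem_Collect_eq by metis
qed

lemma lat_type_squarefree:
  fixes H :: "(real^'n::{finite,linorder}) set"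
  assumes "squarefree a" "squarefree b" "CARD('n) \<ge> 2"
  shows "lat_type (top_entries 1 a) (bottom_entries 1 b) H = {D. adj a b H D}"
proof -
  have ab: "a > 0" "b > 0" using assms by (auto intro!: Nat.gr0I)
  have n: "1 \<le> CARD('n)" using assms by simp
  have "D \<in> lat_type (top_entries 1 a) (bottom_entries 1 b) H \<longleftrightarrow> adj a b H D" for D
  proof -
    have "D \<in> lat_type (top_entries 1 a) (bottom_entries 1 b) H \<longleftrightarrow>
      (\<exists>e. adapted H D e (top_entries 1 a) (bottom_entries 1 b))"
      using assms by (intro lat_type_adapted ab) simp
    also have "\<dots> \<longleftrightarrow> adj a b H D"
    proof
      assume "\<exists>e. adapted H D e (top_entries 1 a) (bottom_entries 1 b)"
      then show "adj a b H D"
        using adapted_adj prod_top_entries[OF n] prod_bottom_entries[OF n] by (metis power_one_right)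
    next
      assume "adj a b H D"
      then obtain e u w where a: "adapted H D e u w" "prod u UNIV = a" "prod w UNIV = b"
        by (rule adj_adapted)
      then show "\<exists>e. adapted H D e (top_entries 1 a) (bottom_entries 1 b)"
        using adapted_squarefree[OF a(1)] assms by metis
    qed
    finally show ?thesis .
  qed
  then show ?thesis by blast
qed

text \<open>\<open>s\<close> and \<open>t\<close> record whether p annihilates H/(H cap D),
  respectively D/(H cap D). Together with the indices they separate the four positions into which
  the second identity splits for p = q.\<close>

lemma lat_type_prime_square:
  fixes H :: "(real^'n::{finite,linorder}) set"
  assumes "prime p" "CARD('n) \<ge> 4"
  shows "lat_type (if s then top_entries 2 p else top_entries 1 (p\<^sup>2))
      (if t then bottom_entries 2 p else bottom_entries 1 (p\<^sup>2)) H =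
    {D. adj (p\<^sup>2) (p\<^sup>2) H D \<and> ((\<forall>x\<in>H. real p *\<^sub>R x \<in> D) \<longleftrightarrow> s) \<and> ((\<forall>x\<in>D. real p *\<^sub>R x \<in> H) \<longleftrightarrow> t)}"
    (is "lat_type ?u ?w H = _")
proof -
  have p: "p > 1" "p > 0" "p\<^sup>2 > 0" using assms prime_gt_1_nat prime_gt_0_nat by auto
  have p2: "\<not> p\<^sup>2 dvd p" using p by (auto dest!: dvd_imp_le simp: power2_eq_square)
  have n: "1 \<le> CARD('n)" "2 \<le> CARD('n)" using assms by simp_all
  have prod: "prod ?u (UNIV::'n set) = p\<^sup>2" "prod ?w (UNIV::'n set) = p\<^sup>2"
    using n by (simp_all add: prod_top_entries prod_bottom_entries)
  have iff: "D \<in> lat_type ?u ?w H \<longleftrightarrow> (\<exists>e. adapted H D e ?u ?w)" for D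
    by (cases s; cases t; simp only: if_True if_False; rule lat_type_adapted; insert p assms(2); simp)
  obtain m :: 'n where m: "pos m = CARD('n) - 1" using pos_exists n by (metis diff_less zero_less_one order_less_le_trans)
  obtain l :: 'n where l: "pos l = 0" using pos_exists n by (metis zero_less_one order_less_le_trans)
  have "\<not> top_entries 1 (p\<^sup>2) m dvd p" "\<not> bottom_entries 1 (p\<^sup>2) l dvd p"
    using m l p2 by (simp_all add: top_entries_def bottom_entries_def)
  moreover have "top_entries 2 p i dvd p" "bottom_entries 2 p i dvd p" for i :: 'n
    by (simp_all add: top_entries_def bottom_entries_def)
  ultimately have st: "(\<forall>i::'n. ?u i dvd p) \<longleftrightarrow> s" "(\<forall>i::'n. ?w i dvd p) \<longleftrightarrow> t"
    by (cases s; cases t; auto)+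
  have "D \<in> lat_type ?u ?w H \<longleftrightarrow> adj (p\<^sup>2) (p\<^sup>2) H D \<and> ((\<forall>x\<in>H. real p *\<^sub>R x \<in> D) \<longleftrightarrow> s)
      \<and> ((\<forall>x\<in>D. real p *\<^sub>R x \<in> H) \<longleftrightarrow> t)" for D
    unfolding iff
  proof
    assume "\<exists>e. adapted H D e ?u ?w"
    then obtain e where e: "adapted H D e ?u ?w" by blast
    show "adj (p\<^sup>2) (p\<^sup>2) H D \<and> ((\<forall>x\<in>H. real p *\<^sub>R x \<in> D) \<longleftrightarrow> s)
      \<and> ((\<forall>x\<in>D. real p *\<^sub>R x \<in> H) \<longleftrightarrow> t)"
      unfolding adapted_scale_subset[OF e] st using adapted_adj[OF e] prod by simp
  next
    assume D: "adj (p\<^sup>2) (p\<^sup>2) H D \<and> ((\<forall>x\<in>H. real p *\<^sub>R x \<in> D) \<longleftrightarrow> s)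
      \<and> ((\<forall>x\<in>D. real p *\<^sub>R x \<in> H) \<longleftrightarrow> t)"
    then obtain e u w where a: "adapted H D e u w" "prod u UNIV = p\<^sup>2" "prod w UNIV = p\<^sup>2"
      using adj_adapted by blast
    then have "u = ?u" "w = ?w"
      using adapted_prime_square[OF a(1) n(2) assms(1)] D by presburger+
    then show "\<exists>e. adapted H D e ?u ?w" using a(1) by blast
  qed
  then show ?thesis by blast
qed

text \<open>If p = q annihilates H/I, this quotient is a plane over the field with p elements, and
  the lattices K are its p + 1 lines. Otherwise H/I is cyclic, as it is for different primes, and
  has a single subgroup of index p.\<close>

lemma card_intermediate:
  fixes H I :: "(real^'n::{finite,linorder}) set"
  assumes "lat_index (p * q) I H" "prime p" "prime q" "CARD('n) \<ge> 2"
  shows "finite {K. I \<subseteq> K \<and> lat_index p K H}"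
    "card {K. I \<subseteq> K \<and> lat_index p K H} = (if p = q \<and> (\<forall>x\<in>H. real p *\<^sub>R x \<in> I) then p + 1 else 1)"
proof -
  have IH: "I \<in> lattices" "H \<in> lattices" "I \<subseteq> H" using assms(1) lat_index_def by auto
  then obtain e u w where a: "adapted H I e u w" using commens_adapted commens_subset by blast
  note ad = adapted_D[OF a]
  have HI: "H \<inter> I = I" using IH by blast
  then have prod: "prod u UNIV = p * q" using adapted_index(1)[OF a] assms lat_index_unique by metis
  have Iu: "I = lat (dmat (\<lambda>i. real (u i)) ** e)" using adapted_Int[OF a] HI by simp
  have p: "p > 1" "p > 0" "q > 0" using assms prime_gt_1_nat prime_gt_0_nat by auto
  show "finite {K. I \<subseteq> K \<and> lat_index p K H}"
    by (rule finite_subset[OF _ card_sublattices(1)[OF IH(2) assms(2)]]) auto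
  show "card {K. I \<subseteq> K \<and> lat_index p K H} = (if p = q \<and> (\<forall>x\<in>H. real p *\<^sub>R x \<in> I) then p + 1 else 1)"
  proof (cases "p = q \<and> (\<forall>x\<in>H. real p *\<^sub>R x \<in> I)")
    case True
    then have updvd: "u i dvd p" for i using adapted_scale_subset(1)[OF a] by blast
    define J where "J = {i. u i = p}"
    have up: "u i = (if i \<in> J then p else 1)" for i
      using updvd[of i] assms(2) unfolding J_def prime_nat_iff by auto
    have "p ^ card J = prod u UNIV" unfolding up[abs_def] by (simp add: prod.If_cases)
    then have "p ^ card J = p ^ 2" using prod True by (simp add: power2_eq_square)
    then have J: "card J = 2" using p(1) power_inject_exp by blast
    define g where "g = dmat (\<lambda>i. real (u i)) ** e"
    have "real (u i) \<noteq> 0" for i using ad(7) by simp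
    then have g: "invertible g" "I = lat g"
      unfolding g_def Iu by (intro invertible_mult invertible_dmat ad(1) HOL.refl | assumption)+
    \<comment> \<open>Dividing the basis of \<open>I\<close> by p at the two indices in
      \<open>J\<close> undoes \<open>u\<close> and gives back \<open>H\<close>.\<close>
    have "dmat (inv_p J p) ** g = dmat (\<lambda>i. 1) ** e"
      unfolding g_def dmat_mult using p by (simp add: inv_p_def up if_distrib cong: if_cong)
    then have "H = lat (dmat (inv_p J p) ** g)" using ad(2) dmat_one by metis
    moreover have "I \<subseteq> K \<and> lat_index p K H \<longleftrightarrow> lat_index p I K \<and> K \<subseteq> H" for K
      using assms(1) True p unfolding lat_index_def by auto
    ultimately have "{K. I \<subseteq> K \<and> lat_index p K H} = {K. lat_index p (lat g) K \<and> K \<subseteq> lat (dmat (inv_p J p) ** g)}"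
      using g by auto
    then have "(p - 1) * card {K. I \<subseteq> K \<and> lat_index p K H} = p ^ 2 - 1"
      using card_superlattices_within(2)[OF assms(2) g(1), of J] J by simp
    also have "p ^ 2 - 1 = (p - 1) * (p + 1)" by (simp add: power2_eq_square algebra_simps)
    finally have "(p - 1) * card {K. I \<subseteq> K \<and> lat_index p K H} = (p - 1) * (p + 1)" .
    moreover have "p - 1 \<noteq> 0" using p(1) by simp
    ultimately have "card {K. I \<subseteq> K \<and> lat_index p K H} = p + 1" by (metis mult_left_cancel neq0_conv)
    then show ?thesis unfolding if_P[OF True] .
  next
    case False
    have u: "u = top_entries 1 (p * q)"
    proof (cases "p = q")
      case True
      then have "\<not> (\<forall>x\<in>H. real p *\<^sub>R x \<in> I)" using False by blast
      moreover have "prod u UNIV = p\<^sup>2" using prod True by (simp add: power2_eq_square)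
      ultimately have "u = top_entries 1 (p\<^sup>2)"
        using adapted_prime_square(1)[OF a assms(4,2)] by (simp only: if_False)
      then show ?thesis using True by (simp add: power2_eq_square)
    next
      case False
      then have "squarefree (p * q)"
        using assms primes_coprime by (intro squarefree_mult_coprime) (auto intro: squarefree_prime)
      then show ?thesis using adapted_squarefree(1)[OF a] prod by blast
    qed
    \<comment> \<open>The only candidate, with the last basis vector multiplied by p. Any K contains
      that multiple because its index is p, and the other basis vectors because they lie in
      \<open>I\<close>.\<close>
    define K\<^sub>0 where "K\<^sub>0 = lat (dmat (\<lambda>i. real (top_entries 1 p i)) ** e)"
    have n: "1 \<le> CARD('n)" using assms by simp
    have 0: "lat_index p K\<^sub>0 H"
    proof -
      have "lat_index (prod (top_entries 1 p) (UNIV :: 'n set)) K\<^sub>0 (lat (dmat (\<lambda>i. 1) ** e))"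
        unfolding K\<^sub>0_def by (rule lat_index_dmat[OF ad(1)]) (use p in \<open>auto simp: top_entries_def\<close>)
      then show ?thesis unfolding dmat_one prod_top_entries[OF n] ad(2)[symmetric] by simp
    qed
    have "lat_index (prod (top_entries 1 q) (UNIV :: 'n set)) I K\<^sub>0"
      unfolding K\<^sub>0_def Iu u by (rule lat_index_dmat[OF ad(1)]) (use p in \<open>auto simp: top_entries_def\<close>)
    then have IK: "I \<subseteq> K\<^sub>0" unfolding lat_index_def by blast
    have "K = K\<^sub>0" if K: "I \<subseteq> K" "lat_index p K H" for K
    proof -
      have "K\<^sub>0 \<subseteq> K" unfolding K\<^sub>0_def
      proof (rule lat_subset_if_rows)
        show "K \<in> lattices" using K lat_index_def by blast
        fix i
        show "row i (dmat (\<lambda>i. real (top_entries 1 p i)) ** e) \<in> K"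
        proof (cases "CARD('n) - 1 \<le> pos i")
          case True
          have "real p *\<^sub>R row i e \<in> K" using lat_index_scale[OF K(2)] row_in_lat ad(2) by blast
          then show ?thesis using True by (simp add: row_dmat_mult top_entries_def)
        next
          case False
          have "row i (dmat (\<lambda>i. real (u i)) ** e) \<in> I" unfolding Iu by (rule row_in_lat)
          then show ?thesis using False K(1) unfolding row_dmat_mult u by (auto simp: top_entries_def)
        qed
      qed
      then show ?thesis using lat_index_eqI[OF 0 K(2)] p by simp
    qed
    then have "{K. I \<subseteq> K \<and> lat_index p K H} = {K\<^sub>0}" using 0 IK by blast
    then show ?thesis unfolding if_not_P[OF False] by simp
  qed
qed

section \<open>Compositions of correspondences between lattices\<close>

lemma lat_index_lattices:
  assumes "lat_index k M H"
  shows "M \<in> lattices" "H \<in> lattices" "M \<subseteq> H"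
  using assms unfolding lat_index_def by auto

lemma adj_commute: "adj a b H D \<longleftrightarrow> adj b a D H"
  unfolding adj_def by (auto simp: Int_commute)

lemma adj_self: "adj a b H H \<Longrightarrow> a = 1"
  unfolding adj_def using lat_index_self lat_index_lattices by fastforce

lemma adj_unique: "adj a b H D \<Longrightarrow> adj a' b' H D \<Longrightarrow> a = a' \<and> b = b'"
  unfolding adj_def using lat_index_unique by blast

lemma prime_factor_cases:
  assumes "prime p" "p = a * b"
  shows "a = 1 \<and> b = p \<or> a = p \<and> b = (1::nat)"
  using assms by (metis mult.right_neutral mult_1 prime_product)

text \<open>The index of H + D in \<open>Z\<close> divides both p and q. If it were not 1, it would
  equal both primes, and \<open>H\<close> and \<open>D\<close> would both be equal to H + D.\<close>

lemma lsum_eq_if_prime_index: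
  fixes H D Z :: "(real^'n::{finite,linorder}) set"
  assumes "lat_index p H Z" "lat_index q D Z" "prime p" "prime q" "D \<noteq> H"
  shows "lsum H D = Z"
proof -
  note l = lat_index_lattices[OF assms(1)] lat_index_lattices[OF assms(2)]
  have "commens H D" using commens_if_subset l by blast
  then obtain a b where "lat_index b H (lsum H D)" "lat_index a D (lsum H D)"
    by (rule commens_index)
  then have S: "lsum H D \<in> lattices" "H \<subseteq> lsum H D" "D \<subseteq> lsum H D"
    using lat_index_lattices by blast+
  have SZ: "lsum H D \<subseteq> Z" using lsum_subset l by blast
  obtain a b where ab: "p = a * b" "lat_index a (lsum H D) Z" "lat_index b H (lsum H D)"
    using lat_index_factor[OF assms(1) S(1,2) SZ] by blast
  obtain a' b' where ab': "q = a' * b'" "lat_index a' (lsum H D) Z" "lat_index b' D (lsum H D)"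
    using lat_index_factor[OF assms(2) S(1,3) SZ] by blast
  have "a' = a" using ab ab' lat_index_unique by blast
  moreover have "\<not> (b = 1 \<and> b' = 1)" using ab(3) ab'(3) lat_index_1 assms(5) by metis
  ultimately have "a = 1"
    using prime_factor_cases[OF assms(3) ab(1)] prime_factor_cases[OF assms(4) ab'(1)] by auto
  then show ?thesis using ab(2) lat_index_1 by blast
qed

lemma Int_eq_if_prime_index:
  fixes H M I :: "(real^'n::{finite,linorder}) set"
  assumes "lat_index p I H" "lat_index p I M" "prime p" "M \<noteq> H"
  shows "H \<inter> M = I"
proof -
  note l = lat_index_lattices[OF assms(1)] lat_index_lattices[OF assms(2)]
  have p: "p > 0" using assms(3) prime_gt_0_nat by blast
  have "commens H M" using commens_if_superset l by blast
  then obtain a b where "lat_index a (H \<inter> M) H" by (rule commens_index)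
  then have "H \<inter> M \<in> lattices" using lat_index_lattices by blast
  then obtain a b where ab: "p = a * b" "lat_index a (H \<inter> M) M" "lat_index b I (H \<inter> M)"
    using lat_index_factor[OF assms(2), of "H \<inter> M"] l by blast
  have "a \<noteq> 1"
  proof
    assume "a = 1"
    then have "H \<inter> M = M" using ab(2) lat_index_1 by blast
    then show False using lat_index_eqI'[OF assms(2,1) _ p] assms(4) by blast
  qed
  then have "b = 1" using prime_factor_cases[OF assms(3) ab(1)] by auto
  then show ?thesis using ab(3) lat_index_1 by blast
qed

text \<open>Double counting: a sum over paths becomes a sum over end points, each weighted by its
  number of intermediate stops. \<open>U\<close> may be any finite set containing all end
  points.\<close>

lemma sum_sum_count:
  fixes F :: "'b \<Rightarrow> complex"
  assumes "finite A" "finite U" "\<And>a D. a \<in> A \<Longrightarrow> D \<in> B a \<Longrightarrow> D \<in> U"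
  shows "(\<Sum>a\<in>A. \<Sum>D\<in>B a. F D) = (\<Sum>D\<in>U. of_nat (card {a\<in>A. D \<in> B a}) * F D)"
proof -
  have "(\<Sum>a\<in>A. \<Sum>D\<in>B a. F D) = (\<Sum>a\<in>A. \<Sum>D | D \<in> U \<and> D \<in> B a. F D)"
    using assms(3) by (intro sum.cong) auto
  also have "\<dots> = (\<Sum>D\<in>U. \<Sum>a | a \<in> A \<and> D \<in> B a. F D)"
    by (rule sum.swap_restrict[OF assms(1,2)])
  finally show ?thesis by simp
qed

lemma adj_squarefree_finite:
  fixes H :: "(real^'n::{finite,linorder}) set"
  assumes "H \<in> lattices" "prime p" "prime q"
  shows "finite {D. adj q p H D}"
proof (rule finite_subset)
  show "{D. adj q p H D} \<subseteq> (\<Union>Z\<in>{Z. lat_index p H Z}. {D. lat_index q D Z})"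
  proof
    fix D assume "D \<in> {D. adj q p H D}"
    then have "lat_index p H (lsum H D)" "lat_index q D (lsum H D)" using adj_lsum by auto
    then show "D \<in> (\<Union>Z\<in>{Z. lat_index p H Z}. {D. lat_index q D Z})" by blast
  qed
  show "finite (\<Union>Z\<in>{Z. lat_index p H Z}. {D. lat_index q D Z})"
  proof (rule finite_UN_I)
    show "finite {D. lat_index q D Z}" if "Z \<in> {Z. lat_index p H Z}" for Z
      using that card_sublattices(1)[OF _ assms(3)] lat_index_lattices(2) by (metis mem_Collect_eq)
  qed (rule card_superlattices(1)[OF assms(1,2)])
qed

text \<open>For an end point D different from \<open>H\<close> the intermediate lattice can only be
  H + D, so the weight is 1. For D = \<open>H\<close>, which requires p = q, every superlattice
  counts.\<close>

theorem sum_up_down: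
  fixes H :: "(real^'n::{finite,linorder}) set" and F :: "(real^'n::{finite,linorder}) set \<Rightarrow> complex"
  assumes "H \<in> lattices" "prime p" "prime q"
  shows "(\<Sum>Z | lat_index p H Z. \<Sum>D | lat_index q D Z. F D) =
    (\<Sum>D | adj q p H D. F D) + of_bool (p = q) * of_nat (card {Z. lat_index p H Z}) * F H"
proof -
  let ?A = "{Z. lat_index p H Z}" and ?X = "{D. adj q p H D}" and ?E = "if p = q then {H} else {}"
  have HX: "H \<notin> ?X" using adj_self assms by (metis mem_Collect_eq not_prime_1)
  have fin: "finite ?A" "finite ?X" using card_superlattices(1) adj_squarefree_finite assms by blast+
  have U: "D \<in> ?X \<union> ?E" if "Z \<in> ?A" "D \<in> {D. lat_index q D Z}" for Z D
  proof (cases "D = H")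
    case True
    then show ?thesis using that lat_index_unique by auto
  next
    case False
    then have "lsum H D = Z" using lsum_eq_if_prime_index that assms by blast
    then show ?thesis using that lsum_adj by auto
  qed
  have 1: "card {Z \<in> ?A. D \<in> {D. lat_index q D Z}} = 1" if D: "D \<in> ?X" for D
  proof -
    have "D \<noteq> H" using D HX by blast
    then have "Z = lsum H D" if "lat_index p H Z" "lat_index q D Z" for Z
      using lsum_eq_if_prime_index[OF that assms(2,3)] by simp
    moreover have "lat_index p H (lsum H D)" "lat_index q D (lsum H D)"
      using D adj_lsum[of q p H D] by simp_all
    ultimately have "{Z \<in> ?A. D \<in> {D. lat_index q D Z}} = {lsum H D}" by blast
    then show ?thesis by simp
  qed
  have "(\<Sum>Z\<in>?A. \<Sum>D | lat_index q D Z. F D) =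
      (\<Sum>D\<in>?X \<union> ?E. of_nat (card {Z \<in> ?A. D \<in> {D. lat_index q D Z}}) * F D)"
    by (rule sum_sum_count) (use fin U in auto)
  also have "\<dots> = (\<Sum>D\<in>?X. of_nat (card {Z \<in> ?A. D \<in> {D. lat_index q D Z}}) * F D)
      + (\<Sum>D\<in>?E. of_nat (card {Z \<in> ?A. D \<in> {D. lat_index q D Z}}) * F D)"
    by (rule sum.union_disjoint) (use fin HX in auto)
  also have "(\<Sum>D\<in>?X. of_nat (card {Z \<in> ?A. D \<in> {D. lat_index q D Z}}) * F D) = sum F ?X"
    using 1 by (intro sum.cong) auto
  finally show ?thesis by simp
qed

lemma card_prime_index_eq:
  fixes H H' :: "(real^'n::{finite,linorder}) set"
  assumes "H \<in> lattices" "H' \<in> lattices" "prime p"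
  shows "card {Z. lat_index p H' Z} = card {Z. lat_index p H Z}"
    "card {M. lat_index p M H'} = card {Z. lat_index p H Z}"
proof -
  have "(p - 1) * card {Z. lat_index p H' Z} = (p - 1) * card {Z. lat_index p H Z}"
    using card_superlattices(2)[OF assms(1,3)] card_superlattices(2)[OF assms(2,3)] by simp
  moreover have "p - 1 \<noteq> 0" using assms(3) prime_gt_1_nat[of p] by simp
  ultimately show "card {Z. lat_index p H' Z} = card {Z. lat_index p H Z}"
    by (metis mult_left_cancel neq0_conv)
  then show "card {M. lat_index p M H'} = card {Z. lat_index p H Z}"
    using card_sublattices(2)[OF assms(2,3)] by simp
qed

text \<open>\<open>sum_up_down\<close> with the constant 1: there are c choices for Z and c for D
  below it, and c of these paths return to \<open>H\<close>.\<close>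

lemma card_adj_prime:
  fixes H :: "(real^'n::{finite,linorder}) set"
  assumes "H \<in> lattices" "prime p"
  defines "c \<equiv> card {Z. lat_index p H Z}"
  shows "card {D. adj p p H D} + c = c * c"
proof -
  have c: "card {D. lat_index p D Z} = c" if "lat_index p H Z" for Z
    unfolding c_def by (rule card_prime_index_eq(2)[OF assms(1) lat_index_lattices(2)[OF that] assms(2)])
  have "of_nat (c * c) = (\<Sum>Z | lat_index p H Z. \<Sum>D | lat_index p D Z. (1::complex))"
    using c by (simp add: c_def)
  also have "\<dots> = of_nat (card {D. adj p p H D} + c)"
    by (subst sum_up_down[OF assms(1,2,2)]) (simp add: c_def)
  finally show ?thesis by (metis of_nat_eq_iff)
qed

text \<open>The common neighbours of two neighbours \<open>H\<close> and \<open>D\<close> are the lattices lying just above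
  \<open>H \<inter> D\<close> or just below \<open>H + D\<close>; \<open>p + 1\<close> lattices, including \<open>H\<close> and \<open>D\<close>, do both.\<close>

lemma card_common_neighbours:
  fixes H D :: "(real^'n::{finite,linorder}) set"
  assumes HD: "adj p p H D" and p: "prime p" and n: "CARD('n) \<ge> 2"
  shows "card {M. adj p p H M \<and> adj p p M D} + p + 3 = 2 * card {Z. lat_index p H Z}"
proof -
  let ?I = "H \<inter> D" and ?S = "lsum H D"
  define c where "c = card {Z. lat_index p H Z}"
  have I: "lat_index p ?I H" "lat_index p ?I D" using HD unfolding adj_def by auto
  have S: "lat_index p H ?S" "lat_index p D ?S" using adj_lsum HD by blast+
  note l = lat_index_lattices[OF I(1)] lat_index_lattices[OF I(2)] lat_index_lattices[OF S(1)]
  have p1: "p > 1" "p - 1 \<noteq> 0" using p prime_gt_1_nat[of p] by auto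
  have "H \<noteq> D" using HD adj_self p by (metis not_prime_1)
  have card_c: "card {M. lat_index p ?I M} = c" "card {M. lat_index p M ?S} = c"
    unfolding c_def using card_prime_index_eq[OF l(2) _ p] l by blast+
  let ?A = "{M. lat_index p ?I M}" and ?B = "{M. lat_index p M ?S}"
  have fin: "finite ?A" "finite ?B" using card_superlattices(1)[OF _ p] card_sublattices(1)[OF _ p] l by auto
  have IS: "lat_index (p * p) ?I ?S" using lat_index_trans[OF S(1) I(1)] .
  \<comment> \<open>As p annihilates (H + D)/(H cap D), \<open>card_intermediate\<close> falls into
    its elementary case, which yields the p + 1 lattices in both families.\<close>
  have "\<forall>x\<in>?S. real p *\<^sub>R x \<in> ?I"
  proof
    fix x assume "x \<in> ?S"
    then obtain y z where "x = y + z" "y \<in> H" "z \<in> D" unfolding lsum_def by blast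
    then show "real p *\<^sub>R x \<in> ?I"
      using lat_index_scale I lattice_closed(2)[OF l(1)] by (metis scaleR_add_right)
  qed
  then have "card {M. ?I \<subseteq> M \<and> lat_index p M ?S} = p + 1"
    using card_intermediate(2)[OF IS p p n] by (auto split: if_splits)
  moreover have "?A \<inter> ?B = {M. ?I \<subseteq> M \<and> lat_index p M ?S}"
    using IS p1 unfolding lat_index_def by auto
  ultimately have AB: "card (?A \<inter> ?B) = p + 1" by simp
  have "card ?A + card ?B = card (?A \<union> ?B) + card (?A \<inter> ?B)"
    by (rule card_Un_Int[OF fin])
  then have "card (?A \<union> ?B) + (p + 1) = 2 * c" using AB card_c by simp
  moreover have "{M. adj p p H M \<and> adj p p M D} = (?A \<union> ?B) - {H, D}"
  proof
    show "(?A \<union> ?B) - {H, D} \<subseteq> {M. adj p p H M \<and> adj p p M D}"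
    proof
      fix M assume M: "M \<in> (?A \<union> ?B) - {H, D}"
      have "adj p p X M" if "X = H \<or> X = D" for X
      proof (cases "M \<in> ?A")
        case True
        then have "X \<inter> M = ?I" using Int_eq_if_prime_index[of p ?I X M] I that M p by blast
        then show ?thesis using True I that unfolding adj_def by auto
      next
        case False
        then have B: "lat_index p M ?S" using M by blast
        then have "lsum X M = ?S" using lsum_eq_if_prime_index[of p X ?S p M] S that M p by blast
        then show ?thesis using B S that lsum_adj by metis
      qed
      then have "adj p p H M" "adj p p D M" by blast+
      then show "M \<in> {M. adj p p H M \<and> adj p p M D}" using adj_commute[of p p D M] by simp
    qed
    show "{M. adj p p H M \<and> adj p p M D} \<subseteq> (?A \<union> ?B) - {H, D}"
    proof
      fix M assume "M \<in> {M. adj p p H M \<and> adj p p M D}"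
      then have M: "adj p p H M" "adj p p M D" by auto
      have K: "lat_index p (H \<inter> M) H" "lat_index p (H \<inter> M) M" using M(1) unfolding adj_def by auto
      have J: "lat_index p (M \<inter> D) M" "lat_index p (M \<inter> D) D" using M(2) unfolding adj_def by auto
      have "M \<noteq> H" "M \<noteq> D" using M adj_self p by (metis not_prime_1)+
      \<comment> \<open>M contains H cap M and M cap D with index p. If they agree, M lies over H
        cap D; if not, they generate M, which therefore lies in H + D.\<close>
      moreover have "M \<in> ?A \<union> ?B"
      proof (cases "H \<inter> M = M \<inter> D")
        case True
        then have "H \<inter> M = ?I" using lat_index_eqI[OF K(1) I(1)] p1 by auto
        then show ?thesis using K by simp
      next
        case False
        then have "lsum (H \<inter> M) (M \<inter> D) = M"
          using lsum_eq_if_prime_index[OF K(2) J(1) p p] by blast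
        then have "M \<subseteq> ?S" unfolding lsum_def by blast
        moreover have "covol M = covol H" using K p1 unfolding lat_index_def by simp
        ultimately have "lat_index p M ?S" using S(1) lat_index_lattices[OF K(2)] unfolding lat_index_def by simp
        then show ?thesis by blast
      qed
      ultimately show "M \<in> (?A \<union> ?B) - {H, D}" by blast
    qed
  qed
  \<comment> \<open>\<open>H\<close> and \<open>D\<close> belong to both families without being
    neighbours of themselves, so 2 is subtracted from 2c - (p + 1).\<close>
  moreover have "card ((?A \<union> ?B) - {H, D}) = card (?A \<union> ?B) - 2"
    using \<open>H \<noteq> D\<close> I by (subst card_Diff_subset) auto
  moreover have "card {H, D} \<le> card (?A \<union> ?B)"
    by (rule card_mono) (use fin I in auto)
  ultimately show ?thesis using \<open>H \<noteq> D\<close> unfolding c_def[symmetric] by simp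
qed

text \<open>Put K = H cap M and J = M cap D. If K = J, then \<open>H\<close> and \<open>D\<close>
  both lie just over K, so they are equal or neighbours. Hence K + J = M, and K cap J has index p q
  in \<open>H\<close> and in \<open>D\<close>. It remains to see that K cap J is all of H cap D: its
  index there divides p and q, and if it were not 1, then \<open>H\<close> and \<open>D\<close>
  would again be neighbours.\<close>

lemma adj_adj_generic:
  fixes H M D :: "(real^'n::{finite,linorder}) set"
  assumes HM: "adj p p H M" and MD: "adj q q M D" and p: "prime p" and q: "prime q"
    and generic: "\<not> (p = q \<and> (D = H \<or> adj p p H D))"
  shows "adj (p * q) (p * q) H D" "H \<inter> D = (H \<inter> M) \<inter> (M \<inter> D)" "lsum (H \<inter> M) (M \<inter> D) = M"
proof -
  define K where "K = H \<inter> M"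
  define J where "J = M \<inter> D"
  define I where "I = H \<inter> D"
  have K: "lat_index p K H" "lat_index p K M" using HM unfolding adj_def K_def by auto
  have J: "lat_index q J M" "lat_index q J D" using MD unfolding adj_def J_def by auto
  note l = lat_index_lattices[OF K(1)] lat_index_lattices[OF K(2)]
    lat_index_lattices[OF J(1)] lat_index_lattices[OF J(2)]
  have p0: "p > 0" "q > 0" using p q prime_gt_0_nat by auto
  have "K \<noteq> J"
  proof
    assume "K = J"
    then have "p = q" using K(2) J(1) lat_index_unique by blast
    have KD: "lat_index p K D" using J(2) \<open>K = J\<close> \<open>p = q\<close> by simp
    have "D \<noteq> H" using generic \<open>p = q\<close> by blast
    then have "H \<inter> D = K" using Int_eq_if_prime_index[OF K(1) KD p] by blast
    then have "adj p p H D" using K(1) KD unfolding adj_def by simp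
    then show False using generic \<open>p = q\<close> by blast
  qed
  then show sum: "lsum (H \<inter> M) (M \<inter> D) = M"
    using lsum_eq_if_prime_index[OF K(2) J(1) p q] unfolding K_def J_def by blast
  then have "adj q p K J" using lsum_adj[of p K J q] K(2) J(1) unfolding K_def J_def by simp
  then have KJ: "lat_index q (K \<inter> J) K" "lat_index p (K \<inter> J) J" unfolding adj_def by auto
  have H: "lat_index (p * q) (K \<inter> J) H" using lat_index_trans[OF K(1) KJ(1)] .
  have D: "lat_index (p * q) (K \<inter> J) D" using lat_index_trans[OF J(2) KJ(2)] by (simp add: mult.commute)
  have KJI: "K \<inter> J \<subseteq> I" unfolding K_def J_def I_def by blast
  have "commens H D"
    using commens_if_superset[of H D "K \<inter> J"] lat_index_lattices[OF H] lat_index_lattices[OF D] by blast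
  then obtain a' b' where ab': "lat_index a' I H" "lat_index b' I D" unfolding I_def by (rule commens_index)
  then have I: "I \<in> lattices" "I \<subseteq> H" "I \<subseteq> D" using lat_index_lattices by blast+
  obtain a b where ab: "p * q = a * b" "lat_index a I H" "lat_index b (K \<inter> J) I"
    using lat_index_factor[OF H I(1) KJI I(2)] by blast
  \<comment> \<open>By the second isomorphism theorem X has index b in I + X, and I + X lies between
    X and Y. This is applied to K in \<open>H\<close> and to J in \<open>D\<close>.\<close>
  have dvd: "b dvd r" if X: "I \<inter> X = K \<inter> J" "lat_index r X Y" "I \<subseteq> Y" for r X Y
  proof -
    note lX = lat_index_lattices[OF X(2)]
    have "commens I X" using commens_if_subset[of I X Y] I lX X(3) by blast
    then obtain s t where st: "lat_index s (I \<inter> X) I" "lat_index s X (lsum I X)" by (rule commens_index)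
    have "s = b" using st(1) ab(3) X(1) lat_index_unique by metis
    obtain s' t' where "r = s' * t'" "lat_index t' X (lsum I X)"
      using lat_index_factor[OF X(2)] lat_index_lattices[OF st(2)] lsum_subset[OF lX(2) X(3) lX(3)] by metis
    then show ?thesis using st(2) \<open>s = b\<close> lat_index_unique by (metis dvd_triv_right)
  qed
  have "b dvd p" by (rule dvd[OF _ K(1) I(2)]) (auto simp: I_def J_def K_def)
  moreover have "b dvd q" by (rule dvd[OF _ J(2) I(3)]) (auto simp: I_def J_def K_def)
  ultimately have b: "b = 1 \<or> b = p \<and> p = q" using p q by (metis prime_nat_iff)
  have cov: "covol D = covol H" using H D p0 unfolding lat_index_def by simp
  have "b = 1"
  proof (rule ccontr)
    assume "b \<noteq> 1"
    then have "b = p" "p = q" using b by auto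
    then have "a = p" using ab(1) p0 by simp
    then have "adj p p H D" using ab(2) I l cov unfolding adj_def I_def[symmetric] lat_index_def by simp
    then show False using generic \<open>p = q\<close> by blast
  qed
  then have IKJ: "K \<inter> J = I" using ab(3) lat_index_1 by blast
  then show "H \<inter> D = (H \<inter> M) \<inter> (M \<inter> D)" unfolding I_def K_def J_def by blast
  show "adj (p * q) (p * q) H D" using H D IKJ unfolding adj_def I_def by simp
qed

text \<open>Modular law: H cap (K + J) = K + (H cap J), and H cap J lies in H cap D, hence in K.
  Thus K, and likewise J, can be recovered from K + J.\<close>

lemma adj_lsum_intermediate:
  fixes H D K J :: "(real^'n::{finite,linorder}) set"
  assumes HD: "adj (p * q) (p * q) H D" and p: "prime p" and q: "prime q"
    and K: "H \<inter> D \<subseteq> K" "lat_index p K H" and J: "H \<inter> D \<subseteq> J" "lat_index q J D"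
  shows "adj p p H (lsum K J)" "adj q q (lsum K J) D" "H \<inter> lsum K J = K" "lsum K J \<inter> D = J"
proof -
  have p0: "p > 0" "q > 0" using p q prime_gt_0_nat by auto
  have I: "lat_index (p * q) (H \<inter> D) H" "lat_index (p * q) (H \<inter> D) D" using HD unfolding adj_def by auto
  note lK = lat_index_lattices[OF K(2)] and lJ = lat_index_lattices[OF J(2)]
  have KJ: "K \<inter> J = H \<inter> D" using lK lJ K J by blast
  have "lat_index q (K \<inter> J) K" "lat_index p (K \<inter> J) J"
    unfolding KJ using I K J p0 unfolding lat_index_def by auto
  then have "adj q p K J" unfolding adj_def by simp
  then have M: "lat_index p K (lsum K J)" "lat_index q J (lsum K J)" by (rule adj_lsum)+
  show HM: "H \<inter> lsum K J = K"
  proof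
    show "H \<inter> lsum K J \<subseteq> K"
    proof
      fix v assume "v \<in> H \<inter> lsum K J"
      then obtain x y where v: "v = x + y" "x \<in> K" "y \<in> J" "v \<in> H" unfolding lsum_def by blast
      then have "v - x \<in> H" using lattice_closed(3)[OF lK(2)] lK(3) by blast
      then have "y \<in> K" using v lJ(3) K(1) by auto
      then show "v \<in> K" using lattice_closed(2)[OF lK(1)] v by blast
    qed
  qed (use lK lat_index_lattices[OF M(1)] in blast)
  show MD: "lsum K J \<inter> D = J"
  proof
    show "lsum K J \<inter> D \<subseteq> J"
    proof
      fix v assume "v \<in> lsum K J \<inter> D"
      then obtain x y where v: "v = x + y" "x \<in> K" "y \<in> J" "v \<in> D" unfolding lsum_def by blast
      then have "v - y \<in> D" using lattice_closed(3)[OF lJ(2)] lJ(3) by blast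
      then have "x \<in> J" using v lK(3) J(1) by auto
      then show "v \<in> J" using lattice_closed(2)[OF lJ(1)] v by blast
    qed
  qed (use lJ lat_index_lattices[OF M(2)] in blast)
  show "adj p p H (lsum K J)" "adj q q (lsum K J) D"
    unfolding adj_def HM MD using K J M by simp_all
qed

definition intermediates :: "nat \<Rightarrow> (real^'n) set \<Rightarrow> (real^'n) set \<Rightarrow> (real^'n) set set" where
  "intermediates p I H = {K. I \<subseteq> K \<and> lat_index p K H}"

lemma card_adj_adj_generic:
  fixes H D :: "(real^'n::{finite,linorder}) set"
  assumes HD: "adj (p * q) (p * q) H D" and p: "prime p" and q: "prime q"
  shows "card {M. adj p p H M \<and> adj q q M D} =
    card (intermediates p (H \<inter> D) H) * card (intermediates q (H \<inter> D) D)"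
proof -
  let ?N = "{M. adj p p H M \<and> adj q q M D}"
  let ?P = "intermediates p (H \<inter> D) H \<times> intermediates q (H \<inter> D) D"
  have pq: "p > 1" "q > 1" using p q prime_gt_1_nat by auto
  have "D \<noteq> H"
  proof
    assume "D = H"
    then have "p * q = 1" using HD adj_self by blast
    then show False using pq by simp
  qed
  moreover have "\<not> adj p p H D"
  proof
    assume "adj p p H D"
    then have "p * q = p" using adj_unique HD by blast
    then show False using pq by simp
  qed
  ultimately have gen: "\<not> (p = q \<and> (D = H \<or> adj p p H D))" by blast
  have "bij_betw (\<lambda>M. (H \<inter> M, M \<inter> D)) ?N ?P"
  proof (rule bij_betw_byWitness[where f' = "\<lambda>(K, J). lsum K J"])
    show "\<forall>M\<in>?N. (case (H \<inter> M, M \<inter> D) of (K, J) \<Rightarrow> lsum K J) = M"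
      using adj_adj_generic(3)[OF _ _ p q gen] by auto
    show "\<forall>x\<in>?P. (\<lambda>M. (H \<inter> M, M \<inter> D)) (case x of (K, J) \<Rightarrow> lsum K J) = x"
      using adj_lsum_intermediate[OF HD p q] unfolding intermediates_def by auto
    show "(\<lambda>M. (H \<inter> M, M \<inter> D)) ` ?N \<subseteq> ?P"
      using adj_adj_generic(2)[OF _ _ p q gen] unfolding intermediates_def adj_def by auto
    show "(\<lambda>(K, J). lsum K J) ` ?P \<subseteq> ?N"
      using adj_lsum_intermediate[OF HD p q] unfolding intermediates_def by auto
  qed
  from bij_betw_same_card[OF this] show ?thesis by (simp only: card_cartesian_product)
qed

text \<open>The end points are the lattices at index p q and, for p = q, also the neighbours of
  \<open>H\<close> and \<open>H\<close> itself. Their weights come from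
  \<open>card_adj_adj_generic\<close>, \<open>card_common_neighbours\<close> and
  \<open>card_adj_prime\<close>.\<close>

theorem sum_adj_adj:
  fixes H :: "(real^'n::{finite,linorder}) set" and F :: "(real^'n::{finite,linorder}) set \<Rightarrow> complex"
  assumes H: "H \<in> lattices" and p: "prime p" and q: "prime q" and n: "CARD('n) \<ge> 2"
  defines "c \<equiv> card {Z. lat_index p H Z}"
  shows "finite {D. adj (p * q) (p * q) H D}"
    "(\<Sum>M | adj p p H M. \<Sum>D | adj q q M D. F D) =
      (\<Sum>D | adj (p * q) (p * q) H D.
        of_nat (card (intermediates p (H \<inter> D) H) * card (intermediates q (H \<inter> D) D)) * F D)
      + of_bool (p = q) * (2 * of_nat c - of_nat p - 3) * (\<Sum>D | adj p p H D. F D)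
      + of_bool (p = q) * (of_nat c * of_nat c - of_nat c) * F H"
proof -
  let ?A = "{M. adj p p H M}" and ?X = "{D. adj (p * q) (p * q) H D}"
  let ?E = "if p = q then {H} else {}" and ?Y = "if p = q then {D. adj p p H D} else {}"
  let ?N = "\<lambda>D. card {M \<in> ?A. D \<in> {D. adj q q M D}}"
  have pq: "p > 1" "q > 1" using p q prime_gt_1_nat by auto
  have latD: "D \<in> lattices" if "adj a b H D" for a b D using that lat_index_lattices unfolding adj_def by blast
  have finA: "finite ?A" using adj_squarefree_finite H p by blast
  have finB: "finite {D. adj q q M D}" if "M \<in> ?A" for M using adj_squarefree_finite latD that q by blast
  have N: "?N D = card (intermediates p (H \<inter> D) H) * card (intermediates q (H \<inter> D) D)" if "D \<in> ?X" for D
    using card_adj_adj_generic[of p q H D] that p q by simp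
  \<comment> \<open>Positive weights show that each D at index p q is reached by some path, which
    makes the set of these lattices finite.\<close>
  have "card (intermediates p (H \<inter> D) H) > 0" "card (intermediates q (H \<inter> D) D) > 0" if D: "D \<in> ?X" for D
  proof -
    have "lat_index (p * q) (H \<inter> D) H" "lat_index (q * p) (H \<inter> D) D"
      using D unfolding adj_def by (auto simp: mult.commute)
    then show "card (intermediates p (H \<inter> D) H) > 0" "card (intermediates q (H \<inter> D) D) > 0"
      unfolding intermediates_def using card_intermediate(2)[of p q "H \<inter> D" H]
        card_intermediate(2)[of q p "H \<inter> D" D] p q n by simp_all
  qed
  then have Npos: "?N D > 0" if "D \<in> ?X" for D using N[OF that] that by simp
  have "{M \<in> ?A. D \<in> {D. adj q q M D}} \<noteq> {}" if "D \<in> ?X" for D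
  proof
    assume "{M \<in> ?A. D \<in> {D. adj q q M D}} = {}"
    then have "?N D = 0" by (simp only: card.empty)
    with Npos[OF that] show False by simp
  qed
  then have "?X \<subseteq> (\<Union>M\<in>?A. {D. adj q q M D})" by blast
  then show finX: "finite ?X" using finA finB by (meson finite_UN_I finite_subset)
  have finY: "finite ?Y" "finite ?E" using finA by auto
  have "\<not> adj p p H D" if "adj (p * q) (p * q) H D" for D
  proof
    assume "adj p p H D"
    then have "p * q = p" using adj_unique that by blast
    then show False using pq by simp
  qed
  then have XY: "?X \<inter> ?Y = {}" by auto
  have HX: "H \<notin> ?X" using adj_self[of "p * q" "p * q" H] pq by auto
  have HY: "H \<notin> {D. adj p p H D}" using adj_self[of p p H] pq by auto
  have U: "D \<in> (?X \<union> ?Y) \<union> ?E" if "M \<in> ?A" "D \<in> {D. adj q q M D}" for M D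
    using adj_adj_generic(1)[of p H M q D] that p q by auto
  have "(\<Sum>M\<in>?A. \<Sum>D | adj q q M D. F D) = (\<Sum>D\<in>(?X \<union> ?Y) \<union> ?E. of_nat (?N D) * F D)"
    by (rule sum_sum_count) (use finA finX finY U in auto)
  also have "\<dots> = (\<Sum>D\<in>?X \<union> ?Y. of_nat (?N D) * F D) + (\<Sum>D\<in>?E. of_nat (?N D) * F D)"
    by (rule sum.union_disjoint) (use finX finY HX HY in auto)
  also have "(\<Sum>D\<in>?X \<union> ?Y. of_nat (?N D) * F D) = (\<Sum>D\<in>?X. of_nat (?N D) * F D) + (\<Sum>D\<in>?Y. of_nat (?N D) * F D)"
    by (rule sum.union_disjoint) (use finX finY XY in auto)
  also have "(\<Sum>D\<in>?X. of_nat (?N D) * F D) = (\<Sum>D\<in>?X.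
      of_nat (card (intermediates p (H \<inter> D) H) * card (intermediates q (H \<inter> D) D)) * F D)"
    using N by (intro sum.cong) auto
  also have "(\<Sum>D\<in>?Y. of_nat (?N D) * F D) =
      of_bool (p = q) * (2 * of_nat c - of_nat p - 3) * (\<Sum>D | adj p p H D. F D)"
  proof (cases "p = q")
    case True
    have "of_nat (?N D) = 2 * of_nat c - of_nat p - (3::complex)" if D: "adj p p H D" for D
    proof -
      have "?N D + p + 3 = 2 * c" unfolding c_def using card_common_neighbours[OF D p n] True by simp
      then have "(of_nat (?N D + p + 3) :: complex) = of_nat (2 * c)" by (rule arg_cong)
      then show ?thesis by (simp add: algebra_simps)
    qed
    then show ?thesis using True by (simp add: sum_distrib_left)
  qed simp
  also have "(\<Sum>D\<in>?E. of_nat (?N D) * F D) = of_bool (p = q) * (of_nat c * of_nat c - of_nat c) * F H"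
  proof (cases "p = q")
    case True
    have "{M \<in> ?A. H \<in> {D. adj q q M D}} = ?A" using True adj_commute[of q q _ H] by simp
    then have "?N H + c = c * c" unfolding c_def using card_adj_prime[OF H p] by simp
    then have "(of_nat (?N H + c) :: complex) = of_nat (c * c)" by (rule arg_cong)
    then have "of_nat (?N H) = of_nat c * of_nat c - (of_nat c :: complex)" by (simp add: algebra_simps)
    then show ?thesis using True by simp
  qed simp
  finally show "(\<Sum>M | adj p p H M. \<Sum>D | adj q q M D. F D) =
      (\<Sum>D | adj (p * q) (p * q) H D.
        of_nat (card (intermediates p (H \<inter> D) H) * card (intermediates q (H \<inter> D) D)) * F D)
      + of_bool (p = q) * (2 * of_nat c - of_nat p - 3) * (\<Sum>D | adj p p H D. F D)
      + of_bool (p = q) * (of_nat c * of_nat c - of_nat c) * F H" .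
qed

section \<open>Hecke operators as sums over lattices\<close>

text \<open>Left invariance makes \<open>f\<close> a function of lattices, and invariance under
  scaling lets positions with denominators be represented by integral matrices. Both properties pass
  to Hecke images, so that operators can be composed.\<close>

definition hecke_invariant :: "('n::finite rmat \<Rightarrow> complex) \<Rightarrow> bool" where
  "hecke_invariant f \<longleftrightarrow> (\<forall>\<gamma>\<in>GL_int. \<forall>g. invertible g \<longrightarrow> f (\<gamma> ** g) = f g)
    \<and> (\<forall>c g. c \<noteq> 0 \<longrightarrow> invertible g \<longrightarrow> f (c *\<^sub>R g) = f g)"

definition on_lattice :: "('n::finite rmat \<Rightarrow> complex) \<Rightarrow> (real^'n) set \<Rightarrow> complex" where
  "on_lattice f L = f (SOME g. invertible g \<and> lat g = L)"

lemma on_lattice_lat: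
  assumes "hecke_invariant f" "invertible g"
  shows "on_lattice f (lat g) = f g"
proof -
  let ?h = "SOME h. invertible h \<and> lat h = lat g"
  have h: "invertible ?h \<and> lat ?h = lat g" by (rule someI[of _ g]) (use assms in simp)
  then obtain \<gamma> where "\<gamma> \<in> GL_int" "?h = \<gamma> ** g" using lat_eq_iff assms by blast
  then show ?thesis using assms unfolding on_lattice_def hecke_invariant_def by simp
qed

lemma lat_scale: "lat (c *\<^sub>R g) = (*\<^sub>R) c ` lat g"
  unfolding lat_def by (force simp: vector_scaleR_matrix_ac)

lemma on_lattice_scale:
  assumes "hecke_invariant f" "L \<in> lattices" "c \<noteq> 0"
  shows "on_lattice f ((*\<^sub>R) c ` L) = on_lattice f L"
proof -
  obtain g where g: "invertible g" "L = lat g" using assms unfolding lattices_def by blast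
  have "invertible (c *\<^sub>R g)" using g assms(3) scalar_invertible by blast
  then have "on_lattice f (lat (c *\<^sub>R g)) = on_lattice f (lat g)"
    using g assms by (simp add: on_lattice_lat) (simp add: hecke_invariant_def)
  then show ?thesis unfolding g lat_scale .
qed

definition neighbours :: "'n::finite rmat \<Rightarrow> (real^'n) set \<Rightarrow> (real^'n) set set" where
  "neighbours d H = {lat (d ** e) | e. invertible e \<and> lat e = H}"

lemma lat_GL_int: "\<gamma> \<in> GL_int \<Longrightarrow> invertible g \<Longrightarrow> lat (\<gamma> ** g) = lat g"
  using lat_eq_iff GL_int_invertible invertible_mult by blast

lemma double_coset_invertible: "invertible d \<Longrightarrow> \<delta> \<in> double_coset d \<Longrightarrow> invertible \<delta>"
  unfolding double_coset_def using GL_int_invertible invertible_mult by blast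

lemma right_coset_representative:
  assumes "invertible \<delta>"
  shows "invertible (SOME \<delta>'. \<delta>' \<in> right_coset \<delta>)" "\<exists>\<gamma>\<in>GL_int. (SOME \<delta>'. \<delta>' \<in> right_coset \<delta>) = \<gamma> ** \<delta>"
proof -
  have "mat 1 ** \<delta> \<in> right_coset \<delta>" unfolding right_coset_def using GL_int_1 by blast
  then have "(SOME \<delta>'. \<delta>' \<in> right_coset \<delta>) \<in> right_coset \<delta>" by (rule someI)
  then show *: "\<exists>\<gamma>\<in>GL_int. (SOME \<delta>'. \<delta>' \<in> right_coset \<delta>) = \<gamma> ** \<delta>" unfolding right_coset_def by blast
  then show "invertible (SOME \<delta>'. \<delta>' \<in> right_coset \<delta>)"
    using GL_int_invertible invertible_mult assms by metis
qed

lemma right_coset_mult: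
  assumes "\<gamma> \<in> GL_int"
  shows "right_coset (\<gamma> ** \<delta>) = right_coset \<delta>"
proof -
  have sub: "right_coset (\<beta> ** \<epsilon>) \<subseteq> right_coset \<epsilon>" if "\<beta> \<in> GL_int" for \<beta> \<epsilon> :: "'a rmat"
  proof
    fix x assume "x \<in> right_coset (\<beta> ** \<epsilon>)"
    then obtain \<alpha> where "\<alpha> \<in> GL_int" "x = \<alpha> ** (\<beta> ** \<epsilon>)" unfolding right_coset_def by blast
    then have "\<alpha> ** \<beta> \<in> GL_int" "x = (\<alpha> ** \<beta>) ** \<epsilon>" using that GL_int_mult by (auto simp: matrix_mul_assoc)
    then show "x \<in> right_coset \<epsilon>" unfolding right_coset_def by blast
  qed
  obtain \<beta> where \<beta>: "\<beta> \<in> GL_int" "\<beta> ** \<gamma> = mat 1" using GL_int_inverse[OF assms] by metis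
  then have "\<beta> ** (\<gamma> ** \<delta>) = \<delta>" by (simp add: matrix_mul_assoc)
  then show ?thesis using sub[OF assms, of \<delta>] sub[OF \<beta>(1), of "\<gamma> ** \<delta>"] by simp
qed

text \<open>The coset of \<gamma> d \<gamma>' is sent to the lattice of d (\<gamma>' h): \<gamma>'
  makes \<gamma>' h run through the bases of the lattice of h, while \<gamma> only changes the basis
  of the result. Injectivity is cancellation of h.\<close>

lemma hecke_neighbours:
  assumes f: "hecke_invariant f" and d: "invertible d" and h: "invertible h"
  shows "hecke d f h = (\<Sum>M\<in>neighbours d (lat h). on_lattice f M)"
proof -
  let ?rep = "\<lambda>C. SOME \<delta>. \<delta> \<in> C"
  let ?C = "right_coset ` double_coset d"
  have rep: "lat (?rep (right_coset \<delta>) ** h) = lat (\<delta> ** h)" if "\<delta> \<in> double_coset d" for \<delta>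
    using right_coset_representative(2)[OF double_coset_invertible[OF d that]] lat_GL_int
      invertible_mult[OF double_coset_invertible[OF d that] h] by (metis matrix_mul_assoc)
  have "bij_betw (\<lambda>C. lat (?rep C ** h)) ?C (neighbours d (lat h))"
    unfolding bij_betw_def
  proof
    show "inj_on (\<lambda>C. lat (?rep C ** h)) ?C"
    proof (rule inj_onI, elim imageE)
      fix C C' \<delta> \<delta>'
      assume *: "lat (?rep C ** h) = lat (?rep C' ** h)" "C = right_coset \<delta>" "\<delta> \<in> double_coset d"
        "C' = right_coset \<delta>'" "\<delta>' \<in> double_coset d"
      then have "lat (\<delta> ** h) = lat (\<delta>' ** h)" using rep by simp
      then obtain \<gamma> where \<gamma>: "\<gamma> \<in> GL_int" "\<delta> ** h = \<gamma> ** (\<delta>' ** h)"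
        using lat_eq_iff invertible_mult double_coset_invertible[OF d] * h by metis
      then have "\<delta> = \<gamma> ** \<delta>'" using mult_inv_cancel(2)[OF h] by (metis matrix_mul_assoc)
      then show "C = C'" using * right_coset_mult \<gamma> by simp
    qed
    show "(\<lambda>C. lat (?rep C ** h)) ` ?C = neighbours d (lat h)"
    proof
      show "(\<lambda>C. lat (?rep C ** h)) ` ?C \<subseteq> neighbours d (lat h)"
      proof clarify
        fix \<delta> assume \<delta>: "\<delta> \<in> double_coset d"
        then obtain \<gamma> \<gamma>' where \<gamma>: "\<gamma> \<in> GL_int" "\<gamma>' \<in> GL_int" "\<delta> = \<gamma> ** d ** \<gamma>'"
          unfolding double_coset_def by blast
        have e: "invertible (\<gamma>' ** h)" "lat (\<gamma>' ** h) = lat h"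
          using \<gamma> h GL_int_invertible invertible_mult lat_GL_int by blast+
        have "lat (\<delta> ** h) = lat (\<gamma> ** (d ** (\<gamma>' ** h)))" unfolding \<gamma>(3) by (simp add: matrix_mul_assoc)
        also have "\<dots> = lat (d ** (\<gamma>' ** h))" using lat_GL_int \<gamma>(1) invertible_mult d e by blast
        finally show "lat (?rep (right_coset \<delta>) ** h) \<in> neighbours d (lat h)"
          unfolding rep[OF \<delta>] neighbours_def using e by blast
      qed
      show "neighbours d (lat h) \<subseteq> (\<lambda>C. lat (?rep C ** h)) ` ?C"
      proof
        fix M assume "M \<in> neighbours d (lat h)"
        then obtain e where e: "M = lat (d ** e)" "invertible e" "lat e = lat h" unfolding neighbours_def by blast
        then obtain \<gamma> where \<gamma>: "\<gamma> \<in> GL_int" "e = \<gamma> ** h" using lat_eq_iff h by blast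
        have "d ** \<gamma> = mat 1 ** d ** \<gamma>" by simp
        then have "d ** \<gamma> \<in> double_coset d" unfolding double_coset_def using GL_int_1 \<gamma> by blast
        moreover from rep[OF this] have "M = lat (?rep (right_coset (d ** \<gamma>)) ** h)"
          unfolding e(1) \<gamma>(2) by (simp add: matrix_mul_assoc)
        ultimately show "M \<in> (\<lambda>C. lat (?rep C ** h)) ` ?C" by blast
      qed
    qed
  qed
  then have "(\<Sum>M\<in>neighbours d (lat h). on_lattice f M) = (\<Sum>C\<in>?C. on_lattice f (lat (?rep C ** h)))"
    by (rule sum.reindex_bij_betw[symmetric])
  also have "\<dots> = (\<Sum>C\<in>?C. f (?rep C ** h))"
  proof (rule sum.cong)
    fix C assume "C \<in> ?C"
    then have "invertible (?rep C ** h)"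
      using right_coset_representative(1) double_coset_invertible[OF d] invertible_mult h by blast
    then show "on_lattice f (lat (?rep C ** h)) = f (?rep C ** h)" by (rule on_lattice_lat[OF f])
  qed simp
  finally show ?thesis unfolding hecke_def by simp
qed

lemma hecke_invariant_hecke:
  assumes f: "hecke_invariant f" and d: "invertible d"
  shows "hecke_invariant (hecke d f)"
  unfolding hecke_invariant_def
proof (intro conjI ballI allI impI)
  fix \<gamma> g :: "'a rmat" assume "\<gamma> \<in> GL_int" "invertible g"
  then show "hecke d f (\<gamma> ** g) = hecke d f g"
    using hecke_neighbours[OF f d] GL_int_invertible invertible_mult lat_GL_int by metis
next
  fix c :: real and g :: "'a rmat" assume c: "c \<noteq> 0" and g: "invertible g"
  have "f ((SOME \<delta>. \<delta> \<in> C) ** (c *\<^sub>R g)) = f ((SOME \<delta>. \<delta> \<in> C) ** g)"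
    if C: "C \<in> right_coset ` double_coset d" for C
  proof -
    have "invertible ((SOME \<delta>. \<delta> \<in> C) ** g)"
      using C right_coset_representative(1) double_coset_invertible[OF d] invertible_mult g by blast
    then show ?thesis using f c unfolding hecke_invariant_def by (simp add: matrix_scalar_ac scalar_matrix_assoc[symmetric])
  qed
  then show "hecke d f (c *\<^sub>R g) = hecke d f g"
    unfolding hecke_def by (intro sum.cong) auto
qed

lemma lat_type_lattices:
  assumes "\<And>i. u i > 0" "\<And>i. w i > 0"
  shows "lat_type u w H \<subseteq> lattices"
proof
  fix D assume "D \<in> lat_type u w H"
  then obtain e where e: "invertible e" "D = lat (dmat (\<lambda>i. real (u i) / real (w i)) ** e)"
    unfolding lat_type_def by blast
  have "real (u i) / real (w i) \<noteq> 0" for i using assms[of i] by simp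
  then show "D \<in> lattices" unfolding e(2) by (intro lattices_lat invertible_mult invertible_dmat e(1))
qed

text \<open>The integral diagonal matrix is \<open>s\<close> times diag(u/w). The scalar rescales
  every lattice in the sum, and \<open>on_lattice f\<close> does not see this.\<close>

lemma hecke_dmat:
  fixes s :: nat
  assumes f: "hecke_invariant f" and h: "invertible h" and s: "s > 0"
    and u: "\<And>i. u i > 0" and w: "\<And>i. w i > 0" and a: "\<And>i. a i * w i = s * u i"
  shows "invertible (dmat (\<lambda>i. real (a i)))"
    "hecke (dmat (\<lambda>i. real (a i))) f h = (\<Sum>D\<in>lat_type u w (lat h). on_lattice f D)"
proof -
  have a': "real (a i) = real s * (real (u i) / real (w i))" for i
  proof -
    have "real (a i) * real (w i) = real s * real (u i)" using a[of i] by (metis of_nat_mult)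
    then show ?thesis using w[of i] by (simp add: field_simps)
  qed
  then have "real (a i) \<noteq> 0" for i using u[of i] w[of i] s by simp
  then show d: "invertible (dmat (\<lambda>i. real (a i)))" by (rule invertible_dmat)
  have eq: "dmat (\<lambda>i. real (a i)) ** e = real s *\<^sub>R (dmat (\<lambda>i. real (u i) / real (w i)) ** e)" for e
    by (simp add: vec_eq_iff dmat_mult_nth a')
  have "lat (dmat (\<lambda>i. real (a i)) ** e) = (*\<^sub>R) (real s) ` lat (dmat (\<lambda>i. real (u i) / real (w i)) ** e)" for e
    by (simp only: eq lat_scale)
  then have "neighbours (dmat (\<lambda>i. real (a i))) (lat h) = (`) ((*\<^sub>R) (real s)) ` lat_type u w (lat h)"
    unfolding neighbours_def lat_type_def by blast
  moreover have "inj_on ((`) ((*\<^sub>R) (real s))) (lat_type u w (lat h))"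
    using s by (intro inj_on_image inj_onI) simp
  ultimately have "hecke (dmat (\<lambda>i. real (a i))) f h = (\<Sum>D\<in>lat_type u w (lat h). on_lattice f ((*\<^sub>R) (real s) ` D))"
    unfolding hecke_neighbours[OF f d h] by (simp add: sum.reindex)
  also have "\<dots> = (\<Sum>D\<in>lat_type u w (lat h). on_lattice f D)"
    using lat_type_lattices[of u w, OF u w] s by (intro sum.cong on_lattice_scale[OF f]) auto
  finally show "hecke (dmat (\<lambda>i. real (a i))) f h = (\<Sum>D\<in>lat_type u w (lat h). on_lattice f D)" .
qed

section \<open>From diagonal matrices to relative positions\<close>

lemma diag_eq_dmat: "diag as = dmat (\<lambda>i. real (as ! pos i))"
  by (simp add: diag_def dmat_def pos_def)

text \<open>With the middle entry \<open>s\<close> taken out as the scalar, there remain 1/b at the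
  first l places, 1 in the middle and a at the last k places.\<close>

lemma hecke_diag:
  fixes h :: "'n::{finite,linorder} rmat"
  assumes f: "hecke_invariant f" and h: "invertible h"
    and as: "as = replicate l x @ replicate m s @ replicate k (s * a)" "l + m + k = CARD('n)"
    and s: "x * b = s" "s > 0" "a > 0"
  shows "invertible (diag as :: 'n rmat)"
    "hecke (diag as) f h = (\<Sum>D\<in>lat_type (top_entries k a) (bottom_entries l b) (lat h). on_lattice f D)"
proof -
  have b: "b > 0" using s by (metis gr0I mult_0_right)
  have u: "top_entries k a i > 0" "bottom_entries l b i > 0" for i :: 'n
    using s b by (auto simp: top_entries_def bottom_entries_def)
  have k: "CARD('n) - k = l + m" using as by simp
  have "as ! pos i * bottom_entries l b i = s * top_entries k a i" for i :: 'n
  proof -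
    consider "pos i < l" | "\<not> pos i < l" "pos i - l < m" "\<not> l + m \<le> pos i"
      | "\<not> pos i < l" "\<not> pos i - l < m" "l + m \<le> pos i" "pos i - l - m < k"
      using pos_lt[of i] as(2) by linarith
    then show ?thesis
      using s(1) unfolding as(1) top_entries_def bottom_entries_def k
      by cases (simp_all add: nth_append)
  qed
  note * = hecke_dmat[OF f h s(2), of "top_entries k a" "bottom_entries l b" "\<lambda>i. as ! pos i", OF u this]
  show "invertible (diag as :: 'n rmat)"
    "hecke (diag as) f h = (\<Sum>D\<in>lat_type (top_entries k a) (bottom_entries l b) (lat h). on_lattice f D)"
    unfolding diag_eq_dmat using * by blast+
qed

text \<open>Turns a formula at matrices into one at lattices, the form needed for the inner operator
  of a composition.\<close>

lemma hecke_comp: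
  assumes f: "hecke_invariant f" and d: "invertible d"
    and "\<And>g. invertible g \<Longrightarrow> hecke d f g = (\<Sum>D\<in>\<N> (lat g). on_lattice f D)"
    and "M \<in> lattices"
  shows "on_lattice (hecke d f) M = (\<Sum>D\<in>\<N> M. on_lattice f D)"
  using assms on_lattice_lat[OF hecke_invariant_hecke[OF f d]] unfolding lattices_def by auto

lemma adj_1_left:
  fixes H D :: "(real^'n::{finite,linorder}) set"
  shows "adj 1 b H D \<longleftrightarrow> lat_index b H D"
proof
  assume *: "adj 1 b H D"
  then have "H \<inter> D = H" unfolding adj_def using lat_index_1 by blast
  then show "lat_index b H D" using * unfolding adj_def by simp
next
  assume *: "lat_index b H D"
  then have "H \<inter> D = H" "lat_index 1 H H" using lat_index_lattices[OF *] lat_index_self by auto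
  then show "adj 1 b H D" using * unfolding adj_def by simp
qed

lemma adj_1_right:
  fixes H D :: "(real^'n::{finite,linorder}) set"
  shows "adj a 1 H D \<longleftrightarrow> lat_index a D H"
  using adj_1_left[of a D H] adj_commute[of a 1 H D] by simp

lemma hecke_adj:
  fixes h :: "'n::{finite,linorder} rmat"
  assumes f: "hecke_invariant f" and h: "invertible h"
    and as: "as = [x] @ replicate m s @ [s * a]" "m + 2 = CARD('n)"
    and s: "x * b = s" "s > 0" "squarefree a" "squarefree b"
  shows "invertible (diag as :: 'n rmat)"
    "hecke (diag as) f h = (\<Sum>D | adj a b (lat h) D. on_lattice f D)"
proof -
  have "a > 0" using s(3) by (auto intro: Nat.gr0I)
  moreover have "as = replicate 1 x @ replicate m s @ replicate 1 (s * a)" using as(1) by simp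
  moreover have "1 + m + 1 = CARD('n)" using as(2) by simp
  moreover have "lat_type (top_entries 1 a) (bottom_entries 1 b) (lat h) = {D. adj a b (lat h) D}"
    using as(2) by (intro lat_type_squarefree s) simp
  ultimately show "invertible (diag as :: 'n rmat)"
    "hecke (diag as) f h = (\<Sum>D | adj a b (lat h) D. on_lattice f D)"
    using hecke_diag[OF f h _ _ s(1,2), of as 1 m 1 a] by simp_all
qed

lemma maass_cusp_form_invariant: "maass_cusp_form f \<Longrightarrow> hecke_invariant f"
  unfolding maass_cusp_form_def hecke_invariant_def GL_real_def by blast

section \<open>The two identities\<close>

lemma sum_bool_pairs:
  fixes g :: "'a \<Rightarrow> complex"
  assumes "finite X"
  shows "sum g X = sum g {x\<in>X. \<not> P x \<and> \<not> Q x} + sum g {x\<in>X. P x \<and> \<not> Q x}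
    + sum g {x\<in>X. \<not> P x \<and> Q x} + sum g {x\<in>X. P x \<and> Q x}"
proof -
  have "sum g X = (\<Sum>y\<in>(UNIV::(bool \<times> bool) set). sum g {x\<in>X. (P x, Q x) = y})"
    by (rule sum.group[symmetric]) (use assms in auto)
  also have "(UNIV::(bool \<times> bool) set) = {(False, False), (True, False), (False, True), (True, True)}" by auto
  finally show ?thesis by (simp add: add.assoc)
qed

text \<open>The outer operator acts first along a path: from the lattice of \<open>h\<close> to a
  superlattice Z of index p, and then by the inner operator to a sublattice of index q in Z.\<close>

lemma hecke_first_identity:
  fixes h :: "'n::{finite,linorder} rmat"
  assumes n: "n = CARD('n)" "n \<ge> 2" and p: "prime p" and q: "prime q"
    and f: "hecke_invariant f" and h: "invertible h"
  shows "(hecke (diag ([1] @ replicate (n-1) p)) \<circ> hecke (diag (replicate (n-1) 1 @ [q]))) f h =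
    hecke (diag ([1] @ replicate (n-2) p @ [p*q])) f h
    + of_bool (p = q) * ((of_nat p ^ n - 1) / (of_nat p - 1)) * f h"
proof -
  let ?d = "diag (replicate (n-1) 1 @ [q]) :: 'n rmat"
  have p0: "p > 1" "q > 1" using p q prime_gt_1_nat by auto
  have n1: "n - 1 = Suc (n - 2)" "n - 2 + 2 = CARD('n)" using n by auto
  have H: "lat h \<in> lattices" using h lattices_lat by blast
  \<comment> \<open>Both lists are brought into the shape of \<open>hecke_adj\<close>: here s = b =
    p and a = 1, in the next one s = b = 1 and a = q.\<close>
  have as1: "[1] @ replicate (n-1) p = [1] @ replicate (n-2) p @ [p * 1]"
    unfolding n1(1) by (simp add: replicate_append_same)
  have as2: "replicate (n-1) 1 @ [q] = [1] @ replicate (n-2) 1 @ [1 * q]"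
    unfolding n1(1) by simp
  note down = hecke_adj[OF f _ as2 n1(2), of _ 1, unfolded adj_1_right]
  have d: "invertible ?d" using down(1)[OF h] squarefree_prime[OF q] by simp
  have up: "hecke (diag ([1] @ replicate (n-1) p)) f' h = (\<Sum>Z | lat_index p (lat h) Z. on_lattice f' Z)"
    if "hecke_invariant f'" for f'
    using hecke_adj(2)[OF that h as1 n1(2), of p] squarefree_prime[OF p] p0 unfolding adj_1_left by simp
  have mid: "hecke (diag ([1] @ replicate (n-2) p @ [p*q])) f h = (\<Sum>D | adj q p (lat h) D. on_lattice f D)"
    by (rule hecke_adj(2)[OF f h HOL.refl n1(2)]) (use p q p0 in \<open>auto intro: squarefree_prime\<close>)
  have "(hecke (diag ([1] @ replicate (n-1) p)) \<circ> hecke ?d) f h =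
      (\<Sum>Z | lat_index p (lat h) Z. on_lattice (hecke ?d f) Z)"
    using up[OF hecke_invariant_hecke[OF f d]] by simp
  also have "\<dots> = (\<Sum>Z | lat_index p (lat h) Z. \<Sum>D | lat_index q D Z. on_lattice f D)"
  proof (rule sum.cong)
    fix Z assume "Z \<in> {Z. lat_index p (lat h) Z}"
    then show "on_lattice (hecke ?d f) Z = (\<Sum>D | lat_index q D Z. on_lattice f D)"
      using down(2) squarefree_prime[OF q] lat_index_lattices
      by (intro hecke_comp[OF f d]) auto
  qed simp
  also have "\<dots> = (\<Sum>D | adj q p (lat h) D. on_lattice f D)
      + of_bool (p = q) * of_nat (card {Z. lat_index p (lat h) Z}) * on_lattice f (lat h)"
    by (rule sum_up_down[OF H p q])
  also have "of_nat (card {Z. lat_index p (lat h) Z}) = (of_nat p ^ n - 1) / (of_nat p - 1 :: complex)"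
  proof -
    have "of_nat ((p - 1) * card {Z. lat_index p (lat h) Z}) = (of_nat (p ^ n - 1) :: complex)"
      using card_superlattices(2)[OF H p] n by simp
    then have "(of_nat p - 1) * of_nat (card {Z. lat_index p (lat h) Z}) = (of_nat p ^ n - 1 :: complex)"
      using p0 by (simp add: of_nat_diff)
    moreover have "of_nat p - 1 \<noteq> (0 :: complex)" using p0 by (metis eq_iff_diff_eq_0 less_irrefl of_nat_1 of_nat_eq_iff)
    ultimately show ?thesis by (simp add: nonzero_eq_divide_eq mult.commute)
  qed
  finally show ?thesis unfolding mid on_lattice_lat[OF f h] .
qed

text \<open>Multiples of vectors of \<open>H\<close> stay in \<open>H\<close>, so the condition of
  \<open>card_intermediate\<close> that p H lies in H cap D reduces to p H lying in
  \<open>D\<close>, and likewise with \<open>H\<close> and \<open>D\<close> exchanged.\<close>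

lemma card_intermediates:
  fixes H D :: "(real^'n::{finite,linorder}) set"
  assumes "adj (p * q) (p * q) H D" "prime p" "prime q" "CARD('n) \<ge> 2"
  shows "card (intermediates p (H \<inter> D) H) = (if p = q \<and> (\<forall>x\<in>H. real p *\<^sub>R x \<in> D) then p + 1 else 1)"
    "card (intermediates q (H \<inter> D) D) = (if p = q \<and> (\<forall>x\<in>D. real p *\<^sub>R x \<in> H) then p + 1 else 1)"
proof -
  have I: "lat_index (p * q) (H \<inter> D) H" "lat_index (q * p) (H \<inter> D) D"
    using assms(1) unfolding adj_def by (auto simp: mult.commute)
  have cl: "real r *\<^sub>R x \<in> L" if "L = H \<or> L = D" "x \<in> L" for r x L
    using that lattice_closed(5) lat_index_lattices(2)[OF I(1)] lat_index_lattices(2)[OF I(2)] by blast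
  show "card (intermediates p (H \<inter> D) H) = (if p = q \<and> (\<forall>x\<in>H. real p *\<^sub>R x \<in> D) then p + 1 else 1)"
    unfolding intermediates_def card_intermediate(2)[OF I(1) assms(2,3,4)] using cl by auto
  show "card (intermediates q (H \<inter> D) D) = (if p = q \<and> (\<forall>x\<in>D. real p *\<^sub>R x \<in> H) then p + 1 else 1)"
    unfolding intermediates_def card_intermediate(2)[OF I(2) assms(3,2,4)] using cl by auto
qed

text \<open>For different primes p q is squarefree, and the end points at index p q form one
  position with weight 1. For p = q they split into four positions, with one factor p + 1 for each
  elementary quotient.\<close>

lemma hecke_second_identity:
  fixes h :: "'n::{finite,linorder} rmat"
  assumes n: "n = CARD('n)" "n \<ge> 4" and p: "prime p" and q: "prime q"
    and f: "hecke_invariant f" and h: "invertible h"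
  shows "(hecke (diag ([1] @ replicate (n-2) p @ [p^2])) \<circ>
        hecke (diag ([1] @ replicate (n-2) q @ [q^2]))) f h =
       hecke (diag ([1] @ replicate (n-2) (p*q) @ [(p*q)^2])) f h
       + of_bool (p = q) * ((2 * of_nat p ^ n - of_nat p ^ 2 - 2 * of_nat p + 1) / (of_nat p - 1))
           * hecke (diag ([1] @ replicate (n-2) p @ [p^2])) f h
       + of_bool (p = q) * (of_nat p * (((of_nat p ^ (n-1) - 1) * (of_nat p ^ n - 1))
           / (of_nat p - 1) ^ 2)) * f h
       + of_bool (p = q) * (of_nat p + 1)
           * hecke (diag ([1] @ replicate (n-3) (p^2) @ [p^3, p^3])) f h
       + of_bool (p = q) * (of_nat p + 1)
           * hecke (diag ([1, 1] @ replicate (n-3) p @ [p^3])) f h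
       + of_bool (p = q) * (of_nat p + 1) ^ 2
           * hecke (diag ([1, 1] @ replicate (n-4) p @ [p^2, p^2])) f h"
proof -
  let ?F = "on_lattice f" and ?H = "lat h"
  let ?d = "\<lambda>r. diag ([1] @ replicate (n-2) r @ [r^2]) :: 'n rmat"
  let ?X = "{D. adj (p * q) (p * q) ?H D}"
  define c where "c = card {Z. lat_index p ?H Z}"
  have p0: "p > 1" "q > 1" "p > 0" "q > 0" using p q prime_gt_1_nat prime_gt_0_nat by auto
  have n2: "n - 2 + 2 = CARD('n)" "CARD('n) \<ge> 2" "CARD('n) \<ge> 4" using n by auto
  have H: "?H \<in> lattices" using h lattices_lat by blast
  have theta: "invertible (?d r)" "hecke (?d r) f' g = (\<Sum>D | adj r r (lat g) D. on_lattice f' D)"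
    if "prime r" "hecke_invariant f'" "invertible g" for r f' g
  proof -
    have as: "[1] @ replicate (n-2) r @ [r^2] = [1] @ replicate (n-2) r @ [r * r]" by (simp add: power2_eq_square)
    show "invertible (?d r)" "hecke (?d r) f' g = (\<Sum>D | adj r r (lat g) D. on_lattice f' D)"
      using hecke_adj[OF that(2,3) as n2(1), of r] that(1) squarefree_prime prime_gt_0_nat by auto
  qed
  have "(hecke (?d p) \<circ> hecke (?d q)) f h = (\<Sum>M | adj p p ?H M. on_lattice (hecke (?d q) f) M)"
    using theta(2)[OF p hecke_invariant_hecke[OF f theta(1)[OF q f h]] h] by simp
  also have "\<dots> = (\<Sum>M | adj p p ?H M. \<Sum>D | adj q q M D. ?F D)"
  proof (rule sum.cong)
    fix M assume "M \<in> {M. adj p p ?H M}"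
    then have "M \<in> lattices" unfolding adj_def using lat_index_lattices by blast
    then show "on_lattice (hecke (?d q) f) M = (\<Sum>D | adj q q M D. ?F D)"
      using theta(2)[OF q f] by (intro hecke_comp[OF f theta(1)[OF q f h]]) auto
  qed simp
  also have "\<dots> = (\<Sum>D\<in>?X. of_nat (card (intermediates p (?H \<inter> D) ?H) * card (intermediates q (?H \<inter> D) D)) * ?F D)
      + of_bool (p = q) * (2 * of_nat c - of_nat p - 3) * (\<Sum>D | adj p p ?H D. ?F D)
      + of_bool (p = q) * (of_nat c * of_nat c - of_nat c) * ?F ?H"
    unfolding c_def by (rule sum_adj_adj(2)[OF H p q n2(2)])
  finally have comp: "(hecke (?d p) \<circ> hecke (?d q)) f h = \<dots>" .
  show ?thesis
  proof (cases "p = q")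
    case False
    have sq: "squarefree (p * q)"
      using p q False primes_coprime by (intro squarefree_mult_coprime) (auto intro: squarefree_prime)
    have "(\<Sum>D\<in>?X. of_nat (card (intermediates p (?H \<inter> D) ?H) * card (intermediates q (?H \<inter> D) D)) * ?F D)
        = (\<Sum>D\<in>?X. ?F D)"
      using card_intermediates[OF _ p q n2(2)] False by (intro sum.cong) auto
    moreover have "hecke (?d (p * q)) f h = (\<Sum>D\<in>?X. ?F D)"
      using hecke_adj(2)[OF f h HOL.refl n2(1), of 1 "p * q" "p * q" "p * q"] sq p0 by (simp add: power2_eq_square)
    ultimately show ?thesis using comp False by simp
  next
    case True
    define P where "P D \<longleftrightarrow> (\<forall>x\<in>?H. real p *\<^sub>R x \<in> D)" for D
    define Q where "Q D \<longleftrightarrow> (\<forall>x\<in>D. real p *\<^sub>R x \<in> ?H)" for D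
    have X: "?X = {D. adj (p\<^sup>2) (p\<^sup>2) ?H D}" using True by (simp add: power2_eq_square)
    have finX: "finite ?X" by (rule sum_adj_adj(1)[OF H p q n2(2)])
    \<comment> \<open>The end points at index p^2, sorted by whether p annihilates H/(H cap D),
      recorded by \<open>s\<close>, and D/(H cap D), recorded by \<open>t\<close>.\<close>
    define S where "S s t = (\<Sum>D | D \<in> ?X \<and> P D = s \<and> Q D = t. ?F D)" for s t
    have S: "(\<Sum>D\<in>lat_type (if s then top_entries 2 p else top_entries 1 (p\<^sup>2))
      (if t then bottom_entries 2 p else bottom_entries 1 (p\<^sup>2)) ?H. ?F D) = S s t" for s t
      unfolding lat_type_prime_square[OF p n2(3)] S_def X P_def Q_def by simp
    \<comment> \<open>Divided by their middle entries, the four diagonals become (p^(-2), 1, ..., 1,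
      p^2), (p^(-2), 1, ..., 1, p, p), (p^(-1), p^(-1), 1, ..., 1, p^2) and (p^(-1), p^(-1), 1, ...,
      1, p, p), which shows the values of \<open>s\<close> and \<open>t\<close>.\<close>
    have TFF: "hecke (?d (p * q)) f h = S False False"
    proof -
      have as: "[1] @ replicate (n-2) (p*q) @ [(p*q)^2] = replicate 1 1 @ replicate (n-2) (p\<^sup>2) @ replicate 1 (p\<^sup>2 * p\<^sup>2)"
        using True by (simp add: power2_eq_square)
      show ?thesis
        using hecke_diag(2)[OF f h as, of "p\<^sup>2"] S[of False False] n p0 by simp
    qed
    have TTF: "hecke (diag ([1] @ replicate (n-3) (p^2) @ [p^3, p^3])) f h = S True False"
    proof -
      have as: "[1] @ replicate (n-3) (p^2) @ [p^3, p^3] = replicate 1 1 @ replicate (n-3) (p\<^sup>2) @ replicate 2 (p\<^sup>2 * p)"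
        by (simp add: power2_eq_square power3_eq_cube numeral_2_eq_2)
      show ?thesis
        using hecke_diag(2)[OF f h as, of "p\<^sup>2"] S[of True False] n p0 by simp
    qed
    have TFT: "hecke (diag ([1, 1] @ replicate (n-3) p @ [p^3])) f h = S False True"
    proof -
      have as: "[1, 1] @ replicate (n-3) p @ [p^3] = replicate 2 1 @ replicate (n-3) p @ replicate 1 (p * p\<^sup>2)"
        by (simp add: power2_eq_square power3_eq_cube numeral_2_eq_2)
      show ?thesis
        using hecke_diag(2)[OF f h as, of p] S[of False True] n p0 by simp
    qed
    have TTT: "hecke (diag ([1, 1] @ replicate (n-4) p @ [p^2, p^2])) f h = S True True"
    proof -
      have as: "[1, 1] @ replicate (n-4) p @ [p^2, p^2] = replicate 2 1 @ replicate (n-4) p @ replicate 2 (p * p)"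
        by (simp add: power2_eq_square numeral_2_eq_2)
      show ?thesis
        using hecke_diag(2)[OF f h as, of p] S[of True True] n p0 by simp
    qed
    let ?g = "\<lambda>D. of_nat (card (intermediates p (?H \<inter> D) ?H) * card (intermediates q (?H \<inter> D) D)) * ?F D"
    have g: "sum ?g {D\<in>?X. P D = s \<and> Q D = t} =
        (if s then of_nat p + 1 else 1) * (if t then of_nat p + 1 else 1) * S s t" for s t
    proof -
      have "?g D = (if s then of_nat p + 1 else 1) * (if t then of_nat p + 1 else 1) * ?F D"
        if "D \<in> {D\<in>?X. P D = s \<and> Q D = t}" for D
        using that card_intermediates[OF _ p q n2(2), of ?H D] True unfolding P_def Q_def by (auto simp: add.commute)
      then have "sum ?g {D\<in>?X. P D = s \<and> Q D = t} = (\<Sum>D\<in>{D\<in>?X. P D = s \<and> Q D = t}.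
          (if s then of_nat p + 1 else 1) * (if t then of_nat p + 1 else 1) * ?F D)"
        by (rule sum.cong[OF HOL.refl])
      then show ?thesis unfolding S_def by (simp only: sum_distrib_left)
    qed
    have sumX: "sum ?g ?X = S False False + (of_nat p + 1) * S True False + (of_nat p + 1) * S False True
        + (of_nat p + 1) ^ 2 * S True True"
      unfolding sum_bool_pairs[OF finX, of ?g P Q]
      using g[of False False] g[of True False] g[of False True] g[of True True]
      by (simp add: power2_eq_square)
    have ne: "of_nat p - 1 \<noteq> (0 :: complex)" using p0 by (metis eq_iff_diff_eq_0 less_irrefl of_nat_1 of_nat_eq_iff)
    have c: "of_nat c = (of_nat p ^ n - 1) / (of_nat p - 1 :: complex)"
    proof -
      have "of_nat ((p - 1) * c) = (of_nat (p ^ n - 1) :: complex)"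
        unfolding c_def using card_superlattices(2)[OF H p] n by simp
      then have "(of_nat p - 1) * of_nat c = (of_nat p ^ n - 1 :: complex)"
        using p0 by (simp add: of_nat_diff)
      then show ?thesis using ne by (simp add: nonzero_eq_divide_eq mult.commute)
    qed
    \<comment> \<open>The numerator is 2(p^n - 1) - (p + 3)(p - 1).\<close>
    have c1: "2 * of_nat c - of_nat p - 3 =
        (2 * of_nat p ^ n - of_nat p ^ 2 - 2 * of_nat p + 1) / (of_nat p - 1 :: complex)"
      unfolding c using ne by (simp add: field_simps power2_eq_square)
    have pn: "(of_nat p :: complex) ^ n = of_nat p * of_nat p ^ (n - 1)"
      using n by (metis power_Suc Suc_diff_1 less_le_trans zero_less_numeral)
    \<comment> \<open>Here c is the geometric sum 1 + p + ... + p^(n-1), so that c - 1 = p (p^(n-1)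
      - 1)/(p - 1).\<close>
    have c2: "of_nat c * of_nat c - of_nat c = of_nat p * (((of_nat p ^ (n-1) - 1) * (of_nat p ^ n - 1))
           / (of_nat p - 1 :: complex) ^ 2)"
    proof -
      have "of_nat c - 1 = of_nat p * (of_nat p ^ (n-1) - 1) / (of_nat p - 1 :: complex)"
        unfolding c pn using ne by (simp add: field_simps)
      then have "of_nat c * (of_nat c - 1) = (of_nat p ^ n - 1) / (of_nat p - 1)
          * (of_nat p * (of_nat p ^ (n-1) - 1) / (of_nat p - 1 :: complex))"
        unfolding c by simp
      moreover have "of_nat c * of_nat c - of_nat c = of_nat c * (of_nat c - 1 :: complex)"
        by (simp add: algebra_simps)
      ultimately show ?thesis by (simp add: power2_eq_square ac_simps)
    qed
    show ?thesis
      unfolding comp sumX TFF TTF TFT TTT theta(2)[OF p f h] c1 c2 on_lattice_lat[OF f h]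
      using True by simp
  qed
qed

theorem corollaryB:
  fixes p q n :: nat
    and f :: "'n::{finite,linorder} rmat \<Rightarrow> complex"
    and h :: "'n rmat"
  assumes "n = CARD('n)" and "n \<ge> 4"
    and "prime p" and "prime q"
    and "maass_cusp_form f" and "h \<in> GL_real"
  shows
    "(hecke (diag ([1] @ replicate (n-1) p)) \<circ> hecke (diag (replicate (n-1) 1 @ [q]))) f h =
       hecke (diag ([1] @ replicate (n-2) p @ [p*q])) f h
       + of_bool (p = q) * ((of_nat p ^ n - 1) / (of_nat p - 1)) * f h
     \<and>
     (hecke (diag ([1] @ replicate (n-2) p @ [p^2])) \<circ>
        hecke (diag ([1] @ replicate (n-2) q @ [q^2]))) f h =
       hecke (diag ([1] @ replicate (n-2) (p*q) @ [(p*q)^2])) f h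
       + of_bool (p = q) * ((2 * of_nat p ^ n - of_nat p ^ 2 - 2 * of_nat p + 1) / (of_nat p - 1))
           * hecke (diag ([1] @ replicate (n-2) p @ [p^2])) f h
       + of_bool (p = q) * (of_nat p * (((of_nat p ^ (n-1) - 1) * (of_nat p ^ n - 1))
           / (of_nat p - 1) ^ 2)) * f h
       + of_bool (p = q) * (of_nat p + 1)
           * hecke (diag ([1] @ replicate (n-3) (p^2) @ [p^3, p^3])) f h
       + of_bool (p = q) * (of_nat p + 1)
           * hecke (diag ([1, 1] @ replicate (n-3) p @ [p^3])) f h
       + of_bool (p = q) * (of_nat p + 1) ^ 2
           * hecke (diag ([1, 1] @ replicate (n-4) p @ [p^2, p^2])) f h"
proof
  have f: "hecke_invariant f" using assms maass_cusp_form_invariant by blast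
  have h: "invertible h" using assms unfolding GL_real_def by simp
  show "(hecke (diag ([1] @ replicate (n-1) p)) \<circ> hecke (diag (replicate (n-1) 1 @ [q]))) f h =
       hecke (diag ([1] @ replicate (n-2) p @ [p*q])) f h
       + of_bool (p = q) * ((of_nat p ^ n - 1) / (of_nat p - 1)) * f h"
    using assms by (intro hecke_first_identity f h) auto
qed (rule hecke_second_identity[OF assms(1-4)];
  use assms maass_cusp_form_invariant in \<open>simp add: GL_real_def\<close>)

end
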